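(* Let $\alpha\in(0,1]$ and let $(X_i)_{i\in\mathbb N}$ be a stationary $\mathbb R^d$-valued process with continuous multidimensional distribution function $F$. Assume: (i) for every $f\in\mathcal H_\alpha$ with ${\rm E}f(X_0)=0$ there is $\sigma_f^2<\infty$ with $\frac1{\sqrt n}\sum_{i=1}^nf(X_i)\to N(0,\sigma_f^2)$ in distribution; (ii) there are constants $\beta>0$, $\gamma>1$, $r\ge1$, an integer $p>rd$, $\kappa_1,\dots,\kappa_p>0$, $\lambda>1$, $z_0\in\mathbb R^+$ and an invertible increasing function $\Phi:\mathbb R_0^+\to\mathbb R_0^+$ such that $w_F(y)\le\beta\,\Phi(y^{-\alpha})^{-\gamma}$ for all $y>0$, $\kappa_i<\gamma\big(\frac ir+2(p-i)-d\big)$ for $i=1,\dots,p$, $\Phi(2z)\le\lambda\Phi(z)$ for all $z\ge z_0$, and such that for all $f\in\mathcal H_\alpha$ with $\|f\|_\infty\le1$ and all $n\ge1$ $${\rm E}\Big|\sum_{i=1}^n\big(f(X_i)-{\rm E}f(X_0)\big)\Big|^{2p}\le C\sum_{i=1}^p n^i\,\|f(X_0)-{\rm E}f(X_0)\|_r^i\,\Phi^{\kappa_i}\big(\|f-{\rm E}f(X_0)\|_{\mathcal H_\alpha}\big)$$ for some constant $C>0$. Then there is a centered Gaussian process $(W(t))_{t\in[-\infty,\infty]^d}$ with almost surely continuous sample paths such that $U_n\to W$ in distribution in $\mathbb D([-\infty,\infty]^d)$.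
   Context: $\mathcal H_\alpha$ is the space of bounded functions $f:\mathbb R^d\to\mathbb R$ with finite norm $\|f\|_{\mathcal H_\alpha}=\|f\|_\infty+\sup_{x\ne y}\frac{|f(x)-f(y)|}{\|x-y\|^\alpha}$. $\|\cdot\|_r$ is the $L^r$ norm; $\Phi^{\kappa}(x)=(\Phi(x))^\kappa$. Modulus of continuity: $w_F(\delta)=\sup\{|F(t)-F(s)|:\|t-s\|\le\delta\}$. Inequalities between vectors are componentwise, $F(t)=P(X_0\le t)$. Empirical process $U_n(t)=\frac1{\sqrt n}\sum_{i=1}^n(\mathbf 1\{X_i\le t\}-F(t))$, $t\in[-\infty,\infty]^d$, a random element of $\mathbb D([-\infty,\infty]^d)$ (multidimensional càdlàg functions with the multidimensional Skorokhod metric). *)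

theory Defs
  imports "HOL-Probability.Probability"
begin

definition normal_law :: "real \<Rightarrow> real measure" where
  "normal_law \<sigma> = (if \<sigma> = 0 then return borel 0 else density lborel (normal_density 0 \<sigma>))"

definition centered_gaussian_rv :: "'w measure \<Rightarrow> ('w \<Rightarrow> real) \<Rightarrow> bool" where
  "centered_gaussian_rv N Y \<longleftrightarrow>
     Y \<in> borel_measurable N \<and> (\<exists>\<sigma>\<ge>0. distr N borel Y = normal_law \<sigma>)"

definition centered_gaussian_process :: "'w measure \<Rightarrow> ('t \<Rightarrow> 'w \<Rightarrow> real) \<Rightarrow> bool" where
  "centered_gaussian_process N W \<longleftrightarrow>
     (\<forall>t. W t \<in> borel_measurable N) \<and>
     (\<forall>T c. finite T \<longrightarrow> centered_gaussian_rv N (\<lambda>\<omega>. \<Sum>t\<in>T. c t * W t \<omega>))"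

definition stationary :: "'a measure \<Rightarrow> (nat \<Rightarrow> 'a \<Rightarrow> 'b::topological_space) \<Rightarrow> bool" where
  "stationary M X \<longleftrightarrow>
     (\<forall>k. distr M (PiM UNIV (\<lambda>_. borel)) (\<lambda>\<omega> i. X (i + k) \<omega>)
          = distr M (PiM UNIV (\<lambda>_. borel)) (\<lambda>\<omega> i. X i \<omega>))"

definition dfun :: "'a measure \<Rightarrow> (nat \<Rightarrow> 'a \<Rightarrow> real^'d) \<Rightarrow> real^'d \<Rightarrow> real" where
  "dfun M X t = measure M {\<omega> \<in> space M. \<forall>j. X 0 \<omega> $ j \<le> t $ j}"

definition ext_le :: "real^'d \<Rightarrow> ereal^'d \<Rightarrow> bool" where
  "ext_le x t \<longleftrightarrow> (\<forall>j. ereal (x $ j) \<le> t $ j)"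

definition dfun_ext :: "'a measure \<Rightarrow> (nat \<Rightarrow> 'a \<Rightarrow> real^'d) \<Rightarrow> ereal^'d \<Rightarrow> real" where
  "dfun_ext M X t = measure M {\<omega> \<in> space M. ext_le (X 0 \<omega>) t}"

definition empirical_process ::
  "'a measure \<Rightarrow> (nat \<Rightarrow> 'a \<Rightarrow> real^'d) \<Rightarrow> nat \<Rightarrow> 'a \<Rightarrow> ereal^'d \<Rightarrow> real" where
  "empirical_process M X n \<omega> t =
     (\<Sum>i=1..n. (if ext_le (X i \<omega>) t then 1 else 0) - dfun_ext M X t) / sqrt (real n)"

definition modulus :: "('v::real_normed_vector \<Rightarrow> real) \<Rightarrow> real \<Rightarrow> real" where
  "modulus F \<delta> = (SUP p\<in>{(t, s). norm (t - s) \<le> \<delta>}. \<bar>F (fst p) - F (snd p)\<bar>)"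

definition sup_norm :: "('v \<Rightarrow> real) \<Rightarrow> real" where
  "sup_norm f = (SUP x. \<bar>f x\<bar>)"

definition holder_const :: "real \<Rightarrow> ('v::real_normed_vector \<Rightarrow> real) \<Rightarrow> real" where
  "holder_const \<alpha> f =
     (SUP p\<in>{(x, y). x \<noteq> y}. \<bar>f (fst p) - f (snd p)\<bar> / norm (fst p - snd p) powr \<alpha>)"

definition holder_space :: "real \<Rightarrow> ('v::real_normed_vector \<Rightarrow> real) set" where
  "holder_space \<alpha> = {f. bounded (range f) \<and>
      bdd_above {\<bar>f x - f y\<bar> / norm (x - y) powr \<alpha> | x y. x \<noteq> y}}"

definition holder_norm :: "real \<Rightarrow> ('v::real_normed_vector \<Rightarrow> real) \<Rightarrow> real" where
  "holder_norm \<alpha> f = sup_norm f + holder_const \<alpha> f"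

definition quadrant :: "ereal^'d \<Rightarrow> ('d \<Rightarrow> bool) \<Rightarrow> (ereal^'d) set" where
  "quadrant t R = {s. \<forall>j. if R j then s $ j < t $ j else t $ j \<le> s $ j}"

text \<open>Neuhaus/Bickel-Wichura: limits exist along every quadrant, and the function
  is continuous from above (along the closed upper quadrant).\<close>
definition Dspace :: "(ereal^'d \<Rightarrow> real) set" where
  "Dspace = {x. \<forall>t. (\<forall>R. \<exists>l. (x \<longlongrightarrow> l) (at t within quadrant t R)) \<and>
                    (x \<longlongrightarrow> x t) (at t within quadrant t (\<lambda>_. False))}"

text \<open>A homeomorphism of [-infinity,infinity] onto [-pi/2,pi/2], used to metrize the time axis.\<close>
definition ext_arctan :: "ereal \<Rightarrow> real" where
  "ext_arctan t = (case t of ereal r \<Rightarrow> arctan r | PInfty \<Rightarrow> pi / 2 | MInfty \<Rightarrow> - (pi / 2))"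

definition time_changes :: "('d \<Rightarrow> ereal \<Rightarrow> ereal) set" where
  "time_changes = {l. \<forall>j. strict_mono (l j) \<and> surj (l j)}"

definition skor_dist :: "(ereal^'d \<Rightarrow> real) \<Rightarrow> (ereal^'d \<Rightarrow> real) \<Rightarrow> real" where
  "skor_dist x y = (INF l\<in>time_changes.
      max (SUP t. \<bar>x t - y (\<chi> j. l j (t $ j))\<bar>)
          (SUP p. \<bar>ext_arctan (l (fst p) (snd p)) - ext_arctan (snd p)\<bar>))"

definition skor_continuous :: "((ereal^'d \<Rightarrow> real) \<Rightarrow> real) \<Rightarrow> bool" where
  "skor_continuous g \<longleftrightarrow>
     (\<forall>x\<in>Dspace. \<forall>e>0. \<exists>\<delta>>0. \<forall>y\<in>Dspace. skor_dist x y < \<delta> \<longrightarrow> \<bar>g y - g x\<bar> < e)"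

end

(*
Indicators of lower orthants are sandwiched between products of piecewise linear functions that
drop from 1 to 0 between neighbouring dyadic quantiles of the marginals. The modulus of continuity
bounds the growth of Phi along the Hoelder constants of these functions from above, and the
condition on kappa is exactly what makes the moment bound summable when one chains over the grids
of level k with 2^k up to a multiple of sqrt n; at the last level the means of the two sandwiching
functions differ by O(2^-k), which is absorbed by the multiple. Hence the empirical process is
uniformly close, in expectation, to a continuous interpolation of finitely many normalised sums.

The normalised sums of all grid functions converge jointly to a Gaussian family: their covariances
converge because of the uniformly bounded moments, the limit kernel is realised by Cholesky
factorisation, and characteristic functions give convergence of expectations of bounded Lipschitz
functions after Gaussian smoothing (Scheffe). The same chaining makes the interpolations of the
Gaussian family converge uniformly almost surely, to a continuous limit W.

A Skorokhod continuous functional g is continuous for the uniform distance on the whole space, so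
it is the increasing limit of functionals g_k that are k-Lipschitz for that distance. For g_k the
comparison with interpolations passes to the limit, which bounds liminf E g(U_n) from below by
E g(W); the same for -g finishes the proof. The Skorokhod topology itself only enters in the
measurability of g(U_n): rounding the observations to a fine lattice moves the paths little in the
Skorokhod distance, though not uniformly.
*)

theory Submission
  imports Defs
begin

section \<open>Gaussian families\<close>

text \<open>The central limit theorem and the moment bound are given for Hoelder functions only,
  while the process is indexed by indicators, and both degrade as the approximation sharpens. Two
  constraints meet at the last level k. The moment bound carries factors n^(i-p), which absorb a
  growth like 4^(k(p-i)) only while 4^k is at most a multiple of n. The sandwich leaves a bias of
  order sqrt n / 2^k, which becomes small when 2^k is a large multiple of sqrt n, but does not
  vanish. Both are met for 2^k between a sqrt n and 2 a sqrt n, where a is chosen after the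
  Lipschitz constant of the functional. On the scale of the marginal distribution functions the
  probability of a coordinate strip is bounded by its width, and time becomes the unit cube, so that
  the limit is continuous up to the infinite times. No sigma-algebra is prescribed on the Skorokhod
  space; the limit law is carried there together with the largest one that makes the limit process
  measurable.\<close>

definition psd_kernel :: "('s \<Rightarrow> 's \<Rightarrow> real) \<Rightarrow> bool" where
  "psd_kernel K \<longleftrightarrow> (\<forall>i j. K i j = K j i) \<and>
     (\<forall>S c. finite S \<longrightarrow> 0 \<le> (\<Sum>i\<in>S. \<Sum>j\<in>S. c i * c j * K i j))"

text \<open>The quadratic form at e_i + t e_a is \<open>K i i + 2 * t * K i a\<close>, affine in t
  because \<open>K a a\<close> vanishes; an affine function that is bounded below has slope
  0.\<close>

lemma psd_kernel_zero_diag: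
  assumes K: "psd_kernel K" and a: "K a a = 0"
  shows "K i a = 0"
proof (cases "i = a")
  case False
  have 0: "0 \<le> (\<Sum>x\<in>{i,a}. \<Sum>y\<in>{i,a}. c x * c y * K x y)" for c
    using K unfolding psd_kernel_def by blast
  have sym: "K a i = K i a" using K unfolding psd_kernel_def by blast
  have 1: "0 \<le> K i i + 2 * t * K i a" for t
    using 0[of "\<lambda>x. if x = i then 1 else t"] False a sym by (simp add: algebra_simps)
  show ?thesis
  proof (rule ccontr)
    assume n: "K i a \<noteq> 0"
    have "2 * (-(K i i + 1) / (2 * K i a)) * K i a = - (K i i + 1)" using n by (simp add: field_simps)
    with 1[of "-(K i i + 1) / (2 * K i a)"] show False by simp
  qed
qed (use a in auto)

text \<open>For \<open>K a a\<close> nonzero, the form of the complement at c is the form of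
  \<open>K\<close> at c with the a-th coordinate lowered by B / \<open>K a a\<close>, the minimiser
  in that direction. For \<open>K a a\<close> = 0 the division convention leaves \<open>K\<close>
  unchanged.\<close>

lemma psd_kernel_schur:
  assumes K: "psd_kernel K"
  shows "psd_kernel (\<lambda>i j. K i j - K i a * K a j / K a a)"
  unfolding psd_kernel_def
proof (intro conjI allI impI)
  have sym: "K i j = K j i" for i j using K unfolding psd_kernel_def by blast
  show "K i j - K i a * K a j / K a a = K j i - K j a * K a i / K a a" for i j
    using sym[of i j] sym[of i a] sym[of j a] by simp
  fix S :: "'a set" and c :: "'a \<Rightarrow> real"
  assume fin: "finite S"
  have pos: "0 \<le> (\<Sum>i\<in>T. \<Sum>j\<in>T. c i * c j * K i j)" if "finite T" for T c
    using K that unfolding psd_kernel_def by blast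
  show "0 \<le> (\<Sum>i\<in>S. \<Sum>j\<in>S. c i * c j * (K i j - K i a * K a j / K a a))"
  proof (cases "K a a = 0")
    case True then show ?thesis using pos[OF fin] by simp
  next
    case False
    \<comment> \<open>The index a may lie outside S, so c is continued by 0 before its a-th
      coordinate is shifted.\<close>
    let ?T = "insert a S"
    define d where "d i = (if i \<in> S then c i else 0)" for i
    define B where "B = (\<Sum>i\<in>?T. d i * K i a)"
    define t where "t = B / K a a"
    define e where "e i = (if i = a then t else 0)" for i
    have finT: "finite ?T" using fin by simp
    have SS: "(\<Sum>i\<in>S. f i) = (\<Sum>i\<in>?T. if i \<in> S then f i else 0)" for f :: "'a \<Rightarrow> real"
      by (rule sum.mono_neutral_cong_left) (use fin in auto)
    have "(\<Sum>i\<in>S. \<Sum>j\<in>S. c i * c j * (K i j - K i a * K a j / K a a))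
       = (\<Sum>i\<in>?T. \<Sum>j\<in>?T. d i * d j * (K i j - K i a * K a j / K a a))"
      unfolding SS by (intro sum.cong refl) (auto simp: d_def intro!: sum.cong)
    also have "\<dots> = (\<Sum>i\<in>?T. \<Sum>j\<in>?T. d i * d j * K i j) - (\<Sum>i\<in>?T. \<Sum>j\<in>?T. (d i * K i a) * (d j * K j a)) / K a a"
    proof -
      have "d i * d j * (K i j - K i a * K a j / K a a)
          = d i * d j * K i j - (d i * K i a) * (d j * K j a) / K a a" for i j
        using sym[of a j] by (simp add: right_diff_distrib)
      then show ?thesis by (simp only: sum_subtractf sum_divide_distrib)
    qed
    also have "(\<Sum>i\<in>?T. \<Sum>j\<in>?T. (d i * K i a) * (d j * K j a)) = B * B"
      unfolding B_def sum_product ..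
    finally have 1: "(\<Sum>i\<in>S. \<Sum>j\<in>S. c i * c j * (K i j - K i a * K a j / K a a))
       = (\<Sum>i\<in>?T. \<Sum>j\<in>?T. d i * d j * K i j) - B * B / K a a" .
    have r1: "(\<Sum>j\<in>?T. e j * f j) = t * f a" for f
    proof -
      have "(\<Sum>j\<in>?T. e j * f j) = (\<Sum>j\<in>?T. if j = a then t * f a else 0)"
        by (intro sum.cong refl) (auto simp: e_def)
      then show ?thesis using finT by (simp only: sum.delta) simp
    qed
    have "(\<Sum>i\<in>?T. \<Sum>j\<in>?T. (d i - e i) * (d j - e j) * K i j) =
       (\<Sum>i\<in>?T. \<Sum>j\<in>?T. d i * d j * K i j) - (\<Sum>j\<in>?T. e j * (\<Sum>i\<in>?T. d i * K i j))
        - (\<Sum>i\<in>?T. e i * (\<Sum>j\<in>?T. d j * K i j)) + (\<Sum>i\<in>?T. e i * (\<Sum>j\<in>?T. e j * K i j))"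
    proof -
      have "(\<Sum>j\<in>?T. e j * (\<Sum>i\<in>?T. d i * K i j)) = (\<Sum>i\<in>?T. \<Sum>j\<in>?T. e j * d i * K i j)"
        unfolding sum_distrib_left by (subst sum.swap) (simp add: mult.assoc)
      moreover have "(d i - e i) * (d j - e j) * K i j
         = d i * d j * K i j - e j * d i * K i j - e i * (d j * K i j) + e i * (e j * K i j)" for i j
        by (simp add: algebra_simps)
      ultimately show ?thesis
        by (simp only: sum_subtractf sum.distrib sum_distrib_left)
    qed
    also have "\<dots> = (\<Sum>i\<in>?T. \<Sum>j\<in>?T. d i * d j * K i j) - t * B - t * B + t * t * K a a"
    proof -
      have "(\<Sum>j\<in>?T. d j * K a j) = B" unfolding B_def by (intro sum.cong refl) (metis sym)
      moreover have "(\<Sum>i\<in>?T. d i * K i a) = B" unfolding B_def ..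
      ultimately show ?thesis unfolding r1 by (simp only: mult.assoc)
    qed
    also have "\<dots> = (\<Sum>i\<in>?T. \<Sum>j\<in>?T. d i * d j * K i j) - B * B / K a a"
      using False by (simp add: t_def)
    finally show ?thesis using 1 pos[OF finT, of "\<lambda>i. d i - e i"] by simp
  qed
qed

text \<open>Cholesky elimination; a vanishing pivot is harmless because its whole row vanishes and x/0 = 0.\<close>
fun schur :: "(nat \<Rightarrow> nat \<Rightarrow> real) \<Rightarrow> nat \<Rightarrow> nat \<Rightarrow> nat \<Rightarrow> real" where
  "schur K 0 = K"
| "schur K (Suc k) = (\<lambda>i j. schur K k i j - schur K k i k * schur K k k j / schur K k k k)"

text \<open>Step k of the elimination subtracts a rank-one kernel and clears row k, and cleared rows
  stay clear. After n steps row i < n is empty, so \<open>K i j\<close> is the sum of the n terms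
  removed; j is arbitrary.\<close>

lemma psd_kernel_gram:
  fixes K :: "nat \<Rightarrow> nat \<Rightarrow> real"
  assumes K: "psd_kernel K"
  obtains v :: "nat \<Rightarrow> nat \<Rightarrow> real" where "\<And>i j n. i < n \<Longrightarrow> K i j = (\<Sum>k<n. v i k * v j k)"
proof -
  have psd: "psd_kernel (schur K k)" for k
    by (induction k) (use K psd_kernel_schur in auto)
  have sym: "schur K k i j = schur K k j i" for k i j
    using psd[of k] unfolding psd_kernel_def by blast
  have diag: "0 \<le> schur K k a a" for k a
    using psd[of k] unfolding psd_kernel_def
    by (auto dest!: conjunct2 spec[of _ "{a}"] spec[of _ "\<lambda>_. 1"])
  have zero: "schur K k i j = 0" if "i < k" for k i j
    using that
  proof (induction k arbitrary: i j)
    case (Suc k)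
    show ?case
    proof (cases "i = k")
      case True
      have "schur K k k j = 0" if "schur K k k k = 0"
        using psd_kernel_zero_diag[OF psd that] sym by metis
      then show ?thesis using True by auto
    next
      case False
      with Suc.prems have "i < k" by simp
      then show ?thesis using Suc.IH by simp
    qed
  qed auto
  have dec: "K i j = (\<Sum>k<n. schur K k i k * schur K k k j / schur K k k k) + schur K n i j" for n i j
    by (induction n) auto
  define v where "v i k = schur K k i k / sqrt (schur K k k k)" for i k
  have "K i j = (\<Sum>k<n. v i k * v j k)" if "i < n" for i j n
    unfolding dec[of i j n] zero[OF that] v_def using diag sym[of _ _ j]
    by (auto intro!: sum.cong)
  then show ?thesis using that by blast
qed

section \<open>Normal laws and their characteristic functions\<close>

lemma prob_space_normal_law: "0 \<le> \<sigma> \<Longrightarrow> prob_space (normal_law \<sigma>)"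
  unfolding normal_law_def
  by (auto intro: prob_space_normal_density prob_space_return)

lemma sets_normal_law [simp, measurable_cong]: "sets (normal_law \<sigma>) = sets borel"
  by (simp add: normal_law_def)

lemma real_distribution_normal_law: "0 \<le> \<sigma> \<Longrightarrow> real_distribution (normal_law \<sigma>)"
  using prob_space_normal_law
  by (auto simp: real_distribution_def real_distribution_axioms_def)

lemma distr_std_normal_scale:
  assumes "0 \<le> \<sigma>"
  shows "distr std_normal_distribution borel (\<lambda>x. \<sigma> * x) = normal_law \<sigma>"
proof (cases "\<sigma> = 0")
  case True
  interpret prob_space std_normal_distribution by (rule prob_space_normal_density) simp
  show ?thesis using True by (simp add: normal_law_def distr_const)
next
  case False
  interpret prob_space std_normal_distribution by (rule prob_space_normal_density) simp
  have "distributed std_normal_distribution lborel (\<lambda>x. x) std_normal_density"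
    by (auto simp: distributed_def intro!: distr_id2)
  from normal_density_affine[OF this, of \<sigma> 0] False assms
  have "distributed std_normal_distribution lborel (\<lambda>x. \<sigma> * x) (normal_density 0 \<sigma>)" by simp
  then have "distr std_normal_distribution lborel (\<lambda>x. \<sigma> * x) = density lborel (normal_density 0 \<sigma>)"
    by (simp add: distributed_def)
  moreover have "distr std_normal_distribution lborel (\<lambda>x. \<sigma> * x) = distr std_normal_distribution borel (\<lambda>x. \<sigma> * x)"
    by (rule distr_cong) auto
  ultimately show ?thesis using False by (simp add: normal_law_def)
qed

lemma char_distr_borel:
  assumes [measurable]: "Y \<in> borel_measurable M"
  shows "char (distr M borel Y) t = (\<integral>\<omega>. iexp (t * Y \<omega>) \<partial>M)"
  unfolding char_def by (subst integral_distr) auto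

lemma char_normal_law:
  assumes "0 \<le> \<sigma>"
  shows "char (normal_law \<sigma>) t = exp (- (\<sigma>\<^sup>2 * t\<^sup>2) / 2)"
proof -
  have "char (normal_law \<sigma>) t = char std_normal_distribution (t * \<sigma>)"
    unfolding distr_std_normal_scale[OF assms, symmetric]
    by (subst char_distr_borel) (auto simp: char_def mult.assoc)
  also have "\<dots> = exp (- (\<sigma>\<^sup>2 * t\<^sup>2) / 2)"
    by (simp add: char_std_normal_distribution power_mult_distrib mult.commute exp_of_real[symmetric])
  finally show ?thesis .
qed

lemma distr_eq_normal_lawI:
  assumes P: "prob_space P" and Y: "Y \<in> borel_measurable P" and s: "0 \<le> \<sigma>"
    and ch: "\<And>t. char (distr P borel Y) t = exp (- (\<sigma>\<^sup>2 * t\<^sup>2) / 2)"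
  shows "distr P borel Y = normal_law \<sigma>"
proof -
  interpret prob_space P by fact
  show ?thesis
    by (rule Levy_uniqueness)
      (use Y s ch in \<open>auto simp: real_distribution_normal_law char_normal_law real_distribution_distr\<close>)
qed

text \<open>\<open>Z s\<close> combines independent standard normal variables with the Gram
  coefficients of row s; characteristic functions then identify the law of every linear
  combination.\<close>

lemma gaussian_family_exists:
  fixes K :: "'s::countable \<Rightarrow> 's \<Rightarrow> real"
  assumes K: "psd_kernel K"
  obtains P :: "(nat \<Rightarrow> real) measure" and Z
  where "prob_space P" "\<And>s. Z s \<in> borel_measurable P"
    "\<And>S c. finite S \<Longrightarrow> distr P borel (\<lambda>\<omega>. \<Sum>s\<in>S. c s * Z s \<omega>)
        = normal_law (sqrt (\<Sum>s\<in>S. \<Sum>t\<in>S. c s * c t * K s t))"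
proof -
  \<comment> \<open>\<open>to_nat\<close> need not be onto; off its range the kernel is continued by
    0, which keeps it positive semidefinite.\<close>
  define R where "R = range (to_nat :: 's \<Rightarrow> nat)"
  define L :: "nat \<Rightarrow> nat \<Rightarrow> real" where
    "L m n = (if m \<in> R \<and> n \<in> R then K (from_nat m) (from_nat n) else 0)" for m n
  have fn: "from_nat (to_nat s) = s" for s :: 's by simp
  have "psd_kernel L"
    unfolding psd_kernel_def
  proof (intro conjI allI impI)
    show "L i j = L j i" for i j using K unfolding psd_kernel_def L_def by auto
    fix S :: "nat set" and c :: "nat \<Rightarrow> real" assume fin: "finite S"
    define T where "T = (from_nat :: nat \<Rightarrow> 's) ` (S \<inter> R)"
    have inj: "inj_on (from_nat :: nat \<Rightarrow> 's) (S \<inter> R)" by (auto simp: inj_on_def R_def)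
    have SS: "(\<Sum>i\<in>S. if i \<in> R then f i else 0) = (\<Sum>i\<in>S \<inter> R. f i)" for f :: "nat \<Rightarrow> real"
      by (rule sum.mono_neutral_cong_right) (use fin in auto)
    have "(\<Sum>i\<in>S. \<Sum>j\<in>S. c i * c j * L i j)
       = (\<Sum>i\<in>S. if i \<in> R then (\<Sum>j\<in>S. if j \<in> R then c i * c j * K (from_nat i) (from_nat j) else 0) else 0)"
      by (intro sum.cong refl) (auto simp: L_def intro!: sum.cong sum.neutral)
    also have "\<dots> = (\<Sum>i\<in>S \<inter> R. \<Sum>j\<in>S \<inter> R. c i * c j * K (from_nat i) (from_nat j))" unfolding SS ..
    also have "\<dots> = (\<Sum>i\<in>S \<inter> R. \<Sum>j\<in>S \<inter> R. c (to_nat (from_nat i::'s)) * c (to_nat (from_nat j::'s)) * K (from_nat i) (from_nat j))"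
      by (intro sum.cong refl) (auto simp: R_def)
    also have "\<dots> = (\<Sum>s\<in>T. \<Sum>t\<in>T. c (to_nat s) * c (to_nat t) * K s t)"
      unfolding T_def by (simp add: sum.reindex[OF inj])
    also have "\<dots> \<ge> 0"
    proof -
      have "\<forall>S c. finite S \<longrightarrow> 0 \<le> (\<Sum>i\<in>S. \<Sum>j\<in>S. c i * c j * K i j)" using K unfolding psd_kernel_def by simp
      from this[rule_format, of T "\<lambda>s. c (to_nat s)"] show ?thesis using fin unfolding T_def by simp
    qed
    finally show "0 \<le> (\<Sum>i\<in>S. \<Sum>j\<in>S. c i * c j * L i j)" .
  qed
  then obtain v where v: "\<And>i j n. i < n \<Longrightarrow> L i j = (\<Sum>k<n. v i k * v j k)"
    using psd_kernel_gram by blast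
  let ?N = "std_normal_distribution"
  interpret N: prob_space ?N by (rule prob_space_normal_density) simp
  define P where "P = PiM UNIV (\<lambda>_::nat. ?N)"
  interpret product_prob_space "\<lambda>_::nat. ?N" UNIV by unfold_locales
  interpret Q: prob_space P unfolding P_def by (rule prob_space_PiM) (rule N.prob_space_axioms)
  have comp: "(\<lambda>\<omega>. \<omega> k) \<in> borel_measurable P" for k
  proof -
    have "(\<lambda>\<omega>. \<omega> k) \<in> measurable P ?N" unfolding P_def by (rule measurable_component_singleton) auto
    then show ?thesis by (simp cong: measurable_cong_sets)
  qed
  define Z where "Z s \<omega> = (\<Sum>k\<le>to_nat s. v (to_nat s) k * \<omega> k)" for s :: 's and \<omega> :: "nat \<Rightarrow> real"
  have Zm [measurable]: "Z s \<in> borel_measurable P" for s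
    unfolding Z_def using comp by measurable
  have indep: "Q.indep_vars (\<lambda>_. borel) (\<lambda>k \<omega>. \<omega> k) (UNIV :: nat set)"
  proof (subst Q.indep_vars_iff_distr_eq_PiM)
    have "distr P (Pi\<^sub>M UNIV (\<lambda>i. borel)) (\<lambda>x. \<lambda>i\<in>UNIV. x i) = distr P P (\<lambda>x. x)"
      by (rule distr_cong) (auto simp: P_def intro!: sets_PiM_cong)
    also have "\<dots> = P" by (rule distr_id2) simp
    also have "P = Pi\<^sub>M UNIV (\<lambda>i. distr P borel (\<lambda>\<omega>. \<omega> i))"
    proof -
      have "distr P borel (\<lambda>\<omega>. \<omega> i) = ?N" for i
      proof -
        have "distr P borel (\<lambda>\<omega>. \<omega> i) = distr P ?N (\<lambda>\<omega>. \<omega> i)" by (rule distr_cong) auto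
        also have "\<dots> = ?N" unfolding P_def by (rule PiM_component) simp
        finally show ?thesis .
      qed
      then show ?thesis unfolding P_def by simp
    qed
    finally show "distr P (Pi\<^sub>M UNIV (\<lambda>i. borel)) (\<lambda>x. \<lambda>i\<in>UNIV. x i) = Pi\<^sub>M UNIV (\<lambda>i. distr P borel (\<lambda>\<omega>. \<omega> i))" .
  qed (use comp in auto)
  have dN: "distr P borel (\<lambda>\<omega>. \<omega> i) = ?N" for i
  proof -
    have "distr P borel (\<lambda>\<omega>. \<omega> i) = distr P ?N (\<lambda>\<omega>. \<omega> i)" by (rule distr_cong) auto
    also have "\<dots> = ?N" unfolding P_def by (rule PiM_component) simp
    finally show ?thesis .
  qed
  have main: "distr P borel (\<lambda>\<omega>. \<Sum>s\<in>S. c s * Z s \<omega>)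
        = normal_law (sqrt (\<Sum>s\<in>S. \<Sum>t\<in>S. c s * c t * K s t))" if fin: "finite S" for S c
  proof -
    have "\<exists>n. \<forall>s\<in>S. to_nat s < n"
      using fin by (metis bounded_nat_set_is_finite finite_imageI finite_nat_set_iff_bounded image_eqI)
    then obtain n where n: "\<And>s. s \<in> S \<Longrightarrow> to_nat s < n" by blast
    define a where "a k = (\<Sum>s\<in>S. c s * v (to_nat s) k)" for k
    \<comment> \<open>Comparing the factorisations of \<open>L i i\<close> with k and with k + 1
      terms gives \<open>v i k * v i k\<close> = 0. The factor is triangular, so the finite sum in
      \<open>Z s\<close> carries the whole Gram row.\<close>
    have v0: "v i k = 0" if "i < k" for i k
      using v[of i "Suc k" i] v[of i "k" i] that by simp
    have "(\<Sum>s\<in>S. c s * Z s \<omega>) = (\<Sum>k<n. a k * \<omega> k)" for \<omega>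
    proof -
      have "Z s \<omega> = (\<Sum>k<n. v (to_nat s) k * \<omega> k)" if "s \<in> S" for s
        unfolding Z_def using n[OF that] by (intro sum.mono_neutral_left) (auto simp: v0)
      then have "(\<Sum>s\<in>S. c s * Z s \<omega>) = (\<Sum>s\<in>S. \<Sum>k<n. c s * v (to_nat s) k * \<omega> k)"
        by (simp add: sum_distrib_left mult.assoc)
      also have "\<dots> = (\<Sum>k<n. a k * \<omega> k)"
        by (subst sum.swap) (simp add: a_def sum_distrib_right)
      finally show ?thesis .
    qed
    then have e1: "(\<lambda>\<omega>. \<Sum>s\<in>S. c s * Z s \<omega>) = (\<lambda>\<omega>. \<Sum>k<n. a k * \<omega> k)" by auto
    have "(\<Sum>k<n. (a k)\<^sup>2) = (\<Sum>s\<in>S. \<Sum>t\<in>S. \<Sum>k<n. c s * c t * (v (to_nat s) k * v (to_nat t) k))"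
    proof -
      have "(\<Sum>k<n. (a k)\<^sup>2) = (\<Sum>k<n. \<Sum>s\<in>S. \<Sum>t\<in>S. c s * c t * (v (to_nat s) k * v (to_nat t) k))"
        by (simp add: a_def power2_eq_square sum_product ac_simps)
      also have "\<dots> = (\<Sum>s\<in>S. \<Sum>t\<in>S. \<Sum>k<n. c s * c t * (v (to_nat s) k * v (to_nat t) k))"
        by (subst sum.swap, intro sum.cong refl, subst sum.swap, rule refl)
      finally show ?thesis .
    qed
    also have "\<dots> = (\<Sum>s\<in>S. \<Sum>t\<in>S. c s * c t * L (to_nat s) (to_nat t))"
      by (intro sum.cong refl) (simp add: v[OF n] sum_distrib_left)
    also have "\<dots> = (\<Sum>s\<in>S. \<Sum>t\<in>S. c s * c t * K s t)" by (simp add: L_def R_def)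
    finally have e2: "(\<Sum>k<n. (a k)\<^sup>2) = (\<Sum>s\<in>S. \<Sum>t\<in>S. c s * c t * K s t)" .
    have ind: "Q.indep_vars (\<lambda>_. borel) (\<lambda>k \<omega>. a k * \<omega> k) {..<n}"
      using Q.indep_vars_compose2[OF Q.indep_vars_subset[OF indep, of "{..<n}"], of "\<lambda>k x. a k * x" "\<lambda>_. borel"] by simp
    have "char (distr P borel (\<lambda>\<omega>. \<Sum>k<n. a k * \<omega> k)) t = exp (- ((\<Sum>k<n. (a k)\<^sup>2) * t\<^sup>2) / 2)" for t
    proof -
      have "char (distr P borel (\<lambda>\<omega>. \<Sum>k<n. a k * \<omega> k)) t = (\<Prod>k<n. char (distr P borel (\<lambda>\<omega>. a k * \<omega> k)) t)"
        by (rule Q.char_distr_sum[OF ind])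
      also have "\<dots> = (\<Prod>k<n. complex_of_real (exp (- ((a k)\<^sup>2 * t\<^sup>2) / 2)))"
      proof (intro prod.cong refl)
        fix k
        have "char (distr P borel (\<lambda>\<omega>. a k * \<omega> k)) t = char (distr P borel (\<lambda>\<omega>. \<omega> k)) (t * a k)"
          by (subst (1 2) char_distr_borel) (use comp in \<open>auto simp: mult.assoc\<close>)
        also have "\<dots> = char (normal_law 1) (t * a k)"
          unfolding dN by (simp add: normal_law_def)
        also have "\<dots> = exp (- ((a k)\<^sup>2 * t\<^sup>2) / 2)"
          by (subst char_normal_law) (auto simp: power_mult_distrib mult.commute)
        finally show "char (distr P borel (\<lambda>\<omega>. a k * \<omega> k)) t = complex_of_real (exp (- ((a k)\<^sup>2 * t\<^sup>2) / 2))" .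
      qed
      also have "\<dots> = exp (- ((\<Sum>k<n. (a k)\<^sup>2) * t\<^sup>2) / 2)"
        by (simp only: of_real_prod[symmetric] exp_sum[symmetric, OF finite_lessThan])
           (simp add: sum_distrib_right sum_negf sum_divide_distrib[symmetric])
      finally show ?thesis .
    qed
    then have "distr P borel (\<lambda>\<omega>. \<Sum>k<n. a k * \<omega> k) = normal_law (sqrt (\<Sum>k<n. (a k)\<^sup>2))"
      by (intro distr_eq_normal_lawI Q.prob_space_axioms)
         (use comp in \<open>auto simp: sum_nonneg\<close>)
    then show ?thesis unfolding e1 e2 .
  qed
  show ?thesis using that[OF Q.prob_space_axioms Zm main] by blast
qed

section \<open>A multivariate continuity theorem\<close>

text \<open>Density at y of the point z perturbed by independent centred Gaussian noise of standard
  deviation \<open>\<tau>\<close>. Averaged over the law of a random vector, it is the density of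
  the smoothed vector.\<close>

definition gauss_kernel :: "'s set \<Rightarrow> real \<Rightarrow> ('s \<Rightarrow> real) \<Rightarrow> ('s \<Rightarrow> real) \<Rightarrow> real" where
  "gauss_kernel S \<tau> z y = (\<Prod>s\<in>S. normal_density (z s) \<tau> (y s))"

lemma gauss_kernel_nonneg: "0 \<le> gauss_kernel S \<tau> z y"
  by (auto simp: gauss_kernel_def intro!: prod_nonneg)

lemma borel_measurable_gauss_kernel:
  assumes "\<And>s. s \<in> S \<Longrightarrow> (\<lambda>x. z x s) \<in> borel_measurable M"
    and "\<And>s. s \<in> S \<Longrightarrow> (\<lambda>x. y x s) \<in> borel_measurable M"
  shows "(\<lambda>x. gauss_kernel S \<tau> (z x) (y x)) \<in> borel_measurable M"
proof -
  have 1: "(\<lambda>x. normal_density (z x s) \<tau> (y x s)) \<in> borel_measurable M" if "s \<in> S" for s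
  proof -
    note [measurable] = assms[OF that]
    show ?thesis unfolding normal_density_def by measurable
  qed
  then show ?thesis unfolding gauss_kernel_def by (rule borel_measurable_prod)
qed

interpretation lborel_product: product_sigma_finite "\<lambda>_::'s. lborel :: real measure"
  by unfold_locales

lemma integral_abs_le:
  fixes f g :: "'a \<Rightarrow> real"
  assumes f: "integrable M f" and g: "integrable M g" and le: "\<And>x. \<bar>f x\<bar> \<le> g x"
  shows "\<bar>integral\<^sup>L M f\<bar> \<le> integral\<^sup>L M g"
proof -
  have "(\<integral>x. \<bar>f x\<bar> \<partial>M) \<le> integral\<^sup>L M g"
    by (rule integral_mono) (use f g le in auto)
  with integral_abs_bound[of M f] show ?thesis by (rule order_trans)
qed

lemma gauss_kernel_integral:
  assumes [simp]: "finite S" and [arith]: "0 < \<tau>"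
  shows "integrable (PiM S (\<lambda>_. lborel)) (gauss_kernel S \<tau> z)"
    and "(\<integral>y. gauss_kernel S \<tau> z y \<partial>PiM S (\<lambda>_. lborel)) = 1"
proof -
  show "integrable (PiM S (\<lambda>_. lborel)) (gauss_kernel S \<tau> z)"
    unfolding gauss_kernel_def[abs_def]
    by (rule lborel_product.product_integrable_prod) auto
  show "(\<integral>y. gauss_kernel S \<tau> z y \<partial>PiM S (\<lambda>_. lborel)) = 1"
    unfolding gauss_kernel_def
    by (subst lborel_product.product_integral_prod) auto
qed

text \<open>The exact value is \<tau> sqrt(2/pi). This is what smoothing costs a Lipschitz function
  in one coordinate.\<close>

lemma gauss_kernel_first_moment:
  assumes [simp]: "finite S" "s \<in> S" and [arith]: "0 < \<tau>"
  shows "integrable (PiM S (\<lambda>_. lborel)) (\<lambda>y. \<bar>y s - z s\<bar> * gauss_kernel S \<tau> z y)"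
    and "(\<integral>y. \<bar>y s - z s\<bar> * gauss_kernel S \<tau> z y \<partial>PiM S (\<lambda>_. lborel)) \<le> \<tau>"
proof -
  define f where "f i x = (if i = s then normal_density (z i) \<tau> x * \<bar>x - z i\<bar> ^ 1 else normal_density (z i) \<tau> x)" for i x
  have eq: "\<bar>y s - z s\<bar> * gauss_kernel S \<tau> z y = (\<Prod>i\<in>S. f i (y i))" for y
  proof -
    have "(\<Prod>i\<in>S. f i (y i)) = f s (y s) * (\<Prod>i\<in>S-{s}. f i (y i))" by (rule prod.remove) auto
    also have "(\<Prod>i\<in>S-{s}. f i (y i)) = (\<Prod>i\<in>S-{s}. normal_density (z i) \<tau> (y i))"
      by (rule prod.cong) (auto simp: f_def)
    finally show ?thesis
      unfolding gauss_kernel_def prod.remove[OF \<open>finite S\<close> \<open>s \<in> S\<close>] by (simp add: f_def)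
  qed
  have int: "integrable lborel (f i)" for i
    using integrable_normal_moment_abs[of \<tau> "z i" 1] by (cases "i = s") (auto simp: f_def[abs_def])
  show "integrable (PiM S (\<lambda>_. lborel)) (\<lambda>y. \<bar>y s - z s\<bar> * gauss_kernel S \<tau> z y)"
    unfolding eq by (rule lborel_product.product_integrable_prod) (auto simp: int)
  have "(\<integral>y. \<bar>y s - z s\<bar> * gauss_kernel S \<tau> z y \<partial>PiM S (\<lambda>_. lborel)) = (\<Prod>i\<in>S. integral\<^sup>L lborel (f i))"
    unfolding eq by (rule lborel_product.product_integral_prod) (auto simp: int)
  also have "\<dots> = (\<Prod>i\<in>S. if i = s then \<tau> * sqrt (2 / pi) else 1)"
  proof (intro prod.cong refl)
    fix i
    show "integral\<^sup>L lborel (f i) = (if i = s then \<tau> * sqrt (2 / pi) else 1)"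
      using integral_normal_moment_abs_odd[of \<tau> "z i" 0] by (cases "i = s") (auto simp: f_def[abs_def])
  qed
  also have "\<dots> = \<tau> * sqrt (2 / pi)" by simp
  also have "\<dots> \<le> \<tau>" using pi_gt3 by (simp add: mult_left_le)
  finally show "(\<integral>y. \<bar>y s - z s\<bar> * gauss_kernel S \<tau> z y \<partial>PiM S (\<lambda>_. lborel)) \<le> \<tau>" .
qed

text \<open>Up to a constant, a centred normal density is itself the characteristic function of a
  normal law; read backwards, the kernel is a Gaussian average of exponentials in y - z.\<close>

lemma gauss_kernel_fourier:
  assumes [simp]: "finite S" and [arith]: "0 < \<tau>"
  shows "complex_of_real (gauss_kernel S \<tau> z y) = (1 / sqrt (2 * pi * \<tau>\<^sup>2)) ^ card S *
     (\<integral>\<theta>. iexp (\<Sum>s\<in>S. \<theta> s * (y s - z s) / \<tau>) \<partial>PiM S (\<lambda>_. std_normal_distribution))"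
proof -
  interpret N: prob_space std_normal_distribution by (rule prob_space_normal_density) simp
  interpret product_sigma_finite "\<lambda>_. std_normal_distribution" by unfold_locales
  have 1: "complex_of_real (normal_density (z s) \<tau> (y s)) = (1 / sqrt (2 * pi * \<tau>\<^sup>2)) *
      (\<integral>x. iexp (x * ((y s - z s) / \<tau>)) \<partial>std_normal_distribution)" for s
    using fun_cong[OF char_std_normal_distribution, of "(y s - z s) / \<tau>"]
    by (simp add: char_def normal_density_def power_divide mult.commute field_simps)
  have "(\<integral>\<theta>. iexp (\<Sum>s\<in>S. \<theta> s * (y s - z s) / \<tau>) \<partial>PiM S (\<lambda>_. std_normal_distribution))
     = (\<integral>\<theta>. (\<Prod>s\<in>S. iexp (\<theta> s * ((y s - z s) / \<tau>))) \<partial>PiM S (\<lambda>_. std_normal_distribution))"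
    by (simp add: exp_sum[symmetric] sum_distrib_left)
  also have "\<dots> = (\<Prod>s\<in>S. \<integral>x. iexp (x * ((y s - z s) / \<tau>)) \<partial>std_normal_distribution)"
    by (rule product_integral_prod) (auto intro!: N.integrable_const_bound[where B=1])
  finally show ?thesis
    unfolding gauss_kernel_def of_real_prod 1 prod.distrib by simp
qed

context
  fixes M :: "'w measure" and Z :: "'w \<Rightarrow> 's \<Rightarrow> real" and S :: "'s set" and \<tau> :: real
  assumes M: "prob_space M" and fin [simp]: "finite S" and tau [arith]: "0 < \<tau>"
    and Z: "\<And>s. s \<in> S \<Longrightarrow> (\<lambda>\<omega>. Z \<omega> s) \<in> borel_measurable M"
begin

interpretation M: prob_space M by (rule M)
interpretation L: finite_product_sigma_finite "\<lambda>_::'s. lborel :: real measure" S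
  by unfold_locales simp
interpretation MN: pair_sigma_finite M "PiM S (\<lambda>_. lborel :: real measure)" by unfold_locales

lemma measurable_gauss_kernel_pair:
  "(\<lambda>(\<omega>, y). gauss_kernel S \<tau> (Z \<omega>) y) \<in> borel_measurable (M \<Otimes>\<^sub>M PiM S (\<lambda>_. lborel))"
  unfolding split_beta
proof (rule borel_measurable_gauss_kernel)
  fix s assume s: "s \<in> S"
  show "(\<lambda>x. Z (fst x) s) \<in> borel_measurable (M \<Otimes>\<^sub>M PiM S (\<lambda>_. lborel))"
    using measurable_compose[OF measurable_fst Z[OF s]] .
  have "(\<lambda>x. snd x s) \<in> measurable (M \<Otimes>\<^sub>M PiM S (\<lambda>_. lborel)) lborel"
    by (rule measurable_compose[OF measurable_snd measurable_component_singleton[OF s]])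
  then show "(\<lambda>x. snd x s) \<in> borel_measurable (M \<Otimes>\<^sub>M PiM S (\<lambda>_. lborel))" by simp
qed

lemma integrable_gauss_kernel_pair:
  assumes h: "h \<in> borel_measurable (PiM S (\<lambda>_. lborel))" and B: "\<And>y. \<bar>h y\<bar> \<le> B"
  shows "integrable (M \<Otimes>\<^sub>M PiM S (\<lambda>_. lborel)) (\<lambda>(\<omega>, y). h y * gauss_kernel S \<tau> (Z \<omega>) y)"
proof -
  have "integrable (M \<Otimes>\<^sub>M PiM S (\<lambda>_. lborel)) (\<lambda>(\<omega>, y). gauss_kernel S \<tau> (Z \<omega>) y)"
  proof (rule MN.Fubini_integrable[OF measurable_gauss_kernel_pair])
    show "integrable M (\<lambda>x. \<integral>y. norm (case (x, y) of (\<omega>, y) \<Rightarrow> gauss_kernel S \<tau> (Z \<omega>) y) \<partial>PiM S (\<lambda>_. lborel))"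
      by (simp add: gauss_kernel_nonneg gauss_kernel_integral)
  qed (simp add: gauss_kernel_integral)
  from integrable_mult_right[OF this, of B] show ?thesis
  proof (rule Bochner_Integration.integrable_bound)
    show "(\<lambda>(\<omega>, y). h y * gauss_kernel S \<tau> (Z \<omega>) y) \<in> borel_measurable (M \<Otimes>\<^sub>M PiM S (\<lambda>_. lborel))"
      using borel_measurable_times[OF measurable_compose[OF measurable_snd h] measurable_gauss_kernel_pair]
      by (simp add: split_beta)
    have "0 \<le> B" using B[of undefined] by simp
    then show "AE x in M \<Otimes>\<^sub>M PiM S (\<lambda>_. lborel). norm (case x of (\<omega>, y) \<Rightarrow> h y * gauss_kernel S \<tau> (Z \<omega>) y)
        \<le> norm (B * (case x of (\<omega>, y) \<Rightarrow> gauss_kernel S \<tau> (Z \<omega>) y))"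
      using B gauss_kernel_nonneg by (intro AE_I2) (auto simp: split_beta abs_mult intro!: mult_right_mono)
  qed
qed

text \<open>By Fubini, integrating h against the smoothed density gives the mean of the Gaussian
  smoothing of h at \<open>Z\<close>. Pointwise, that smoothing moves h by at most L times the
  summed first moments of the noise.\<close>

lemma smoothed_expectation:
  assumes h: "h \<in> borel_measurable (PiM S (\<lambda>_. lborel))" and B: "\<And>y. \<bar>h y\<bar> \<le> B"
    and lip: "\<And>x y. \<bar>h x - h y\<bar> \<le> L * (\<Sum>s\<in>S. \<bar>x s - y s\<bar>)" and L: "0 \<le> L"
    and hZ: "(\<lambda>\<omega>. h (Z \<omega>)) \<in> borel_measurable M"
  shows "\<bar>(\<integral>\<omega>. h (Z \<omega>) \<partial>M) - (\<integral>y. h y * (\<integral>\<omega>. gauss_kernel S \<tau> (Z \<omega>) y \<partial>M) \<partial>PiM S (\<lambda>_. lborel))\<bar>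
     \<le> L * (real (card S) * \<tau>)"
proof -
  let ?N = "PiM S (\<lambda>_. lborel :: real measure)"
  note int = integrable_gauss_kernel_pair[OF h B]
  have "(\<integral>y. h y * (\<integral>\<omega>. gauss_kernel S \<tau> (Z \<omega>) y \<partial>M) \<partial>?N)
     = (\<integral>y. (\<integral>\<omega>. h y * gauss_kernel S \<tau> (Z \<omega>) y \<partial>M) \<partial>?N)" by simp
  also have "\<dots> = (\<integral>\<omega>. (\<integral>y. h y * gauss_kernel S \<tau> (Z \<omega>) y \<partial>?N) \<partial>M)"
    by (rule MN.Fubini_integral[OF int])
  finally have e: "(\<integral>y. h y * (\<integral>\<omega>. gauss_kernel S \<tau> (Z \<omega>) y \<partial>M) \<partial>?N)
     = (\<integral>\<omega>. (\<integral>y. h y * gauss_kernel S \<tau> (Z \<omega>) y \<partial>?N) \<partial>M)" .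
  have i1: "integrable M (\<lambda>\<omega>. h (Z \<omega>))"
    by (rule M.integrable_const_bound[where B=B]) (use hZ B in auto)
  have i2: "integrable M (\<lambda>\<omega>. \<integral>y. h y * gauss_kernel S \<tau> (Z \<omega>) y \<partial>?N)"
    using MN.integrable_fst[OF int] .
  have pt: "\<bar>h z - (\<integral>y. h y * gauss_kernel S \<tau> z y \<partial>?N)\<bar> \<le> L * (real (card S) * \<tau>)" for z
  proof -
    have j: "integrable ?N (\<lambda>y. h y * gauss_kernel S \<tau> z y)"
      by (rule Bochner_Integration.integrable_bound[OF integrable_mult_right[OF gauss_kernel_integral(1)[OF fin tau], of B z]])
        (use h B order_trans[OF abs_ge_zero B] gauss_kernel_nonneg borel_measurable_integrable[OF gauss_kernel_integral(1)[OF fin tau]]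
         in \<open>auto simp: abs_mult intro!: mult_right_mono\<close>)
    have "h z - (\<integral>y. h y * gauss_kernel S \<tau> z y \<partial>?N) = (\<integral>y. h z * gauss_kernel S \<tau> z y \<partial>?N) - (\<integral>y. h y * gauss_kernel S \<tau> z y \<partial>?N)"
      by (simp add: gauss_kernel_integral)
    also have "\<dots> = (\<integral>y. h z * gauss_kernel S \<tau> z y - h y * gauss_kernel S \<tau> z y \<partial>?N)"
      by (rule Bochner_Integration.integral_diff[symmetric]) (use j in \<open>auto simp: gauss_kernel_integral\<close>)
    also have "\<bar>\<dots>\<bar> \<le> (\<integral>y. L * (\<Sum>s\<in>S. \<bar>y s - z s\<bar> * gauss_kernel S \<tau> z y) \<partial>?N)"
    proof (rule integral_abs_le)
      show "integrable ?N (\<lambda>y. h z * gauss_kernel S \<tau> z y - h y * gauss_kernel S \<tau> z y)"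
        by (intro Bochner_Integration.integrable_diff integrable_mult_right j gauss_kernel_integral) auto
      show "integrable ?N (\<lambda>y. L * (\<Sum>s\<in>S. \<bar>y s - z s\<bar> * gauss_kernel S \<tau> z y))"
        by (intro integrable_mult_right Bochner_Integration.integrable_sum gauss_kernel_first_moment) auto
      fix y
      have "\<bar>h z * gauss_kernel S \<tau> z y - h y * gauss_kernel S \<tau> z y\<bar> = \<bar>h y - h z\<bar> * gauss_kernel S \<tau> z y"
        by (simp add: left_diff_distrib[symmetric] abs_mult gauss_kernel_nonneg abs_minus_commute)
      also have "\<dots> \<le> (L * (\<Sum>s\<in>S. \<bar>y s - z s\<bar>)) * gauss_kernel S \<tau> z y"
        by (intro mult_right_mono lip gauss_kernel_nonneg)
      finally show "\<bar>h z * gauss_kernel S \<tau> z y - h y * gauss_kernel S \<tau> z y\<bar>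
          \<le> L * (\<Sum>s\<in>S. \<bar>y s - z s\<bar> * gauss_kernel S \<tau> z y)"
        by (simp add: sum_distrib_right mult.assoc)
    qed
    also have "\<dots> = L * (\<Sum>s\<in>S. (\<integral>y. \<bar>y s - z s\<bar> * gauss_kernel S \<tau> z y \<partial>?N))"
      by (simp add: gauss_kernel_first_moment)
    also have "\<dots> \<le> L * (\<Sum>s\<in>S. \<tau>)"
      by (intro mult_left_mono sum_mono gauss_kernel_first_moment L) auto
    finally show ?thesis by simp
  qed
  have "(\<integral>\<omega>. h (Z \<omega>) \<partial>M) - (\<integral>\<omega>. (\<integral>y. h y * gauss_kernel S \<tau> (Z \<omega>) y \<partial>?N) \<partial>M)
    = (\<integral>\<omega>. h (Z \<omega>) - (\<integral>y. h y * gauss_kernel S \<tau> (Z \<omega>) y \<partial>?N) \<partial>M)"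
    by (rule Bochner_Integration.integral_diff[symmetric, OF i1 i2])
  also have "\<bar>\<dots>\<bar> \<le> (\<integral>\<omega>. L * (real (card S) * \<tau>) \<partial>M)"
    by (rule integral_abs_le) (use i1 i2 pt in auto)
  finally show ?thesis unfolding e by (simp add: M.prob_space)
qed

lemma smoothed_density:
  shows "integrable (PiM S (\<lambda>_. lborel)) (\<lambda>y. \<integral>\<omega>. gauss_kernel S \<tau> (Z \<omega>) y \<partial>M)" (is ?A)
    and "(\<integral>\<^sup>+y. norm (\<integral>\<omega>. gauss_kernel S \<tau> (Z \<omega>) y \<partial>M) \<partial>PiM S (\<lambda>_. lborel)) = 1" (is ?B)
proof -
  have int: "integrable (M \<Otimes>\<^sub>M PiM S (\<lambda>_. lborel)) (\<lambda>(\<omega>, y). gauss_kernel S \<tau> (Z \<omega>) y)"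
    using integrable_gauss_kernel_pair[of "\<lambda>_. 1" 1] by simp
  show A: ?A using MN.integrable_snd[OF int] .
  have n: "0 \<le> (\<integral>\<omega>. gauss_kernel S \<tau> (Z \<omega>) y \<partial>M)" for y
    by (simp add: gauss_kernel_nonneg)
  have "(\<integral>y. (\<integral>\<omega>. gauss_kernel S \<tau> (Z \<omega>) y \<partial>M) \<partial>PiM S (\<lambda>_. lborel)) = 1"
    using MN.Fubini_integral[OF int] by (simp add: gauss_kernel_integral M.prob_space)
  then show ?B
    using n by (subst nn_integral_eq_integral) (use A in auto)
qed

text \<open>The smoothed density involves the law of \<open>Z\<close> only through characteristic
  functions of linear combinations, so convergence of the latter yields pointwise convergence of the
  densities.\<close>

lemma smoothed_density_fourier:
  "complex_of_real (\<integral>\<omega>. gauss_kernel S \<tau> (Z \<omega>) y \<partial>M) = (1 / sqrt (2 * pi * \<tau>\<^sup>2)) ^ card S *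
    (\<integral>\<theta>. iexp (\<Sum>s\<in>S. \<theta> s * y s / \<tau>) * (\<integral>\<omega>. iexp (\<Sum>s\<in>S. (- \<theta> s / \<tau>) * Z \<omega> s) \<partial>M)
       \<partial>PiM S (\<lambda>_. std_normal_distribution))"
proof -
  interpret N: prob_space std_normal_distribution by (rule prob_space_normal_density) simp
  interpret G: prob_space "PiM S (\<lambda>_. std_normal_distribution)"
    by (rule prob_space_PiM) (rule N.prob_space_axioms)
  interpret MG: pair_prob_space M "PiM S (\<lambda>_. std_normal_distribution)" by unfold_locales
  let ?G = "PiM S (\<lambda>_. std_normal_distribution)"
  have meas: "(\<lambda>(\<omega>, \<theta>). iexp (\<Sum>s\<in>S. \<theta> s * (y s - Z \<omega> s) / \<tau>)) \<in> borel_measurable (M \<Otimes>\<^sub>M ?G)"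
  proof -
    have "(\<lambda>x. \<Sum>s\<in>S. snd x s * (y s - Z (fst x) s) / \<tau>) \<in> borel_measurable (M \<Otimes>\<^sub>M ?G)"
    proof (intro borel_measurable_sum borel_measurable_times borel_measurable_divide borel_measurable_diff borel_measurable_const)
      fix s assume s: "s \<in> S"
      show "(\<lambda>x. Z (fst x) s) \<in> borel_measurable (M \<Otimes>\<^sub>M ?G)"
        using measurable_compose[OF measurable_fst Z[OF s]] .
      have "(\<lambda>x. snd x s) \<in> measurable (M \<Otimes>\<^sub>M ?G) std_normal_distribution"
        by (rule measurable_compose[OF measurable_snd measurable_component_singleton[OF s]])
      then show "(\<lambda>x. snd x s) \<in> borel_measurable (M \<Otimes>\<^sub>M ?G)" by (simp cong: measurable_cong_sets)
    qed
    then show ?thesis unfolding split_beta by measurable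
  qed
  have int: "integrable (M \<Otimes>\<^sub>M ?G) (\<lambda>(\<omega>, \<theta>). iexp (\<Sum>s\<in>S. \<theta> s * (y s - Z \<omega> s) / \<tau>))"
    by (rule MG.P.integrable_const_bound[where B=1]) (use meas in \<open>auto simp: split_beta\<close>)
  have "complex_of_real (\<integral>\<omega>. gauss_kernel S \<tau> (Z \<omega>) y \<partial>M) = (\<integral>\<omega>. complex_of_real (gauss_kernel S \<tau> (Z \<omega>) y) \<partial>M)"
    by (rule integral_complex_of_real[symmetric])
  also have "\<dots> = (1 / sqrt (2 * pi * \<tau>\<^sup>2)) ^ card S *
     (\<integral>\<omega>. (\<integral>\<theta>. iexp (\<Sum>s\<in>S. \<theta> s * (y s - Z \<omega> s) / \<tau>) \<partial>?G) \<partial>M)"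
    unfolding gauss_kernel_fourier[OF fin tau] by simp
  also have "(\<integral>\<omega>. (\<integral>\<theta>. iexp (\<Sum>s\<in>S. \<theta> s * (y s - Z \<omega> s) / \<tau>) \<partial>?G) \<partial>M)
     = (\<integral>\<theta>. (\<integral>\<omega>. iexp (\<Sum>s\<in>S. \<theta> s * (y s - Z \<omega> s) / \<tau>) \<partial>M) \<partial>?G)"
    by (rule MG.Fubini_integral[symmetric, OF int])
  also have "\<dots> = (\<integral>\<theta>. iexp (\<Sum>s\<in>S. \<theta> s * y s / \<tau>) * (\<integral>\<omega>. iexp (\<Sum>s\<in>S. (- \<theta> s / \<tau>) * Z \<omega> s) \<partial>M) \<partial>?G)"
  proof (intro Bochner_Integration.integral_cong refl)
    fix \<theta>
    have "iexp (\<Sum>s\<in>S. \<theta> s * (y s - Z \<omega> s) / \<tau>)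
       = iexp (\<Sum>s\<in>S. \<theta> s * y s / \<tau>) * iexp (\<Sum>s\<in>S. (- \<theta> s / \<tau>) * Z \<omega> s)" for \<omega>
    proof -
      have "(\<Sum>s\<in>S. \<theta> s * (y s - Z \<omega> s) / \<tau>) = (\<Sum>s\<in>S. \<theta> s * y s / \<tau>) + (\<Sum>s\<in>S. (- \<theta> s / \<tau>) * Z \<omega> s)"
        unfolding sum.distrib[symmetric] by (intro sum.cong refl) (simp add: field_simps)
      then show ?thesis by (simp only: exp_add of_real_add distrib_left)
    qed
    then show "(\<integral>\<omega>. iexp (\<Sum>s\<in>S. \<theta> s * (y s - Z \<omega> s) / \<tau>) \<partial>M)
       = iexp (\<Sum>s\<in>S. \<theta> s * y s / \<tau>) * (\<integral>\<omega>. iexp (\<Sum>s\<in>S. (- \<theta> s / \<tau>) * Z \<omega> s) \<partial>M)"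
      by simp
  qed
  finally show ?thesis .
qed

end

lemma continuous_on_lipschitz_finite_coordinates:
  fixes h :: "('s \<Rightarrow> real) \<Rightarrow> real"
  assumes lip: "\<And>x y. \<bar>h x - h y\<bar> \<le> L * (\<Sum>s\<in>S. \<bar>x s - y s\<bar>)"
  shows "continuous_on UNIV h"
  unfolding continuous_on_def
proof
  fix x
  have c: "continuous_on UNIV (\<lambda>y :: 's \<Rightarrow> real. L * (\<Sum>s\<in>S. \<bar>y s - x s\<bar>))"
    by (intro continuous_intros continuous_on_product_coordinates)
  have "((\<lambda>y. L * (\<Sum>s\<in>S. \<bar>y s - x s\<bar>)) \<longlongrightarrow> L * (\<Sum>s\<in>S. \<bar>x s - x s\<bar>)) (at x within UNIV)"
    using c unfolding continuous_on_def by blast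
  then have "((\<lambda>y. L * (\<Sum>s\<in>S. \<bar>y s - x s\<bar>)) \<longlongrightarrow> 0) (at x within UNIV)" by simp
  then have "((\<lambda>y. h y - h x) \<longlongrightarrow> 0) (at x within UNIV)"
    by (rule Lim_null_comparison[rotated]) (use lip in auto)
  then show "(h \<longlongrightarrow> h x) (at x within UNIV)" by (rule LIM_zero_cancel)
qed

text \<open>On a countable index set the product sigma-algebra is the Borel sigma-algebra of the
  product topology.\<close>

lemma borel_measurable_continuous_family:
  fixes h :: "('s::countable \<Rightarrow> real) \<Rightarrow> real"
  assumes h: "continuous_on UNIV h" and Z: "\<And>s. (\<lambda>\<omega>. Z \<omega> s) \<in> borel_measurable M"
  shows "(\<lambda>\<omega>. h (Z \<omega>)) \<in> borel_measurable M"
proof (rule measurable_compose[of Z M "PiM UNIV (\<lambda>_. borel)" h borel])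
  have "(\<lambda>\<omega> s. Z \<omega> s) \<in> measurable M (PiM UNIV (\<lambda>_. borel))"
    by (rule measurable_PiM_single'[where f="\<lambda>s \<omega>. Z \<omega> s"]) (use Z in auto)
  then show "Z \<in> measurable M (PiM UNIV (\<lambda>_. borel))" .
  show "h \<in> measurable (PiM UNIV (\<lambda>_. borel)) borel"
    by (subst measurable_cong_sets[OF sets_PiM_equal_borel refl]) (rule borel_measurable_continuous_onI[OF h])
qed

text \<open>The width \<open>\<tau>\<close> depends on L, S and e alone, so smoothing costs less
  than e / 3 uniformly in n. For fixed \<open>\<tau>\<close> the smoothed densities converge
  pointwise by dominated convergence and, having mass 1, also in L1; the bound B transfers this to
  h.\<close>

lemma lipschitz_expectation_convergence:
  fixes Zn :: "nat \<Rightarrow> 'w \<Rightarrow> 's::countable \<Rightarrow> real" and Z :: "'v \<Rightarrow> 's \<Rightarrow> real"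
  assumes M: "prob_space M" and P: "prob_space P" and fin: "finite S"
    and Zn: "\<And>n s. (\<lambda>\<omega>. Zn n \<omega> s) \<in> borel_measurable M"
    and Z: "\<And>s. (\<lambda>\<omega>. Z \<omega> s) \<in> borel_measurable P"
    and ch: "\<And>c. (\<lambda>n. \<integral>\<omega>. iexp (\<Sum>s\<in>S. c s * Zn n \<omega> s) \<partial>M) \<longlonglongrightarrow> (\<integral>\<omega>. iexp (\<Sum>s\<in>S. c s * Z \<omega> s) \<partial>P)"
    and B: "\<And>y. \<bar>h y\<bar> \<le> B" and lip: "\<And>x y. \<bar>h x - h y\<bar> \<le> L * (\<Sum>s\<in>S. \<bar>x s - y s\<bar>)" and L: "0 \<le> L"
  shows "(\<lambda>n. \<integral>\<omega>. h (Zn n \<omega>) \<partial>M) \<longlonglongrightarrow> (\<integral>\<omega>. h (Z \<omega>) \<partial>P)"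
proof (rule metric_LIMSEQ_I)
  interpret M: prob_space M by fact
  interpret N: prob_space std_normal_distribution by (rule prob_space_normal_density) simp
  interpret G: prob_space "PiM S (\<lambda>_. std_normal_distribution)"
    by (rule prob_space_PiM) (rule N.prob_space_axioms)
  let ?N = "PiM S (\<lambda>_. lborel :: real measure)"
  have hc: "continuous_on UNIV h" by (rule continuous_on_lipschitz_finite_coordinates[OF lip])
  have hn: "(\<lambda>\<omega>. h (Zn n \<omega>)) \<in> borel_measurable M" for n
    by (rule borel_measurable_continuous_family[OF hc Zn])
  have hz: "(\<lambda>\<omega>. h (Z \<omega>)) \<in> borel_measurable P"
    by (rule borel_measurable_continuous_family[OF hc Z])
  \<comment> \<open>Points of the product over S are \<open>undefined\<close> off S. By its
    Lipschitz bound h ignores those coordinates, so they may be reset to 0, which makes every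
    coordinate measurable.\<close>
  have hN: "h \<in> borel_measurable ?N"
  proof -
    have "h y = h (\<lambda>s. if s \<in> S then y s else 0)" for y
      using lip[of y "\<lambda>s. if s \<in> S then y s else 0"] by simp
    moreover have "(\<lambda>y. h (\<lambda>s. if s \<in> S then y s else 0)) \<in> borel_measurable ?N"
    proof (rule borel_measurable_continuous_family[OF hc])
      fix s show "(\<lambda>y. if s \<in> S then y s else 0) \<in> borel_measurable ?N"
        using measurable_component_singleton[of s S "\<lambda>_. lborel :: real measure"]
        by (cases "s \<in> S") simp_all
    qed
    ultimately show ?thesis by presburger
  qed
  fix e :: real assume e: "0 < e"
  define \<tau> where "\<tau> = e / (4 * (L * real (card S) + 1))"
  have den: "0 < L * real (card S) + 1" using L by (simp add: add_nonneg_pos)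
  have tau: "0 < \<tau>" unfolding \<tau>_def using e den by simp
  have small: "L * (real (card S) * \<tau>) < e / 3"
  proof -
    have "L * (real (card S) * \<tau>) \<le> (L * real (card S) + 1) * \<tau>"
      using tau by (simp add: algebra_simps)
    also have "\<dots> = e / 4" unfolding \<tau>_def using den by (simp add: field_simps)
    finally show ?thesis using e by simp
  qed
  define f where "f n y = (\<integral>\<omega>. gauss_kernel S \<tau> (Zn n \<omega>) y \<partial>M)" for n y
  define g where "g y = (\<integral>\<omega>. gauss_kernel S \<tau> (Z \<omega>) y \<partial>P)" for y
  have conv: "(\<lambda>n. f n y) \<longlonglongrightarrow> g y" for y
  proof -
    have "(\<lambda>n. \<integral>\<theta>. iexp (\<Sum>s\<in>S. \<theta> s * y s / \<tau>) * (\<integral>\<omega>. iexp (\<Sum>s\<in>S. (- \<theta> s / \<tau>) * Zn n \<omega> s) \<partial>M)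
       \<partial>PiM S (\<lambda>_. std_normal_distribution)) \<longlonglongrightarrow>
       (\<integral>\<theta>. iexp (\<Sum>s\<in>S. \<theta> s * y s / \<tau>) * (\<integral>\<omega>. iexp (\<Sum>s\<in>S. (- \<theta> s / \<tau>) * Z \<omega> s) \<partial>P)
       \<partial>PiM S (\<lambda>_. std_normal_distribution))"
    proof (rule integral_dominated_convergence[where w="\<lambda>_. 1"])
      let ?G = "PiM S (\<lambda>_. std_normal_distribution)"
      have comp: "(\<lambda>\<theta>. \<theta> s) \<in> borel_measurable ?G" if "s \<in> S" for s
        using measurable_component_singleton[OF that, of "\<lambda>_. std_normal_distribution"]
        by (simp cong: measurable_cong_sets)
      have m1: "(\<lambda>\<theta>. iexp (\<Sum>s\<in>S. \<theta> s * y s / \<tau>)) \<in> borel_measurable ?G"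
      proof -
        have "(\<lambda>\<theta>. \<Sum>s\<in>S. \<theta> s * y s / \<tau>) \<in> borel_measurable ?G"
          by (intro borel_measurable_sum borel_measurable_times borel_measurable_divide borel_measurable_const comp)
        then show ?thesis by measurable
      qed
      have m2: "(\<lambda>\<theta>. \<integral>\<omega>. iexp (\<Sum>s\<in>S. (- \<theta> s / \<tau>) * Y \<omega> s) \<partial>Q) \<in> borel_measurable ?G"
        if Q: "prob_space Q" and Y: "\<And>s. (\<lambda>\<omega>. Y \<omega> s) \<in> borel_measurable Q" for Q :: "'x measure" and Y
      proof -
        interpret Q: prob_space Q by fact
        have "(\<lambda>(\<theta>, \<omega>). \<Sum>s\<in>S. (- \<theta> s / \<tau>) * Y \<omega> s) \<in> borel_measurable (?G \<Otimes>\<^sub>M Q)"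
          unfolding split_beta
        proof (intro borel_measurable_sum borel_measurable_times borel_measurable_divide borel_measurable_uminus borel_measurable_const)
          fix s assume s: "s \<in> S"
          show "(\<lambda>x. Y (snd x) s) \<in> borel_measurable (?G \<Otimes>\<^sub>M Q)"
            using measurable_compose[OF measurable_snd Y] .
          show "(\<lambda>x. fst x s) \<in> borel_measurable (?G \<Otimes>\<^sub>M Q)"
            using measurable_compose[OF measurable_fst comp[OF s]] .
        qed
        then have "(\<lambda>(\<theta>, \<omega>). iexp (\<Sum>s\<in>S. (- \<theta> s / \<tau>) * Y \<omega> s)) \<in> borel_measurable (?G \<Otimes>\<^sub>M Q)"
          unfolding split_beta by measurable
        then show ?thesis by (rule Q.borel_measurable_lebesgue_integral)
      qed
      show "(\<lambda>\<theta>. iexp (\<Sum>s\<in>S. \<theta> s * y s / \<tau>) * (\<integral>\<omega>. iexp (\<Sum>s\<in>S. (- \<theta> s / \<tau>) * Zn n \<omega> s) \<partial>M)) \<in> borel_measurable ?G" for n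
        by (intro borel_measurable_times m1 m2 M Zn)
      show "(\<lambda>\<theta>. iexp (\<Sum>s\<in>S. \<theta> s * y s / \<tau>) * (\<integral>\<omega>. iexp (\<Sum>s\<in>S. (- \<theta> s / \<tau>) * Z \<omega> s) \<partial>P)) \<in> borel_measurable ?G"
        by (intro borel_measurable_times m1 m2 P Z)
      show "AE \<theta> in ?G. (\<lambda>n. iexp (\<Sum>s\<in>S. \<theta> s * y s / \<tau>) * (\<integral>\<omega>. iexp (\<Sum>s\<in>S. (- \<theta> s / \<tau>) * Zn n \<omega> s) \<partial>M))
         \<longlonglongrightarrow> iexp (\<Sum>s\<in>S. \<theta> s * y s / \<tau>) * (\<integral>\<omega>. iexp (\<Sum>s\<in>S. (- \<theta> s / \<tau>) * Z \<omega> s) \<partial>P)"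
        using ch by (intro AE_I2 tendsto_mult_left)
      show "AE \<theta> in ?G. norm (iexp (\<Sum>s\<in>S. \<theta> s * y s / \<tau>) * (\<integral>\<omega>. iexp (\<Sum>s\<in>S. (- \<theta> s / \<tau>) * Zn n \<omega> s) \<partial>M)) \<le> 1" for n
      proof (intro AE_I2)
        fix \<theta>
        have "norm (\<integral>\<omega>. iexp (\<Sum>s\<in>S. (- \<theta> s / \<tau>) * Zn n \<omega> s) \<partial>M) \<le> (\<integral>\<omega>. norm (iexp (\<Sum>s\<in>S. (- \<theta> s / \<tau>) * Zn n \<omega> s)) \<partial>M)"
          by (rule integral_norm_bound)
        then show "norm (iexp (\<Sum>s\<in>S. \<theta> s * y s / \<tau>) * (\<integral>\<omega>. iexp (\<Sum>s\<in>S. (- \<theta> s / \<tau>) * Zn n \<omega> s) \<partial>M)) \<le> 1"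
          by (simp add: norm_mult M.prob_space)
      qed
    qed simp
    from tendsto_mult_left[OF this, of "complex_of_real (1 / sqrt (2 * pi * \<tau>\<^sup>2)) ^ card S"]
    have "(\<lambda>n. complex_of_real (f n y)) \<longlonglongrightarrow> complex_of_real (g y)"
      unfolding f_def g_def smoothed_density_fourier[OF M fin tau Zn] smoothed_density_fourier[OF P fin tau Z]
      by simp
    then show ?thesis by (simp add: tendsto_of_real_iff)
  qed
  have fi: "integrable ?N (f n)" and fn: "(\<integral>\<^sup>+y. norm (f n y) \<partial>?N) = 1" for n
    unfolding f_def using smoothed_density[OF M fin tau Zn] by auto
  have gi: "integrable ?N g" and gn: "(\<integral>\<^sup>+y. norm (g y) \<partial>?N) = 1"
    unfolding g_def using smoothed_density[OF P fin tau Z] by auto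
  have "(\<lambda>n. \<integral>\<^sup>+y. norm (f n y - g y) \<partial>?N) \<longlonglongrightarrow> 0"
    by (rule Scheffe_lemma2) (use fi gi conv fn gn in auto)
  moreover have "(\<integral>\<^sup>+y. norm (f n y - g y) \<partial>?N) = ennreal (\<integral>y. \<bar>f n y - g y\<bar> \<partial>?N)" for n
    by (subst nn_integral_eq_integral) (use fi gi in auto)
  ultimately have "(\<lambda>n. ennreal (\<integral>y. \<bar>f n y - g y\<bar> \<partial>?N)) \<longlonglongrightarrow> ennreal 0" by simp
  then have "(\<lambda>n. \<integral>y. \<bar>f n y - g y\<bar> \<partial>?N) \<longlonglongrightarrow> 0"
    by (subst (asm) tendsto_ennreal_iff) auto
  from tendsto_mult_right_zero[OF this, of B]
  have "eventually (\<lambda>n. B * (\<integral>y. \<bar>f n y - g y\<bar> \<partial>?N) < e / 3) sequentially"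
    using e by (intro order_tendstoD(2)) auto
  then obtain n0 where n0: "\<And>n. n \<ge> n0 \<Longrightarrow> B * (\<integral>y. \<bar>f n y - g y\<bar> \<partial>?N) < e / 3"
    unfolding eventually_sequentially by blast
  have hint: "integrable ?N (\<lambda>y. h y * k y)" if "integrable ?N k" for k
    by (rule Bochner_Integration.integrable_bound[OF integrable_mult_right[OF that, of B]])
      (use hN that B order_trans[OF abs_ge_zero B] in \<open>auto simp: abs_mult intro!: mult_right_mono\<close>)
  show "\<exists>no. \<forall>n\<ge>no. dist (\<integral>\<omega>. h (Zn n \<omega>) \<partial>M) (\<integral>\<omega>. h (Z \<omega>) \<partial>P) < e"
  proof (intro exI allI impI)
    fix n assume n: "n \<ge> n0"
    have 1: "\<bar>(\<integral>\<omega>. h (Zn n \<omega>) \<partial>M) - (\<integral>y. h y * f n y \<partial>?N)\<bar> < e / 3"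
      using smoothed_expectation[OF M fin tau Zn hN B lip L hn, of n] small unfolding f_def by simp
    have 2: "\<bar>(\<integral>\<omega>. h (Z \<omega>) \<partial>P) - (\<integral>y. h y * g y \<partial>?N)\<bar> < e / 3"
      using smoothed_expectation[OF P fin tau Z hN B lip L hz] small unfolding g_def by simp
    have "(\<integral>y. h y * f n y \<partial>?N) - (\<integral>y. h y * g y \<partial>?N) = (\<integral>y. h y * f n y - h y * g y \<partial>?N)"
      by (rule Bochner_Integration.integral_diff[symmetric]) (auto intro: hint fi gi)
    also have "\<bar>\<dots>\<bar> \<le> (\<integral>y. B * \<bar>f n y - g y\<bar> \<partial>?N)"
    proof (rule integral_abs_le)
      show "integrable ?N (\<lambda>y. h y * f n y - h y * g y)"
        by (intro Bochner_Integration.integrable_diff hint fi gi)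
      show "integrable ?N (\<lambda>y. B * \<bar>f n y - g y\<bar>)" using fi gi by auto
      show "\<bar>h y * f n y - h y * g y\<bar> \<le> B * \<bar>f n y - g y\<bar>" for y
        unfolding right_diff_distrib[symmetric] abs_mult by (intro mult_right_mono B) auto
    qed
    finally have 3: "\<bar>(\<integral>y. h y * f n y \<partial>?N) - (\<integral>y. h y * g y \<partial>?N)\<bar> < e / 3" using n0[OF n] by simp
    show "dist (\<integral>\<omega>. h (Zn n \<omega>) \<partial>M) (\<integral>\<omega>. h (Z \<omega>) \<partial>P) < e"
      using 1 2 3 unfolding dist_real_def by linarith
  qed
qed

section \<open>Moments and weak limits\<close>

lemma normal_law_even_moment:
  assumes "0 \<le> \<sigma>"
  shows "integrable (normal_law \<sigma>) (\<lambda>x. x ^ (2 * k))"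
    and "(\<integral>x. x ^ (2 * k) \<partial>normal_law \<sigma>) = \<sigma> ^ (2 * k) * (fact (2 * k) / (2 ^ k * fact k))"
  unfolding distr_std_normal_scale[OF assms, symmetric]
  by (subst integrable_distr_eq, auto simp: power_mult_distrib std_normal_distribution_even_moments)
     (subst integral_distr, auto simp: power_mult_distrib std_normal_distribution_even_moments)

lemma square_le_truncation:
  fixes y :: real
  assumes "0 < B"
  shows "y\<^sup>2 \<le> min (y\<^sup>2) B + y ^ 4 / B"
proof (cases "y\<^sup>2 \<le> B")
  case False
  have "y\<^sup>2 * B \<le> y\<^sup>2 * y\<^sup>2" using False by (intro mult_left_mono) auto
  also have "y\<^sup>2 * y\<^sup>2 = y ^ 4" by (simp add: power_add[symmetric])
  finally have "y\<^sup>2 \<le> y ^ 4 / B" using assms by (simp add: pos_le_divide_eq)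
  moreover have "0 \<le> min (y\<^sup>2) B" using assms by simp
  ultimately show ?thesis by linarith
qed (use assms in auto)

text \<open>The truncated square is bounded and continuous, so its mean converges; bounded fourth
  moments keep the truncation error below C / B for all large n.\<close>

lemma weak_conv_normal_second_moment:
  fixes Y :: "nat \<Rightarrow> 'w \<Rightarrow> real"
  assumes M: "prob_space M" and Y: "\<And>n. Y n \<in> borel_measurable M" and s: "0 \<le> \<sigma>"
    and wc: "weak_conv_m (\<lambda>n. distr M borel (Y n)) (normal_law \<sigma>)"
    and i4: "\<And>n. integrable M (\<lambda>\<omega>. Y n \<omega> ^ 4)"
    and C: "eventually (\<lambda>n. (\<integral>\<omega>. Y n \<omega> ^ 4 \<partial>M) \<le> C) sequentially"
  shows "(\<lambda>n. \<integral>\<omega>. (Y n \<omega>)\<^sup>2 \<partial>M) \<longlonglongrightarrow> \<sigma>\<^sup>2"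
proof (rule metric_LIMSEQ_I)
  interpret M: prob_space M by fact
  interpret N: prob_space "normal_law \<sigma>" by (rule prob_space_normal_law[OF s])
  have trunc: "integrable Q y2 \<and> \<bar>(\<integral>\<omega>. (y \<omega>)\<^sup>2 \<partial>Q) - (\<integral>\<omega>. min ((y \<omega>)\<^sup>2) B \<partial>Q)\<bar> \<le> (\<integral>\<omega>. y \<omega> ^ 4 \<partial>Q) / B"
    if Q: "prob_space Q" and y: "y \<in> borel_measurable Q" and i: "integrable Q (\<lambda>\<omega>. y \<omega> ^ 4)" and B: "0 < B"
      and y2: "y2 = (\<lambda>\<omega>. (y \<omega>)\<^sup>2)"
    for Q :: "'q measure" and y :: "'q \<Rightarrow> real" and B y2
  proof -
    interpret Q: prob_space Q by fact
    note [measurable] = y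
    have i2: "integrable Q y2" unfolding y2
    proof (rule Bochner_Integration.integrable_bound[of Q "\<lambda>\<omega>. 1 + y \<omega> ^ 4"])
      show "integrable Q (\<lambda>\<omega>. 1 + y \<omega> ^ 4)" using i by simp
      show "(\<lambda>\<omega>. (y \<omega>)\<^sup>2) \<in> borel_measurable Q" by measurable
      have "t\<^sup>2 \<le> 1 + t ^ 4" for t :: real using square_le_truncation[of 1 t] by linarith
      then show "AE \<omega> in Q. norm ((y \<omega>)\<^sup>2) \<le> norm (1 + y \<omega> ^ 4)" by (intro AE_I2) simp
    qed
    have im: "integrable Q (\<lambda>\<omega>. min ((y \<omega>)\<^sup>2) B)"
      by (rule Q.integrable_const_bound[where B=B]) (use B in auto)
    have "(\<integral>\<omega>. (y \<omega>)\<^sup>2 \<partial>Q) \<le> (\<integral>\<omega>. min ((y \<omega>)\<^sup>2) B + y \<omega> ^ 4 / B \<partial>Q)"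
      by (rule integral_mono) (use i2 im i square_le_truncation[OF B] y2 in auto)
    moreover have "(\<integral>\<omega>. min ((y \<omega>)\<^sup>2) B \<partial>Q) \<le> (\<integral>\<omega>. (y \<omega>)\<^sup>2 \<partial>Q)"
      by (rule integral_mono) (use i2 im y2 in auto)
    ultimately show ?thesis using im i i2 by simp
  qed
  fix e :: real assume e: "0 < e"
  \<comment> \<open>\<open>3 * \<sigma> ^ 4\<close> is the fourth moment of the limit law, which has
    to be truncated as well.\<close>
  define D where "D = max 1 (max C (3 * \<sigma> ^ 4))"
  have D: "1 \<le> D" "C \<le> D" "3 * \<sigma> ^ 4 \<le> D" unfolding D_def by auto
  define B where "B = 4 * D / e"
  have B: "0 < B" "D / B = e / 4" unfolding B_def using D e by auto
  have lim: "(\<lambda>n. \<integral>\<omega>. min ((Y n \<omega>)\<^sup>2) B \<partial>M) \<longlonglongrightarrow> (\<integral>x. min (x\<^sup>2) B \<partial>normal_law \<sigma>)"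
  proof -
    have "(\<lambda>n. \<integral>x. min (x\<^sup>2) B \<partial>distr M borel (Y n)) \<longlonglongrightarrow> (\<integral>x. min (x\<^sup>2) B \<partial>normal_law \<sigma>)"
      by (rule weak_conv_imp_integral_bdd_continuous_conv[where B=B, OF _ real_distribution_normal_law[OF s] wc])
        (use Y B in \<open>auto simp: M.real_distribution_distr intro!: continuous_intros\<close>)
    then show ?thesis by (subst (asm) integral_distr) (use Y in auto)
  qed
  from metric_LIMSEQ_D[OF this, of "e / 4"] e obtain n1 where
    n1: "\<And>n. n \<ge> n1 \<Longrightarrow> \<bar>(\<integral>\<omega>. min ((Y n \<omega>)\<^sup>2) B \<partial>M) - (\<integral>x. min (x\<^sup>2) B \<partial>normal_law \<sigma>)\<bar> < e / 4"
    unfolding dist_real_def by auto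
  from C obtain n2 where n2: "\<And>n. n \<ge> n2 \<Longrightarrow> (\<integral>\<omega>. Y n \<omega> ^ 4 \<partial>M) \<le> C"
    unfolding eventually_sequentially by blast
  have "\<bar>(\<integral>x. x\<^sup>2 \<partial>normal_law \<sigma>) - (\<integral>x. min (x\<^sup>2) B \<partial>normal_law \<sigma>)\<bar> \<le> (\<integral>x. x ^ 4 \<partial>normal_law \<sigma>) / B"
    using trunc[OF N.prob_space_axioms _ _ B(1) refl, of "\<lambda>x. x"] normal_law_even_moment(1)[OF s, of 2] by simp
  also have "\<dots> \<le> D / B"
    using normal_law_even_moment(2)[OF s, of 2] D B by (intro divide_right_mono) (auto simp: fact_numeral)
  finally have a: "\<bar>\<sigma>\<^sup>2 - (\<integral>x. min (x\<^sup>2) B \<partial>normal_law \<sigma>)\<bar> \<le> e / 4"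
    using normal_law_even_moment(2)[OF s, of 1] B by (simp add: fact_numeral)
  show "\<exists>no. \<forall>n\<ge>no. dist (\<integral>\<omega>. (Y n \<omega>)\<^sup>2 \<partial>M) (\<sigma>\<^sup>2) < e"
  proof (intro exI allI impI)
    fix n assume n: "n \<ge> max n1 n2"
    have "\<bar>(\<integral>\<omega>. (Y n \<omega>)\<^sup>2 \<partial>M) - (\<integral>\<omega>. min ((Y n \<omega>)\<^sup>2) B \<partial>M)\<bar> \<le> (\<integral>\<omega>. Y n \<omega> ^ 4 \<partial>M) / B"
      using trunc[OF M Y i4 B(1) refl] by simp
    also have "\<dots> \<le> D / B" using n2[of n] n D B by (intro divide_right_mono) auto
    finally show "dist (\<integral>\<omega>. (Y n \<omega>)\<^sup>2 \<partial>M) (\<sigma>\<^sup>2) < e"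
      using n1[of n] n a B e unfolding dist_real_def by linarith
  qed
qed

text \<open>The characteristic functions exp(- s_n t^2 / 2), with s_n the variances, converge to a
  function that is continuous with value 1 at 0 and thus nonzero at some \<open>t0\<close>.
  Logarithms at \<open>t0\<close> make the s_n converge, and their limit determines the limit
  law.\<close>

lemma AE_limit_normal_law:
  fixes Y :: "'w \<Rightarrow> real"
  assumes P: "prob_space P" and Yn: "\<And>n. Yn n \<in> borel_measurable P" and Y: "Y \<in> borel_measurable P"
    and nl: "\<And>n. \<exists>\<sigma>\<ge>0. distr P borel (Yn n) = normal_law \<sigma>"
    and lim: "AE \<omega> in P. (\<lambda>n. Yn n \<omega>) \<longlonglongrightarrow> Y \<omega>"
  shows "\<exists>\<sigma>\<ge>0. distr P borel Y = normal_law \<sigma>"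
proof -
  interpret P: prob_space P by fact
  obtain \<sigma> where \<sigma>: "\<And>n. 0 \<le> \<sigma> n" "\<And>n. distr P borel (Yn n) = normal_law (\<sigma> n)" using nl by metis
  define \<phi> where "\<phi> = char (distr P borel Y)"
  interpret D: real_distribution "distr P borel Y" using Y by (rule P.real_distribution_distr)
  have c: "(\<lambda>n. complex_of_real (exp (- ((\<sigma> n)\<^sup>2 * t\<^sup>2) / 2))) \<longlonglongrightarrow> \<phi> t" for t
  proof -
    have "(\<lambda>n. char (distr P borel (Yn n)) t) \<longlonglongrightarrow> \<phi> t"
      unfolding \<phi>_def char_distr_borel[OF Yn] char_distr_borel[OF Y]
    proof (rule integral_dominated_convergence[where w="\<lambda>_. 1"])
      show "AE x in P. (\<lambda>i. iexp (t * Yn i x)) \<longlonglongrightarrow> iexp (t * Y x)"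
        using lim by eventually_elim (intro tendsto_intros)
    qed (use Yn Y in auto)
    then show ?thesis unfolding \<sigma> char_normal_law[OF \<sigma>(1)] .
  qed
  have "isCont \<phi> 0" unfolding \<phi>_def by (rule D.isCont_char)
  moreover have "\<phi> 0 = 1" unfolding \<phi>_def by (rule D.char_zero)
  ultimately have "\<phi> \<midarrow>0\<rightarrow> 1" by (simp add: isCont_def)
  from metric_LIM_D[OF this, of 1] obtain d where d: "0 < d" "\<And>t. t \<noteq> 0 \<Longrightarrow> \<bar>t\<bar> < d \<Longrightarrow> dist (\<phi> t) 1 < 1"
    by (auto simp: dist_real_def)
  define t0 where "t0 = d / 2"
  have t0: "t0 \<noteq> 0" "\<phi> t0 \<noteq> 0" using d(1) d(2)[of t0] by (auto simp: t0_def dist_norm)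
  define a where "a = Re (\<phi> t0)"
  have ca: "(\<lambda>n. exp (- ((\<sigma> n)\<^sup>2 * t0\<^sup>2) / 2)) \<longlonglongrightarrow> a"
    using tendsto_Re[OF c[of t0]] by (simp add: a_def)
  have "(\<lambda>n. 0) \<longlonglongrightarrow> Im (\<phi> t0)" using tendsto_Im[OF c[of t0]] by simp
  then have "Im (\<phi> t0) = 0" using LIMSEQ_unique tendsto_const by blast
  with t0 have "a \<noteq> 0" unfolding a_def by (simp add: complex_eq_iff)
  moreover have "0 \<le> a" by (rule LIMSEQ_le_const[OF ca]) auto
  ultimately have "0 < a" by simp
  from tendsto_ln[OF ca] this have "(\<lambda>n. - ((\<sigma> n)\<^sup>2 * t0\<^sup>2) / 2) \<longlonglongrightarrow> ln a" by simp
  from tendsto_mult_left[OF this, of "- 2 / t0\<^sup>2"]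
  have cs: "(\<lambda>n. (\<sigma> n)\<^sup>2) \<longlonglongrightarrow> - 2 / t0\<^sup>2 * ln a" using t0 by simp
  define s where "s = - 2 / t0\<^sup>2 * ln a"
  have s: "0 \<le> s" unfolding s_def by (rule LIMSEQ_le_const[OF cs]) auto
  have "\<phi> t = exp (- ((sqrt s)\<^sup>2 * t\<^sup>2) / 2)" for t
  proof -
    have "(\<lambda>n. complex_of_real (exp (- ((\<sigma> n)\<^sup>2 * t\<^sup>2) / 2))) \<longlonglongrightarrow> complex_of_real (exp (- (s * t\<^sup>2) / 2))"
      unfolding s_def by (intro tendsto_intros cs) auto
    then show ?thesis using LIMSEQ_unique[OF c[of t]] s by simp
  qed
  then have "distr P borel Y = normal_law (sqrt s)"
    by (intro distr_eq_normal_lawI P Y) (use s in \<open>auto simp: \<phi>_def\<close>)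
  then show ?thesis using s by (intro exI[of _ "sqrt s"]) auto
qed

text \<open>The bound passes to the limit for every truncation, and Fatou's lemma removes the
  truncation.\<close>

lemma weak_conv_moment_bound:
  fixes Y :: "'v \<Rightarrow> real" and Yn :: "nat \<Rightarrow> 'w \<Rightarrow> real"
  assumes M: "prob_space M" and P: "prob_space P"
    and Yn: "\<And>n. Yn n \<in> borel_measurable M" and Y: "Y \<in> borel_measurable P"
    and wc: "weak_conv_m (\<lambda>n. distr M borel (Yn n)) (distr P borel Y)"
    and i: "\<And>n. integrable M (\<lambda>\<omega>. \<bar>Yn n \<omega>\<bar> ^ k)"
    and C: "eventually (\<lambda>n. (\<integral>\<omega>. \<bar>Yn n \<omega>\<bar> ^ k \<partial>M) \<le> C) sequentially" and C0: "0 \<le> C"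
  shows "integrable P (\<lambda>\<omega>. \<bar>Y \<omega>\<bar> ^ k)" and "(\<integral>\<omega>. \<bar>Y \<omega>\<bar> ^ k \<partial>P) \<le> C"
proof -
  interpret M: prob_space M by fact
  interpret P: prob_space P by fact
  have t: "(\<integral>\<omega>. min (\<bar>Y \<omega>\<bar> ^ k) B \<partial>P) \<le> C" if B: "0 \<le> B" for B
  proof -
    have "(\<lambda>n. \<integral>x. min (\<bar>x\<bar> ^ k) B \<partial>distr M borel (Yn n)) \<longlonglongrightarrow> (\<integral>x. min (\<bar>x\<bar> ^ k) B \<partial>distr P borel Y)"
      by (rule weak_conv_imp_integral_bdd_continuous_conv[where B=B, OF _ P.real_distribution_distr[OF Y] wc])
        (use Yn B in \<open>auto simp: M.real_distribution_distr intro!: continuous_intros\<close>)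
    then have l: "(\<lambda>n. \<integral>\<omega>. min (\<bar>Yn n \<omega>\<bar> ^ k) B \<partial>M) \<longlonglongrightarrow> (\<integral>\<omega>. min (\<bar>Y \<omega>\<bar> ^ k) B \<partial>P)"
      by (subst (asm) (1 2) integral_distr) (use Yn Y in auto)
    show ?thesis
    proof (rule tendsto_upperbound[OF l])
      show "\<forall>\<^sub>F n in sequentially. (\<integral>\<omega>. min (\<bar>Yn n \<omega>\<bar> ^ k) B \<partial>M) \<le> C"
        using C
      proof eventually_elim
        case (elim n)
        have "integrable M (\<lambda>\<omega>. min (\<bar>Yn n \<omega>\<bar> ^ k) B)"
          by (rule M.integrable_const_bound[where B=B]) (use B Yn in auto)
        then have "(\<integral>\<omega>. min (\<bar>Yn n \<omega>\<bar> ^ k) B \<partial>M) \<le> (\<integral>\<omega>. \<bar>Yn n \<omega>\<bar> ^ k \<partial>M)"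
          by (rule integral_mono) (use i in auto)
        then show ?case using elim by simp
      qed
    qed simp
  qed
  have "(\<integral>\<^sup>+\<omega>. ennreal (\<bar>Y \<omega>\<bar> ^ k) \<partial>P) = (\<integral>\<^sup>+\<omega>. liminf (\<lambda>n. ennreal (min (\<bar>Y \<omega>\<bar> ^ k) (real n))) \<partial>P)"
  proof (intro nn_integral_cong)
    fix \<omega>
    have "eventually (\<lambda>n. min (\<bar>Y \<omega>\<bar> ^ k) (real n) = \<bar>Y \<omega>\<bar> ^ k) sequentially"
      using eventually_ge_at_top[of "nat \<lceil>\<bar>Y \<omega>\<bar> ^ k\<rceil>"] by eventually_elim (simp add: min_def; linarith)
    then have "(\<lambda>n. ennreal (min (\<bar>Y \<omega>\<bar> ^ k) (real n))) \<longlonglongrightarrow> ennreal (\<bar>Y \<omega>\<bar> ^ k)"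
      by (intro tendsto_eventually) (auto elim: eventually_mono)
    then show "ennreal (\<bar>Y \<omega>\<bar> ^ k) = liminf (\<lambda>n. ennreal (min (\<bar>Y \<omega>\<bar> ^ k) (real n)))"
      by (intro lim_imp_Liminf[symmetric]) auto
  qed
  also have "\<dots> \<le> liminf (\<lambda>n. \<integral>\<^sup>+\<omega>. ennreal (min (\<bar>Y \<omega>\<bar> ^ k) (real n)) \<partial>P)"
    by (rule nn_integral_liminf) (use Y in auto)
  also have "\<dots> \<le> liminf (\<lambda>n. ennreal C)"
  proof (intro Liminf_mono always_eventually allI)
    fix n
    have "integrable P (\<lambda>\<omega>. min (\<bar>Y \<omega>\<bar> ^ k) (real n))"
      by (rule P.integrable_const_bound[where B="real n"]) (use Y in auto)
    then have "(\<integral>\<^sup>+\<omega>. ennreal (min (\<bar>Y \<omega>\<bar> ^ k) (real n)) \<partial>P) = ennreal (\<integral>\<omega>. min (\<bar>Y \<omega>\<bar> ^ k) (real n) \<partial>P)"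
      by (rule nn_integral_eq_integral) auto
    then show "(\<integral>\<^sup>+\<omega>. ennreal (min (\<bar>Y \<omega>\<bar> ^ k) (real n)) \<partial>P) \<le> ennreal C"
      using t[of "real n"] by (simp add: ennreal_leI)
  qed
  finally have fin: "(\<integral>\<^sup>+\<omega>. ennreal (\<bar>Y \<omega>\<bar> ^ k) \<partial>P) \<le> ennreal C" by (simp add: Liminf_const)
  show int: "integrable P (\<lambda>\<omega>. \<bar>Y \<omega>\<bar> ^ k)"
    by (rule integrableI_bounded) (use Y le_less_trans[OF fin ennreal_less_top] in auto)
  show "(\<integral>\<omega>. \<bar>Y \<omega>\<bar> ^ k \<partial>P) \<le> C"
    using fin C0 by (subst (asm) nn_integral_eq_integral[OF int]) auto
qed

section \<open>The Skorokhod space\<close>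

text \<open>McShane extension: the minimum of the cones of slope 1/2 with vertices
  (\<open>x i\<close>, \<open>d i\<close>), capped at \<open>\<epsilon>\<close>. It stays above
  \<open>- \<epsilon>\<close> because all vertices do.\<close>

lemma lipschitz_extension_finite:
  fixes x d :: "'i \<Rightarrow> real"
  assumes I: "finite I" and d: "\<And>i. i \<in> I \<Longrightarrow> \<bar>d i\<bar> \<le> \<epsilon>"
    and lip: "\<And>i k. i \<in> I \<Longrightarrow> k \<in> I \<Longrightarrow> \<bar>d i - d k\<bar> \<le> \<bar>x i - x k\<bar> / 2" and eps: "0 \<le> \<epsilon>"
  obtains \<phi> :: "real \<Rightarrow> real" where "\<And>p. \<bar>\<phi> p\<bar> \<le> \<epsilon>" "\<And>p q. \<bar>\<phi> p - \<phi> q\<bar> \<le> \<bar>p - q\<bar> / 2"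
    "\<And>i. i \<in> I \<Longrightarrow> \<phi> (x i) = d i"
proof -
  define A where "A p = insert \<epsilon> ((\<lambda>i. d i + \<bar>p - x i\<bar> / 2) ` I)" for p
  define \<phi> where "\<phi> p = Min (A p)" for p
  have A: "finite (A p)" "A p \<noteq> {}" for p using I by (auto simp: A_def)
  have up: "\<phi> p \<le> a" if "a \<in> A p" for a p unfolding \<phi>_def using A that by (intro Min_le)
  have lo: "c \<le> \<phi> p" if "\<And>a. a \<in> A p \<Longrightarrow> c \<le> a" for c p
    unfolding \<phi>_def using A that by (subst Min_ge_iff) auto
  have 1: "\<bar>\<phi> p\<bar> \<le> \<epsilon>" for p
  proof -
    have "- \<epsilon> \<le> \<phi> p"
    proof (rule lo)
      fix a assume "a \<in> A p"
      then show "- \<epsilon> \<le> a"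
      proof (cases "a = \<epsilon>")
        case False
        then obtain i where "i \<in> I" "a = d i + \<bar>p - x i\<bar> / 2" using \<open>a \<in> A p\<close> by (auto simp: A_def)
        moreover have "0 \<le> \<bar>p - x i\<bar> / 2" by simp
        ultimately show ?thesis using d[of i] unfolding abs_le_iff by linarith
      qed (use eps in simp)
    qed
    moreover have "\<phi> p \<le> \<epsilon>" by (rule up) (simp add: A_def)
    ultimately show ?thesis by simp
  qed
  have half: "\<phi> p - \<bar>p - q\<bar> / 2 \<le> \<phi> q" for p q
  proof (rule lo)
    fix a assume a: "a \<in> A q"
    show "\<phi> p - \<bar>p - q\<bar> / 2 \<le> a"
    proof (cases "a = \<epsilon>")
      case True
      moreover have "0 \<le> \<bar>p - q\<bar> / 2" by simp
      ultimately show ?thesis using 1[of p] unfolding abs_le_iff by linarith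
    next
      case False
      then obtain i where i: "i \<in> I" "a = d i + \<bar>q - x i\<bar> / 2" using a by (auto simp: A_def)
      have "\<phi> p \<le> d i + \<bar>p - x i\<bar> / 2" by (rule up) (use i in \<open>auto simp: A_def\<close>)
      also have "\<dots> \<le> d i + (\<bar>q - x i\<bar> + \<bar>p - q\<bar>) / 2" by simp
      finally show ?thesis using i by (simp add: add_divide_distrib)
    qed
  qed
  have 2: "\<bar>\<phi> p - \<phi> q\<bar> \<le> \<bar>p - q\<bar> / 2" for p q
  proof (rule abs_leI)
    show "\<phi> p - \<phi> q \<le> \<bar>p - q\<bar> / 2" using half[of p q] by simp
    show "- (\<phi> p - \<phi> q) \<le> \<bar>p - q\<bar> / 2" using half[of q p] by (simp add: abs_minus_commute)
  qed
  have 3: "\<phi> (x i) = d i" if i: "i \<in> I" for i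
  proof (rule antisym)
    have "d i + \<bar>x i - x i\<bar> / 2 \<in> A (x i)" unfolding A_def using i by blast
    from up[OF this] show "\<phi> (x i) \<le> d i" by simp
    show "d i \<le> \<phi> (x i)"
    proof (rule lo)
      fix a assume a: "a \<in> A (x i)"
      show "d i \<le> a"
      proof (cases "a = \<epsilon>")
        case True then show ?thesis using d[OF i] by simp
      next
        case False
        then obtain k where k: "k \<in> I" "a = d k + \<bar>x i - x k\<bar> / 2" using a by (auto simp: A_def)
        then show ?thesis using order_trans[OF abs_ge_self lip[OF i k(1)]] by simp
      qed
    qed
  qed
  show ?thesis using that 1 2 3 by blast
qed

text \<open>Adding a displacement of slope at most 1/2 to the identity leaves it strictly
  increasing; since the displacement is bounded and continuous, the sum is onto the reals. Infinite
  times stay fixed.\<close>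

lemma time_change_exists:
  fixes x d :: "'i \<Rightarrow> real"
  assumes I: "finite I" and d: "\<And>i. i \<in> I \<Longrightarrow> \<bar>d i\<bar> \<le> \<epsilon>"
    and lip: "\<And>i k. i \<in> I \<Longrightarrow> k \<in> I \<Longrightarrow> \<bar>d i - d k\<bar> \<le> \<bar>x i - x k\<bar> / 2" and eps: "0 \<le> \<epsilon>"
  shows "\<exists>l :: ereal \<Rightarrow> ereal. strict_mono l \<and> surj l \<and> (\<forall>i\<in>I. l (ereal (x i)) = ereal (x i + d i)) \<and>
    (\<forall>p. p = l p \<or> (\<exists>a b. p = ereal a \<and> l p = ereal b \<and> \<bar>a - b\<bar> \<le> \<epsilon>))"
proof -
  obtain \<phi> where \<phi>: "\<And>p. \<bar>\<phi> p\<bar> \<le> \<epsilon>" "\<And>p q. \<bar>\<phi> p - \<phi> q\<bar> \<le> \<bar>p - q\<bar> / 2"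
    "\<And>i. i \<in> I \<Longrightarrow> \<phi> (x i) = d i"
    by (rule lipschitz_extension_finite[of I d \<epsilon> x]) (use assms in blast)+
  define f where "f p = p + \<phi> p" for p
  have mono: "f p < f q" if "p < q" for p q
  proof -
    have "\<phi> p - \<phi> q \<le> \<bar>p - q\<bar> / 2" by (rule order_trans[OF abs_ge_self \<phi>(2)])
    then have "\<phi> p - \<phi> q \<le> (q - p) / 2" using that by simp
    moreover have "(q - p) / 2 < q - p" using that by simp
    ultimately show ?thesis unfolding f_def by linarith
  qed
  have cont: "isCont f p" for p
  proof -
    have "((\<lambda>q. \<phi> q - \<phi> p) \<longlongrightarrow> 0) (at p)"
    proof (rule Lim_null_comparison)
      show "\<forall>\<^sub>F q in at p. norm (\<phi> q - \<phi> p) \<le> \<bar>q - p\<bar> / 2" using \<phi>(2) by simp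
      have "((\<lambda>q. \<bar>q - p\<bar> / 2) \<longlongrightarrow> \<bar>p - p\<bar> / 2) (at p)" by (intro tendsto_intros) simp
      then show "((\<lambda>q. \<bar>q - p\<bar> / 2) \<longlongrightarrow> 0) (at p)" by simp
    qed
    then have "isCont \<phi> p" unfolding isCont_def by (rule LIM_zero_cancel)
    then show ?thesis unfolding f_def by (intro continuous_intros)
  qed
  have surj: "\<exists>p. f p = y" for y
  proof -
    have "f (y - \<epsilon>) \<le> y" "y \<le> f (y + \<epsilon>)" using \<phi>(1)[of "y - \<epsilon>"] \<phi>(1)[of "y + \<epsilon>"] by (auto simp: f_def abs_le_iff)
    moreover have "y - \<epsilon> \<le> y + \<epsilon>" using eps by simp
    ultimately show ?thesis using IVT[of f "y - \<epsilon>" y "y + \<epsilon>"] cont by blast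
  qed
  define l where "l p = (case p of ereal r \<Rightarrow> ereal (f r) | PInfty \<Rightarrow> \<infinity> | MInfty \<Rightarrow> - \<infinity>)" for p
  have l: "l (ereal r) = ereal (f r)" "l \<infinity> = \<infinity>" "l (-\<infinity>) = -\<infinity>" for r by (auto simp: l_def)
  have "strict_mono l"
  proof (rule strict_monoI)
    fix p q :: ereal assume "p < q"
    then show "l p < l q" by (cases p; cases q) (auto simp: l mono)
  qed
  moreover have "surj l"
    unfolding surj_def
  proof
    fix y
    show "\<exists>p. y = l p" 
    proof (cases y)
      case (real r)
      obtain p where "f p = r" using surj by blast
      then have "y = l (ereal p)" using real l(1) by simp
      then show ?thesis by blast
    qed (use l in metis)+
  qed
  moreover have "p = l p \<or> (\<exists>a b. p = ereal a \<and> l p = ereal b \<and> \<bar>a - b\<bar> \<le> \<epsilon>)" for p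
    using \<phi>(1) by (cases p) (auto simp: l f_def)
  moreover have "\<forall>i\<in>I. l (ereal (x i)) = ereal (x i + d i)" by (auto simp: l f_def \<phi>(3))
  ultimately show ?thesis by blast
qed

section \<open>Upper bounds for the Skorokhod distance\<close>

lemma abs_arctan_diff_le: "\<bar>arctan a - arctan b\<bar> \<le> \<bar>a - b\<bar>"
proof -
  have "arctan v - arctan u \<le> v - u" if uv: "u < v" for u v
  proof -
    obtain z where "arctan v - arctan u = (v - u) * inverse (1 + z\<^sup>2)"
      using MVT2[OF uv, of arctan "\<lambda>x. inverse (1 + x\<^sup>2)"] DERIV_arctan by blast
    moreover have "inverse (1 + z\<^sup>2) \<le> 1" by (simp add: inverse_le_1_iff)
    ultimately show ?thesis using uv by (simp add: mult_left_le)
  qed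
  moreover have "arctan u \<le> arctan v" if "u \<le> v" for u v using that by (simp add: arctan_le_iff)
  ultimately show ?thesis by (smt (verit))
qed

lemma abs_ext_arctan_le: "\<bar>ext_arctan p\<bar> \<le> pi / 2"
proof (cases p)
  case (real r)
  then show ?thesis using arctan_lbound[of r] arctan_ubound[of r]
    unfolding abs_le_iff by (simp add: ext_arctan_def)
qed (auto simp: ext_arctan_def)

lemma skor_dist_le:
  fixes x y :: "ereal^'d \<Rightarrow> real"
  assumes l: "l \<in> time_changes" and xy: "\<And>t. \<bar>x t - y (\<chi> j. l j (t $ j))\<bar> \<le> c"
    and c: "\<And>j p. \<bar>ext_arctan (l j p) - ext_arctan p\<bar> \<le> c"
  shows "skor_dist x y \<le> c"
proof -
  let ?S = "\<lambda>l :: 'd \<Rightarrow> ereal \<Rightarrow> ereal. (SUP p. \<bar>ext_arctan (l (fst p) (snd p)) - ext_arctan (snd p)\<bar>)"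
  let ?f = "\<lambda>l. max (SUP t. \<bar>x t - y (\<chi> j. l j (t $ j))\<bar>) (?S l)"
  \<comment> \<open>The time part is a supremum over a bounded set, because
    \<open>ext_arctan\<close> is bounded. Its being nonnegative bounds the infimum over time changes
    from below.\<close>
  have nn: "0 \<le> ?S l" for l
  proof -
    have "bdd_above (range (\<lambda>p. \<bar>ext_arctan (l (fst p) (snd p)) - ext_arctan (snd p)\<bar>))"
    proof (rule bdd_aboveI2)
      fix p :: "'d \<times> ereal"
      show "\<bar>ext_arctan (l (fst p) (snd p)) - ext_arctan (snd p)\<bar> \<le> pi"
        using abs_ext_arctan_le[of "l (fst p) (snd p)"] abs_ext_arctan_le[of "snd p"]
          abs_triangle_ineq4[of "ext_arctan (l (fst p) (snd p))" "ext_arctan (snd p)"] by linarith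
    qed
    from cSUP_upper[OF UNIV_I this, of "(undefined, 0)"] show ?thesis
      by (rule order_trans[OF abs_ge_zero])
  qed
  have "skor_dist x y \<le> ?f l"
    unfolding skor_dist_def
  proof (rule cINF_lower)
    show "bdd_below (?f ` time_changes)" using nn by (intro bdd_belowI2[where m=0]) (simp add: max.coboundedI2)
  qed (rule l)
  also have "\<dots> \<le> c"
    by (intro max.boundedI cSUP_least) (use xy c in auto)
  finally show ?thesis .
qed

lemma skor_dist_le_uniform:
  assumes "\<And>t. \<bar>x t - y t\<bar> \<le> c"
  shows "skor_dist x y \<le> c"
proof (rule skor_dist_le[of "\<lambda>_ p. p"])
  show "(\<lambda>_ p. p) \<in> time_changes" by (auto simp: time_changes_def strict_mono_def)
  have "0 \<le> c" using assms order_trans[OF abs_ge_zero] by blast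
  then show "\<bar>ext_arctan p - ext_arctan p\<bar> \<le> c" for p by simp
qed (use assms in \<open>simp add: vec_lambda_eta\<close>)

section \<open>Continuous functions, indicators and linear operations in
  \<open>Dspace\<close>\<close>

lemma continuous_in_Dspace: "continuous_on UNIV x \<Longrightarrow> x \<in> Dspace"
proof -
  assume x: "continuous_on UNIV x"
  have "(x \<longlongrightarrow> x t) (at t within S)" for t S
    by (rule tendsto_within_subset[of _ _ _ UNIV]) (use x in \<open>auto simp: continuous_on_def\<close>)
  then show "x \<in> Dspace" unfolding Dspace_def by auto
qed

text \<open>In the quadrant R of t, the coordinates marked by R stay strictly below those of t and
  the others at or above them. Close to t the comparison with \<open>a $ j\<close> is therefore
  decided by a strict, respectively weak, comparison of \<open>a $ j\<close> with
  \<open>t $ j\<close>, and the indicator is constant.\<close>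

lemma indicator_in_Dspace:
  fixes a :: "real^'d"
  shows "(\<lambda>t. if ext_le a t then 1 else 0) \<in> Dspace"
proof -
  let ?f = "\<lambda>t. if ext_le a t then 1 else (0::real)"
  have lim: "(?f \<longlongrightarrow> (if \<forall>j. (if R j then ereal (a $ j) < t $ j else ereal (a $ j) \<le> t $ j) then 1 else 0))
      (at t within quadrant t R)" for t R
  proof (rule tendsto_eventually)
    have "eventually (\<lambda>s. ereal (a $ j) \<le> s $ j \<longleftrightarrow> (if R j then ereal (a $ j) < t $ j else ereal (a $ j) \<le> t $ j))
        (at t within quadrant t R)" for j
    proof -
      have q: "eventually (\<lambda>s. s \<in> quadrant t R) (at t within quadrant t R)"
        by (simp add: eventually_at_filter)
      have s: "((\<lambda>s. s $ j) \<longlongrightarrow> t $ j) (at t within quadrant t R)"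
        by (intro tendsto_vec_nth tendsto_ident_at)
      show ?thesis
      proof (cases "R j")
        case True
        show ?thesis
        proof (cases "ereal (a $ j) < t $ j")
          case lt: True
          from order_tendstoD(1)[OF s lt] show ?thesis by eventually_elim (use True lt in auto)
        next
          case False
          from q show ?thesis by eventually_elim (use True False in \<open>auto simp: quadrant_def dest!: spec[of _ j]\<close>)
        qed
      next
        case nR: False
        show ?thesis
        proof (cases "ereal (a $ j) \<le> t $ j")
          case True
          from q show ?thesis by eventually_elim (use True nR in \<open>auto simp: quadrant_def dest!: spec[of _ j]\<close>)
        next
          case False
          then have "t $ j < ereal (a $ j)" by simp
          from order_tendstoD(2)[OF s this] show ?thesis by eventually_elim (use False nR in auto)
        qed
      qed
    qed
    then have "eventually (\<lambda>s. \<forall>j. ereal (a $ j) \<le> s $ j \<longleftrightarrow> (if R j then ereal (a $ j) < t $ j else ereal (a $ j) \<le> t $ j))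
        (at t within quadrant t R)" by (rule eventually_all_finite)
    then show "eventually (\<lambda>s. ?f s = (if \<forall>j. (if R j then ereal (a $ j) < t $ j else ereal (a $ j) \<le> t $ j) then 1 else 0))
        (at t within quadrant t R)"
      by eventually_elim (simp add: ext_le_def)
  qed
  show ?thesis
    unfolding Dspace_def
  proof (intro CollectI allI conjI)
    fix t R show "\<exists>l. (?f \<longlongrightarrow> l) (at t within quadrant t R)" using lim by blast
  next
    fix t show "(?f \<longlongrightarrow> ?f t) (at t within quadrant t (\<lambda>_. False))"
      using lim[where t=t and R="\<lambda>_. False"] by (simp add: ext_le_def)
  qed
qed

lemma Dspace_diff: "x \<in> Dspace \<Longrightarrow> y \<in> Dspace \<Longrightarrow> (\<lambda>t. x t - y t) \<in> Dspace"
proof -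
  assume x: "x \<in> Dspace" and y: "y \<in> Dspace"
  have "\<exists>l. ((\<lambda>t. x t - y t) \<longlongrightarrow> l) (at t within quadrant t R)" for t R
  proof -
    obtain l m where "(x \<longlongrightarrow> l) (at t within quadrant t R)" "(y \<longlongrightarrow> m) (at t within quadrant t R)"
      using x y unfolding Dspace_def by blast
    then show ?thesis using tendsto_diff by blast
  qed
  moreover have "((\<lambda>t. x t - y t) \<longlongrightarrow> x t - y t) (at t within quadrant t (\<lambda>_. False))" for t
    using x y unfolding Dspace_def by (intro tendsto_diff) blast+
  ultimately show ?thesis unfolding Dspace_def by blast
qed

lemma Dspace_divide: "x \<in> Dspace \<Longrightarrow> (\<lambda>t. x t / c) \<in> Dspace"
proof -
  assume x: "x \<in> Dspace"
  have "\<exists>l. ((\<lambda>t. x t / c) \<longlongrightarrow> l) (at t within quadrant t R)" for t R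
  proof -
    obtain l where "(x \<longlongrightarrow> l) (at t within quadrant t R)"
      using x unfolding Dspace_def by blast
    then show ?thesis unfolding divide_inverse using tendsto_mult_right by blast
  qed
  moreover have "((\<lambda>t. x t / c) \<longlongrightarrow> x t / c) (at t within quadrant t (\<lambda>_. False))" for t
    using x unfolding Dspace_def divide_inverse by (intro tendsto_mult_right) blast
  ultimately show ?thesis unfolding Dspace_def by blast
qed

lemma Dspace_sum:
  assumes "\<And>i. i \<in> I \<Longrightarrow> x i \<in> Dspace"
  shows "(\<lambda>t. \<Sum>i\<in>I. x i t) \<in> Dspace"
proof -
  have "\<exists>l. ((\<lambda>t. \<Sum>i\<in>I. x i t) \<longlongrightarrow> l) (at t within quadrant t R)" for t R
  proof -
    have "\<forall>i\<in>I. \<exists>l. (x i \<longlongrightarrow> l) (at t within quadrant t R)" using assms unfolding Dspace_def by blast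
    then obtain l where "\<forall>i\<in>I. (x i \<longlongrightarrow> l i) (at t within quadrant t R)" by metis
    then have "((\<lambda>t. \<Sum>i\<in>I. x i t) \<longlongrightarrow> (\<Sum>i\<in>I. l i)) (at t within quadrant t R)" by (intro tendsto_sum) auto
    then show ?thesis by blast
  qed
  moreover have "((\<lambda>t. \<Sum>i\<in>I. x i t) \<longlongrightarrow> (\<Sum>i\<in>I. x i t)) (at t within quadrant t (\<lambda>_. False))" for t
    using assms unfolding Dspace_def by (intro tendsto_sum) blast
  ultimately show ?thesis unfolding Dspace_def by blast
qed

text \<open>Relates a time vector to its image under the time changes of
  \<open>time_change_exists\<close>, which leave infinite times in place.\<close>

definition near_times :: "real \<Rightarrow> ereal^'d \<Rightarrow> ereal^'d \<Rightarrow> bool" where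
  "near_times \<delta> s t \<longleftrightarrow> (\<forall>j. s $ j = t $ j \<or> (\<exists>a b. s $ j = ereal a \<and> t $ j = ereal b \<and> \<bar>a - b\<bar> \<le> \<delta>))"

text \<open>The empirical process of a deterministic sample with an abstract centring, so that the
  sample can be rounded while the centring is kept.\<close>

definition emp :: "(ereal^'d \<Rightarrow> real) \<Rightarrow> nat \<Rightarrow> (nat \<Rightarrow> real^'d) \<Rightarrow> ereal^'d \<Rightarrow> real" where
  "emp F n x t = (\<Sum>i=1..n. (if ext_le (x i) t then 1 else 0) - F t) / sqrt (real n)"

lemma emp_in_Dspace:
  assumes "F \<in> Dspace" shows "emp F n x \<in> Dspace"
proof -
  have "(\<lambda>t. (if ext_le (x i) t then 1 else 0) - F t) \<in> Dspace" for i
    by (rule Dspace_diff[OF indicator_in_Dspace assms])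
  from Dspace_sum[of "{1..n}", OF this] show ?thesis
    unfolding emp_def[abs_def] by (rule Dspace_divide)
qed

definition disc :: "nat \<Rightarrow> real^'d \<Rightarrow> real^'d" where
  "disc N x = (\<chi> j. real_of_int \<lfloor>real (Suc N) * x $ j\<rfloor> / real (Suc N))"

lemma disc_bound: "\<bar>disc N x $ j - x $ j\<bar> \<le> 1 / real (Suc N)"
proof -
  have "disc N x $ j - x $ j = (real_of_int \<lfloor>real (Suc N) * x $ j\<rfloor> - real (Suc N) * x $ j) / real (Suc N)"
    by (simp add: disc_def diff_divide_distrib)
  moreover have "\<bar>real_of_int \<lfloor>real (Suc N) * x $ j\<rfloor> - real (Suc N) * x $ j\<bar> \<le> 1" by linarith
  ultimately show ?thesis by (simp add: divide_right_mono del: of_nat_Suc)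
qed

text \<open>In each coordinate, distinct sample values are at least c apart and equal ones are
  rounded alike. Once the mesh is small against c, the rounding displacement has slope at most 1/2
  on the sample and extends to a time change that carries jumps to jumps. The indicators then agree
  exactly, and only the centring contributes to the error.\<close>

lemma skor_dist_emp_disc:
  fixes x :: "nat \<Rightarrow> real^'d"
  assumes F: "\<And>e. 0 < e \<Longrightarrow> \<exists>\<delta>>0. \<forall>s t. near_times \<delta> s t \<longrightarrow> \<bar>F s - F t\<bar> < e" and e: "0 < e"
  shows "eventually (\<lambda>N. skor_dist (emp F n x) (emp F n (\<lambda>i. disc N (x i))) < e) sequentially"
proof -
  define \<eta> where "\<eta> = e / (2 * (real n + 1))"
  have eta: "0 < \<eta>" "real n * \<eta> \<le> e / 2"
    unfolding \<eta>_def using e by (auto simp: field_simps)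
  obtain \<delta> where \<delta>: "0 < \<delta>" "\<And>s t. near_times \<delta> s t \<Longrightarrow> \<bar>F s - F t\<bar> < \<eta>"
    using F[OF eta(1)] by blast
  define G where "G = {\<bar>x i $ j - x k $ j\<bar> | i k j. i \<in> {1..n} \<and> k \<in> {1..n} \<and> x i $ j \<noteq> x k $ j}"
  have "G \<subseteq> (\<lambda>(i, k, j). \<bar>x i $ j - x k $ j\<bar>) ` ({1..n} \<times> {1..n} \<times> UNIV)" unfolding G_def by force
  then have finG: "finite G" by (rule finite_subset) auto
  \<comment> \<open>The inserted 1 serves when there are no two distinct values.\<close>
  define c where "c = Min (insert 1 G)"
  have c: "0 < c" unfolding c_def using finG by (subst Min_gr_iff) (auto simp: G_def)
  have gap: "c \<le> \<bar>x i $ j - x k $ j\<bar>" if "i \<in> {1..n}" "k \<in> {1..n}" "x i $ j \<noteq> x k $ j" for i k j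
    unfolding c_def using finG that by (intro Min_le) (auto simp: G_def)
  \<comment> \<open>The three bounds serve the displacement of time, the oscillation of the centring
    and the slope: two displacements of at most c / 4 differ by at most half a gap.\<close>
  define \<epsilon> where "\<epsilon> = min (e / 2) (min \<delta> (c / 4))"
  have eps: "0 < \<epsilon>" "\<epsilon> \<le> e / 2" "\<epsilon> \<le> \<delta>" "4 * \<epsilon> \<le> c" unfolding \<epsilon>_def using e \<delta> c by auto
  have "eventually (\<lambda>N. 1 / real (Suc N) < \<epsilon>) sequentially"
    using order_tendstoD(2)[OF LIMSEQ_inverse_real_of_nat eps(1)] by (simp add: inverse_eq_divide)
  then show ?thesis
  proof eventually_elim
    case (elim N)
    let ?x' = "\<lambda>i. disc N (x i)"
    have db: "\<bar>disc N (x i) $ j - x i $ j\<bar> \<le> \<epsilon>" for i j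
      using disc_bound[of N "x i" j] elim by linarith
    define Q where "Q j l \<longleftrightarrow> strict_mono l \<and> surj l \<and> (\<forall>i\<in>{1..n}. l (ereal (x i $ j)) = ereal (x i $ j + (?x' i $ j - x i $ j))) \<and>
      (\<forall>p. p = l p \<or> (\<exists>a b. p = ereal a \<and> l p = ereal b \<and> \<bar>a - b\<bar> \<le> \<epsilon>))" for j and l :: "ereal \<Rightarrow> ereal"
    have "\<exists>l. Q j l" for j
      unfolding Q_def
    proof (rule time_change_exists)
      fix i k assume ik: "i \<in> {1..n}" "k \<in> {1..n}"
      show "\<bar>?x' i $ j - x i $ j - (?x' k $ j - x k $ j)\<bar> \<le> \<bar>x i $ j - x k $ j\<bar> / 2"
      proof (cases "x i $ j = x k $ j")
        case True then show ?thesis by (simp add: disc_def)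
      next
        case False
        have "\<bar>?x' i $ j - x i $ j - (?x' k $ j - x k $ j)\<bar> \<le> \<bar>?x' i $ j - x i $ j\<bar> + \<bar>?x' k $ j - x k $ j\<bar>"
          by (rule abs_triangle_ineq4)
        also have "\<dots> \<le> \<epsilon> + \<epsilon>" by (intro add_mono db)
        also have "\<dots> \<le> \<bar>x i $ j - x k $ j\<bar> / 2" using gap[OF ik False] eps(4) by simp
        finally show ?thesis .
      qed
    qed (use db eps in auto)
    then have "\<exists>l. \<forall>j. Q j (l j)" by (intro choice allI)
    then obtain l where "\<And>j. Q j (l j)" by blast
    then have l: "\<And>j. strict_mono (l j)" "\<And>j. surj (l j)"
      "\<And>i j. i \<in> {1..n} \<Longrightarrow> l j (ereal (x i $ j)) = ereal (?x' i $ j)"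
      "\<And>j p. p = l j p \<or> (\<exists>a b. p = ereal a \<and> l j p = ereal b \<and> \<bar>a - b\<bar> \<le> \<epsilon>)"
      unfolding Q_def by simp_all
    have "skor_dist (emp F n x) (emp F n ?x') \<le> e / 2"
    proof (rule skor_dist_le)
      show "l \<in> time_changes" using l by (simp add: time_changes_def)
      show "\<bar>ext_arctan (l j p) - ext_arctan p\<bar> \<le> e / 2" for j p
        using l(4)[of p j]
      proof
        assume "\<exists>a b. p = ereal a \<and> l j p = ereal b \<and> \<bar>a - b\<bar> \<le> \<epsilon>"
        then obtain a b where ab: "p = ereal a" "l j p = ereal b" "\<bar>a - b\<bar> \<le> \<epsilon>" by blast
        have "\<bar>arctan b - arctan a\<bar> \<le> \<bar>a - b\<bar>"
          using abs_arctan_diff_le[of b a] by (simp add: abs_minus_commute)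
        also have "\<dots> \<le> e / 2" using ab(3) eps(2) by (rule order_trans)
        finally show ?thesis using ab by (simp add: ext_arctan_def)
      next
        assume "p = l j p" then show ?thesis using e by simp
      qed
      fix t
      let ?t = "\<chi> j. l j (t $ j)"
      have ind: "ext_le (x i) t \<longleftrightarrow> ext_le (?x' i) ?t" if "i \<in> {1..n}" for i
        unfolding ext_le_def using l(3)[OF that, symmetric] strict_mono_less_eq[OF l(1)] by simp
      have "near_times \<delta> t ?t"
        unfolding near_times_def using l(4) eps(3) by (auto) (metis order_trans)
      from \<delta>(2)[OF this] have Fd: "\<bar>F t - F ?t\<bar> < \<eta>" .
      have "emp F n x t - emp F n ?x' ?t = (\<Sum>i=1..n. F ?t - F t) / sqrt (real n)"
        unfolding emp_def diff_divide_distrib[symmetric] sum_subtractf[symmetric]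
        using ind by (intro arg_cong2[where f="(/)"] sum.cong refl) auto
      also have "\<bar>\<dots>\<bar> = real n * \<bar>F t - F ?t\<bar> / sqrt (real n)"
        by (simp add: abs_mult abs_minus_commute)
      also have "\<dots> \<le> real n * \<bar>F t - F ?t\<bar>"
      proof (cases "n = 0")
        case False
        then have "1 \<le> sqrt (real n)" by simp
        then have "real n * \<bar>F t - F ?t\<bar> / sqrt (real n) \<le> real n * \<bar>F t - F ?t\<bar> / 1"
          using False by (intro divide_left_mono) auto
        then show ?thesis by simp
      qed simp
      also have "\<dots> \<le> real n * \<eta>" using Fd by (intro mult_left_mono) auto
      also have "\<dots> \<le> e / 2" by (rule eta)
      finally show "\<bar>emp F n x t - emp F n ?x' ?t\<bar> \<le> e / 2" .
    qed
    then show ?case using e by simp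
  qed
qed

text \<open>A rounded sample takes countably many values, so any function of it is measurable;
  Skorokhod continuity of g makes the values at the rounded samples converge pointwise.\<close>

lemma borel_measurable_skor_continuous_emp:
  fixes X :: "nat \<Rightarrow> 'a \<Rightarrow> real^'d"
  assumes g: "skor_continuous g" and FD: "F \<in> Dspace"
    and F: "\<And>e. 0 < e \<Longrightarrow> \<exists>\<delta>>0. \<forall>s t. near_times \<delta> s t \<longrightarrow> \<bar>F s - F t\<bar> < e"
    and X: "\<And>i. X i \<in> borel_measurable M"
  shows "(\<lambda>\<omega>. g (emp F n (\<lambda>i. X i \<omega>))) \<in> borel_measurable M"
proof (rule borel_measurable_LIMSEQ_real)
  fix N
  define a where "a = real (Suc N)"
  \<comment> \<open>The first n rounded observations are coded in the countable type of lists of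
    integer vectors; list positions start at 0, observations at 1.\<close>
  define k where "k \<omega> = map (\<lambda>i j. \<lfloor>a * X (Suc i) \<omega> $ j\<rfloor>) [0..<n]" for \<omega>
  define H where "H l = g (emp F n (\<lambda>i. \<chi> j. real_of_int ((l ! (i - 1)) j) / a))" for l :: "('d \<Rightarrow> int) list"
  have km: "k \<in> measurable M (count_space UNIV)"
  proof (subst measurable_count_space_eq2_countable, safe)
    fix l :: "('d \<Rightarrow> int) list"
    note [measurable] = X
    have "k \<omega> = l \<longleftrightarrow> length l = n \<and> (\<forall>i\<in>{..<n}. \<forall>j\<in>UNIV. \<lfloor>a * X (Suc i) \<omega> $ j\<rfloor> = (l ! i) j)" for \<omega>
      unfolding k_def list_eq_iff_nth_eq fun_eq_iff by auto
    then have "k -` {l} \<inter> space M = {\<omega> \<in> space M. length l = n \<and> (\<forall>i\<in>{..<n}. \<forall>j\<in>UNIV. \<lfloor>a * X (Suc i) \<omega> $ j\<rfloor> = (l ! i) j)}"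
      by blast
    also have "\<dots> \<in> sets M"
    proof (cases "length l = n")
      case True
      have [measurable]: "(\<lambda>\<omega>. X i \<omega> $ j) \<in> borel_measurable M" for i j
        using X[of i] by (rule measurable_compose) simp
      have "{\<omega> \<in> space M. \<lfloor>a * X (Suc i) \<omega> $ j\<rfloor> = (l ! i) j} \<in> sets M" for i j by measurable
      then have "{\<omega> \<in> space M. \<forall>i\<in>{..<n}. \<forall>j\<in>UNIV. \<lfloor>a * X (Suc i) \<omega> $ j\<rfloor> = (l ! i) j} \<in> sets M"
        by (intro sets.sets_Collect_finite_All) auto
      then show ?thesis using True by simp
    qed simp
    finally show "k -` {l} \<inter> space M \<in> sets M" .
  qed auto
  have "g (emp F n (\<lambda>i. disc N (X i \<omega>))) = H (k \<omega>)" for \<omega>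
  proof -
    have "disc N (X i \<omega>) = (\<chi> j. real_of_int ((k \<omega> ! (i - 1)) j) / a)" if "i \<in> {1..n}" for i
      using that by (auto simp: k_def disc_def a_def vec_eq_iff simp del: of_nat_Suc)
    then have "emp F n (\<lambda>i. disc N (X i \<omega>)) = emp F n (\<lambda>i. \<chi> j. real_of_int ((k \<omega> ! (i - 1)) j) / a)"
      unfolding emp_def[abs_def] by simp
    then show ?thesis unfolding H_def by simp
  qed
  moreover have "(\<lambda>\<omega>. H (k \<omega>)) \<in> borel_measurable M"
    by (rule measurable_compose[OF km]) simp
  ultimately show "(\<lambda>\<omega>. g (emp F n (\<lambda>i. disc N (X i \<omega>)))) \<in> borel_measurable M" by presburger
next
  fix \<omega>
  show "(\<lambda>N. g (emp F n (\<lambda>i. disc N (X i \<omega>)))) \<longlonglongrightarrow> g (emp F n (\<lambda>i. X i \<omega>))"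
  proof (rule tendstoI)
    fix e :: real assume "0 < e"
    from g[unfolded skor_continuous_def, rule_format, OF emp_in_Dspace[OF FD, of n "\<lambda>i. X i \<omega>"] this]
    obtain \<delta> where \<delta>: "\<delta> > 0" "\<And>y. y \<in> Dspace \<Longrightarrow> skor_dist (emp F n (\<lambda>i. X i \<omega>)) y < \<delta>
        \<Longrightarrow> \<bar>g y - g (emp F n (\<lambda>i. X i \<omega>))\<bar> < e" by blast
    have "eventually (\<lambda>N. skor_dist (emp F n (\<lambda>i. X i \<omega>)) (emp F n (\<lambda>i. disc N (X i \<omega>))) < \<delta>) sequentially"
      using F \<delta>(1) by (rule skor_dist_emp_disc)
    then show "eventually (\<lambda>N. dist (g (emp F n (\<lambda>i. disc N (X i \<omega>)))) (g (emp F n (\<lambda>i. X i \<omega>))) < e) sequentially"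
      unfolding dist_real_def by eventually_elim (rule \<delta>(2)[OF emp_in_Dspace[OF FD]])
  qed
qed

text \<open>Lipschitz regularisation with respect to the uniform distance, to which Skorokhod continuity restricts.\<close>
definition lip_reg :: "((ereal^'d \<Rightarrow> real) \<Rightarrow> real) \<Rightarrow> real \<Rightarrow> (ereal^'d \<Rightarrow> real) \<Rightarrow> real" where
  "lip_reg g k x = Inf {g y + k * c | y c. y \<in> Dspace \<and> 0 \<le> c \<and> (\<forall>t. \<bar>x t - y t\<bar> \<le> c)}"

context
  fixes g :: "(ereal^'d \<Rightarrow> real) \<Rightarrow> real" and B k :: real
  assumes B: "\<And>x. x \<in> Dspace \<Longrightarrow> \<bar>g x\<bar> \<le> B" and k: "0 \<le> k"
begin

lemma lip_reg_lower:
  assumes "y \<in> Dspace" "0 \<le> c" "\<And>t. \<bar>x t - y t\<bar> \<le> c"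
  shows "lip_reg g k x \<le> g y + k * c"
  unfolding lip_reg_def
proof (rule cInf_lower)
  show "g y + k * c \<in> {g y + k * c |y c. y \<in> Dspace \<and> 0 \<le> c \<and> (\<forall>t. \<bar>x t - y t\<bar> \<le> c)}" using assms by blast
  show "bdd_below {g y + k * c |y c. y \<in> Dspace \<and> 0 \<le> c \<and> (\<forall>t. \<bar>x t - y t\<bar> \<le> c)}"
  proof (rule bdd_belowI[where m="- B"], safe)
    fix y :: "ereal^'d \<Rightarrow> real" and c :: real assume "y \<in> Dspace" "0 \<le> c"
    then show "- B \<le> g y + k * c" using B[of y] mult_nonneg_nonneg[OF k, of c] by linarith
  qed
qed

lemma lip_reg_greatest:
  assumes x: "x \<in> Dspace" and m: "\<And>y c. y \<in> Dspace \<Longrightarrow> 0 \<le> c \<Longrightarrow> (\<And>t. \<bar>x t - y t\<bar> \<le> c) \<Longrightarrow> m \<le> g y + k * c"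
  shows "m \<le> lip_reg g k x"
  unfolding lip_reg_def
proof (rule cInf_greatest)
  have "g x + k * 0 \<in> {g y + k * c |y c. y \<in> Dspace \<and> 0 \<le> c \<and> (\<forall>t. \<bar>x t - y t\<bar> \<le> c)}" using x by force
  then show "{g y + k * c |y c. y \<in> Dspace \<and> 0 \<le> c \<and> (\<forall>t. \<bar>x t - y t\<bar> \<le> c)} \<noteq> {}" by blast
qed (use m in blast)

lemma lip_reg_le: "x \<in> Dspace \<Longrightarrow> lip_reg g k x \<le> g x"
  using lip_reg_lower[of x 0 x] by simp

lemma lip_reg_ge: "x \<in> Dspace \<Longrightarrow> - B \<le> lip_reg g k x"
proof (rule lip_reg_greatest)
  fix y :: "ereal^'d \<Rightarrow> real" and c :: real assume "y \<in> Dspace" "0 \<le> c"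
  then show "- B \<le> g y + k * c" using B[of y] mult_nonneg_nonneg[OF k, of c] by linarith
qed

lemma lip_reg_bound: "x \<in> Dspace \<Longrightarrow> \<bar>lip_reg g k x\<bar> \<le> B"
  using lip_reg_le lip_reg_ge B[of x] by fastforce

text \<open>A competitor for x' at distance c' is a competitor for x at distance c + c', at the
  additional cost k c.\<close>

lemma lip_reg_lipschitz1:
  assumes x: "x \<in> Dspace" and x': "x' \<in> Dspace" and c: "\<And>t. \<bar>x t - x' t\<bar> \<le> c"
  shows "lip_reg g k x - k * c \<le> lip_reg g k x'"
proof (rule lip_reg_greatest[OF x'])
  fix y :: "ereal^'d \<Rightarrow> real" and c' :: real assume y: "y \<in> Dspace" "0 \<le> c'" "\<And>t. \<bar>x' t - y t\<bar> \<le> c'"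
  have "0 \<le> c" using c order_trans[OF abs_ge_zero] by blast
  moreover have "\<bar>x t - y t\<bar> \<le> c + c'" for t using c[of t] y(3)[of t] by linarith
  ultimately have "lip_reg g k x \<le> g y + k * (c + c')" using y by (intro lip_reg_lower) auto
  then show "lip_reg g k x - k * c \<le> g y + k * c'" by (simp add: algebra_simps)
qed

lemma lip_reg_lipschitz:
  assumes "x \<in> Dspace" "x' \<in> Dspace" "\<And>t. \<bar>x t - x' t\<bar> \<le> c"
  shows "\<bar>lip_reg g k x - lip_reg g k x'\<bar> \<le> k * c"
proof (rule abs_leI)
  have "\<bar>x' t - x t\<bar> \<le> c" for t using assms(3)[of t] by (simp add: abs_minus_commute)
  from lip_reg_lipschitz1[OF assms(2,1) this] show "- (lip_reg g k x - lip_reg g k x') \<le> k * c" by simp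
  from lip_reg_lipschitz1[OF assms] show "lip_reg g k x - lip_reg g k x' \<le> k * c" by simp
qed

end

text \<open>Competitors within \<open>\<delta>\<close> of x have nearly the value \<open>g x\<close>
  by continuity; for all others the penalty is at least 2 B as soon as k \<ge> 2 B /
  \<delta>.\<close>

lemma lip_reg_tendsto:
  fixes g :: "(ereal^'d \<Rightarrow> real) \<Rightarrow> real"
  assumes B: "\<And>x. x \<in> Dspace \<Longrightarrow> \<bar>g x\<bar> \<le> B" and g: "skor_continuous g" and x: "x \<in> Dspace"
  shows "(\<lambda>k. lip_reg g (real k) x) \<longlonglongrightarrow> g x"
proof (rule metric_LIMSEQ_I)
  fix e :: real assume e: "0 < e"
  then obtain \<delta> where \<delta>: "\<delta> > 0" "\<And>y. y \<in> Dspace \<Longrightarrow> skor_dist x y < \<delta> \<Longrightarrow> \<bar>g y - g x\<bar> < e / 2"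
    using g x half_gt_zero[OF e] unfolding skor_continuous_def by meson
  obtain K :: nat where K: "2 * B / \<delta> \<le> real K" using real_arch_simple by blast
  show "\<exists>no. \<forall>k\<ge>no. dist (lip_reg g (real k) x) (g x) < e"
  proof (intro exI allI impI)
    fix k assume k: "k \<ge> K"
    have "g x - e / 2 \<le> lip_reg g (real k) x"
    proof (rule lip_reg_greatest[OF B _ x])
      fix y :: "ereal^'d \<Rightarrow> real" and c :: real assume y: "y \<in> Dspace" "0 \<le> c" "\<And>t. \<bar>x t - y t\<bar> \<le> c"
      show "g x - e / 2 \<le> g y + real k * c"
      proof (cases "c < \<delta>")
        case True
        have "\<bar>g y - g x\<bar> < e / 2"
          using skor_dist_le_uniform[of x y c, OF y(3)] True by (intro \<delta>(2) y(1)) simp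
        moreover have "0 \<le> real k * c" using y(2) by simp
        ultimately show ?thesis by linarith
      next
        case False
        have "2 * B \<le> real K * \<delta>" using K \<delta>(1) by (simp add: field_simps)
        also have "\<dots> \<le> real k * c" using k False \<delta>(1) by (intro mult_mono) auto
        finally show ?thesis using B[OF y(1)] B[OF x] e by linarith
      qed
    qed auto
    moreover have "lip_reg g (real k) x \<le> g x" by (rule lip_reg_le[OF B _ x]) auto
    ultimately show "dist (lip_reg g (real k) x) (g x) < e" using e by (simp add: dist_real_def)
  qed
qed

section \<open>Marginal quantiles and smoothed indicators\<close>

lemma holder_spaceI:
  fixes f :: "'v::real_normed_vector \<Rightarrow> real"
  assumes "\<And>x. \<bar>f x\<bar> \<le> S" and "\<And>x y. \<bar>f x - f y\<bar> \<le> K * norm (x - y) powr \<alpha>"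
  shows "f \<in> holder_space \<alpha>"
proof -
  have "\<bar>f x - f y\<bar> / norm (x - y) powr \<alpha> \<le> K" if "x \<noteq> y" for x y
    using assms(2)[of x y] that by (simp add: divide_le_eq)
  then have "bdd_above {\<bar>f x - f y\<bar> / norm (x - y) powr \<alpha> |x y. x \<noteq> y}"
    by (intro bdd_aboveI[where M=K]) blast
  moreover have "bounded (range f)" using assms(1) by (auto simp: bounded_iff)
  ultimately show ?thesis by (simp add: holder_space_def)
qed

lemma sup_norm_le:
  fixes f :: "'v \<Rightarrow> real"
  assumes "\<And>x. \<bar>f x\<bar> \<le> S" shows "sup_norm f \<le> S"
  unfolding sup_norm_def by (rule cSUP_least) (use assms in auto)

lemma holder_norm_bounds:
  fixes f :: "real^'d \<Rightarrow> real"
  assumes S: "\<And>x. \<bar>f x\<bar> \<le> S" and K: "\<And>x y. \<bar>f x - f y\<bar> \<le> K * norm (x - y) powr \<alpha>"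
  shows "holder_norm \<alpha> f \<le> S + K" and "0 \<le> holder_norm \<alpha> f"
proof -
  let ?h = "\<lambda>p. \<bar>f (fst p) - f (snd p)\<bar> / norm (fst p - snd p) powr \<alpha>"
  \<comment> \<open>The Hoelder constant is a supremum over pairs of distinct points; this pair
    shows that there is one.\<close>
  have ne: "(axis undefined 1, 0) \<in> {(x, y). x \<noteq> (y :: real^'d)}" by (simp add: axis_eq_0_iff)
  have le: "?h p \<le> K" if "p \<in> {(x, y). x \<noteq> y}" for p
    using K[of "fst p" "snd p"] that by (auto simp: divide_le_eq)
  have hc: "holder_const \<alpha> f \<le> K"
    unfolding holder_const_def by (rule cSUP_least) (use ne le in blast)+
  show "holder_norm \<alpha> f \<le> S + K"
    unfolding holder_norm_def using sup_norm_le[of f S] S hc by (simp add: add_mono)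
  have "?h (axis undefined 1, 0) \<le> holder_const \<alpha> f"
    unfolding holder_const_def
    by (rule cSUP_upper[OF ne]) (rule bdd_aboveI2[where M=K], use le in blast)
  then have "0 \<le> holder_const \<alpha> f" by (rule order_trans[rotated]) auto
  moreover
  have "\<bar>f 0\<bar> \<le> sup_norm f"
  proof -
    have "bdd_above (range (\<lambda>x. \<bar>f x\<bar>))" using S by (intro bdd_aboveI[where M=S]) auto
    then show ?thesis unfolding sup_norm_def using cSUP_upper[of 0 UNIV "\<lambda>x. \<bar>f x\<bar>"] by simp
  qed
  then have "0 \<le> sup_norm f" by (rule order_trans[OF abs_ge_zero])
  ultimately show "0 \<le> holder_norm \<alpha> f" unfolding holder_norm_def by (rule add_nonneg_nonneg[rotated])
qed

lemma abs_prod_diff_le: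
  fixes a b :: "'i \<Rightarrow> real"
  assumes "\<And>i. i \<in> I \<Longrightarrow> 0 \<le> a i \<and> a i \<le> 1" "\<And>i. i \<in> I \<Longrightarrow> 0 \<le> b i \<and> b i \<le> 1"
  shows "\<bar>(\<Prod>i\<in>I. a i) - (\<Prod>i\<in>I. b i)\<bar> \<le> (\<Sum>i\<in>I. \<bar>a i - b i\<bar>)"
  using norm_prod_diff[of I a b] assms by simp

text \<open>Fixes the parameters whose existence the moment condition asserts, so that later
  constants may depend on them.\<close>

locale empirical_setup = prob_space M
  for M :: "'a measure" and X :: "nat \<Rightarrow> 'a \<Rightarrow> real^'d" +
  fixes \<alpha> \<beta> \<gamma> r :: real and p :: nat and \<kappa> :: "nat \<Rightarrow> real" and lam z0 :: real
    and \<Phi> :: "real \<Rightarrow> real" and C :: real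
  assumes meas: "\<And>i. X i \<in> borel_measurable M"
    and alpha: "0 < \<alpha>" "\<alpha> \<le> 1"
    and clt: "\<And>f. f \<in> holder_space \<alpha> \<Longrightarrow> (\<integral>\<omega>. f (X 0 \<omega>) \<partial>M) = 0 \<Longrightarrow>
               (\<exists>\<sigma>\<ge>0. weak_conv_m
                    (\<lambda>n. distr M borel (\<lambda>\<omega>. (\<Sum>i=1..n. f (X i \<omega>)) / sqrt (real n)))
                    (normal_law \<sigma>))"
    and beta: "0 < \<beta>" and gamma: "1 < \<gamma>" and r: "1 \<le> r" and p: "r * real CARD('d) < real p"
    and kappa: "\<And>i. i \<in> {1..p} \<Longrightarrow> 0 < \<kappa> i \<and>
          \<kappa> i < \<gamma> * (real i / r + 2 * (real p - real i) - real CARD('d))"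
    and lam: "1 < lam" and z0: "0 < z0"
    and Phi_bij: "bij_betw \<Phi> {0..} {0..}" and Phi_mono: "mono_on {0..} \<Phi>"
    and mod: "\<And>y. 0 < y \<Longrightarrow> modulus (dfun M X) y \<le> \<beta> * (\<Phi> (y powr (- \<alpha>))) powr (- \<gamma>)"
    and doubling: "\<And>z. z0 \<le> z \<Longrightarrow> \<Phi> (2 * z) \<le> lam * \<Phi> z"
    and C: "0 < C"
    and moment: "\<And>f n. f \<in> holder_space \<alpha> \<Longrightarrow> sup_norm f \<le> 1 \<Longrightarrow> 1 \<le> n \<Longrightarrow>
          (\<integral>\<omega>. \<bar>\<Sum>i=1..n. f (X i \<omega>) - (\<integral>\<omega>. f (X 0 \<omega>) \<partial>M)\<bar> ^ (2 * p) \<partial>M)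
            \<le> C * (\<Sum>i=1..p. real n ^ i
                    * ((\<integral>\<omega>. \<bar>f (X 0 \<omega>) - (\<integral>\<omega>. f (X 0 \<omega>) \<partial>M)\<bar> powr r \<partial>M) powr (1 / r)) ^ i
                    * (\<Phi> (holder_norm \<alpha> (\<lambda>x. f x - (\<integral>\<omega>. f (X 0 \<omega>) \<partial>M)))) powr (\<kappa> i))"
begin

lemma meas_comp [measurable]: "(\<lambda>\<omega>. X i \<omega> $ j) \<in> borel_measurable M"
  using meas[of i] by (rule measurable_compose) simp

text \<open>Marginal distribution functions, taken also at infinite times; they provide the scale on
  which the grids are dyadic.\<close>

definition u :: "'d \<Rightarrow> ereal \<Rightarrow> real" where
  "u j t = prob {\<omega> \<in> space M. ereal (X 0 \<omega> $ j) \<le> t}"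

lemma u_bounds: "0 \<le> u j t" "u j t \<le> 1"
  by (auto simp: u_def)

lemma u_mono: "s \<le> t \<Longrightarrow> u j s \<le> u j t"
  unfolding u_def by (rule finite_measure_mono) (auto intro: order_trans)

lemma u_less_imp: "u j s < u j t \<Longrightarrow> s < t"
  using u_mono[of t s j] by (meson not_le)

lemma Phi_nonneg: "0 \<le> z \<Longrightarrow> 0 \<le> \<Phi> z"
  using Phi_bij by (auto simp: bij_betw_def)

lemma Phi_surj:
  assumes "0 \<le> v" obtains z where "0 \<le> z" "\<Phi> z = v"
  using Phi_bij assms by (metis atLeast_iff bij_betw_imp_surj_on imageE)

lemma Phi_le: "0 \<le> x \<Longrightarrow> x \<le> y \<Longrightarrow> \<Phi> x \<le> \<Phi> y"
  using Phi_mono by (auto simp: mono_on_def)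

lemma Phi_le_cancel: "0 \<le> x \<Longrightarrow> 0 \<le> y \<Longrightarrow> \<Phi> x \<le> \<Phi> y \<Longrightarrow> x \<le> y"
proof (rule ccontr)
  assume a: "0 \<le> x" "0 \<le> y" "\<Phi> x \<le> \<Phi> y" "\<not> x \<le> y"
  then have "\<Phi> x = \<Phi> y" using Phi_le[of y x] by simp
  then have "x = y" using a Phi_bij by (auto simp: bij_betw_def inj_on_def)
  then show False using a by simp
qed

text \<open>The marginal is the limit of the joint distribution function as the other coordinates
  grow. Two arguments that share these coordinates differ by y - x along a single axis.\<close>

lemma u_increment:
  assumes xy: "x < y"
  shows "u j (ereal y) - u j (ereal x) \<le> modulus (dfun M X) (y - x)"
proof -
  have lim: "(\<lambda>N. dfun M X (\<chi> i. if i = j then a else real N)) \<longlonglongrightarrow> u j (ereal a)" for a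
  proof -
    define A where "A N = {\<omega> \<in> space M. \<forall>i. X 0 \<omega> $ i \<le> (\<chi> i. if i = j then a else real N) $ i}" for N
    have "A N \<in> sets M" for N
    proof -
      have "A N = {\<omega> \<in> space M. \<forall>i\<in>UNIV. X 0 \<omega> $ i \<le> (if i = j then a else real N)}" by (simp add: A_def)
      also have "\<dots> \<in> sets M" by (intro sets.sets_Collect_finite_All) auto
      finally show ?thesis .
    qed
    then have "range A \<subseteq> sets M" by blast
    moreover have "incseq A"
      unfolding incseq_def A_def by (auto split: if_splits) (meson of_nat_mono order_trans)
    ultimately have "(\<lambda>N. prob (A N)) \<longlonglongrightarrow> prob (\<Union>N. A N)" by (rule finite_Lim_measure_incseq)
    moreover have "(\<Union>N. A N) = {\<omega> \<in> space M. ereal (X 0 \<omega> $ j) \<le> ereal a}"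
    proof safe
      fix \<omega> assume w: "\<omega> \<in> space M" "ereal (X 0 \<omega> $ j) \<le> ereal a"
      obtain N where N: "norm (X 0 \<omega>) \<le> real N" using real_arch_simple by blast
      have "X 0 \<omega> $ i \<le> real N" for i
        using component_le_norm_cart[of "X 0 \<omega>" i] N by linarith
      then have "\<omega> \<in> A N" using w by (auto simp: A_def)
      then show "\<omega> \<in> (\<Union>N. A N)" by blast
    next
      fix \<omega> N assume "\<omega> \<in> A N"
      then have "\<omega> \<in> space M" and "\<forall>i. X 0 \<omega> $ i \<le> (if i = j then a else real N)" by (auto simp: A_def)
      then show "\<omega> \<in> space M" "ereal (X 0 \<omega> $ j) \<le> ereal a" by (auto dest: spec[of _ j])
    qed
    ultimately show ?thesis by (simp add: dfun_def A_def u_def)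
  qed
  have "(\<lambda>N. dfun M X (\<chi> i. if i = j then y else real N) - dfun M X (\<chi> i. if i = j then x else real N))
     \<longlonglongrightarrow> u j (ereal y) - u j (ereal x)"
    by (intro tendsto_diff lim)
  moreover have "dfun M X (\<chi> i. if i = j then y else real N) - dfun M X (\<chi> i. if i = j then x else real N)
     \<le> modulus (dfun M X) (y - x)" for N
  proof -
    let ?t = "\<chi> i. if i = j then y else real N" and ?s = "\<chi> i. if i = j then x else real N"
    have "?t - ?s = axis j (y - x)" by (simp add: vec_eq_iff axis_def)
    then have "norm (?t - ?s) = y - x" using xy by (simp add: norm_eq_sqrt_inner inner_axis_axis)
    then have in1: "(?t, ?s) \<in> {(t, s). norm (t - s) \<le> y - x}" by simp
    have "\<bar>dfun M X (fst (?t, ?s)) - dfun M X (snd (?t, ?s))\<bar> \<le> modulus (dfun M X) (y - x)"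
      unfolding modulus_def
    proof (rule cSUP_upper[OF in1], rule bdd_aboveI2)
      fix q :: "(real^'d) \<times> (real^'d)"
      have d: "0 \<le> dfun M X t \<and> dfun M X t \<le> 1" for t by (simp add: dfun_def)
      show "\<bar>dfun M X (fst q) - dfun M X (snd q)\<bar> \<le> 1" using d[of "fst q"] d[of "snd q"] by (simp add: abs_le_iff)
    qed
    then show ?thesis by simp
  qed
  ultimately show ?thesis by (intro LIMSEQ_le_const2) auto
qed

lemma u_increment_Phi:
  assumes "x < y"
  shows "u j (ereal y) - u j (ereal x) \<le> \<beta> * (\<Phi> ((y - x) powr (- \<alpha>))) powr (- \<gamma>)"
  using u_increment[OF assms, of j] mod[of "y - x"] assms by simp

lemma u_uniform:
  assumes e: "0 < e"
  shows "\<exists>\<delta>>0. \<forall>j x y. \<bar>x - y\<bar> \<le> \<delta> \<longrightarrow> \<bar>u j (ereal x) - u j (ereal y)\<bar> < e"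
proof -
  \<comment> \<open>Solves \<open>\<beta> * v powr (- \<gamma>)\<close> = e / 2; a preimage of v
    under \<open>\<Phi>\<close> then yields the admissible step.\<close>
  define v where "v = (2 * \<beta> / e) powr (1 / \<gamma>)"
  have v: "0 < v" unfolding v_def using beta e by simp
  have "v powr (- \<gamma>) = e / (2 * \<beta>)"
    unfolding v_def powr_powr using gamma beta e by (simp add: powr_minus)
  then have ve: "\<beta> * v powr (- \<gamma>) = e / 2" using beta by simp
  obtain z where z: "0 \<le> z" "\<Phi> z = v" using Phi_surj[of v] v by auto
  \<comment> \<open>The preimage may be 0; the maximum with 1 allows negative powers, and
    monotonicity of \<open>\<Phi>\<close> absorbs the change.\<close>
  define z' where "z' = max 1 z"
  define \<delta> where "\<delta> = z' powr (- 1 / \<alpha>)"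
  have d: "0 < \<delta>" unfolding \<delta>_def z'_def by simp
  have one: "u j (ereal y) - u j (ereal x) \<le> e / 2" if xy: "x < y" "y - x \<le> \<delta>" for x y j
  proof -
    have "z' = \<delta> powr (- \<alpha>)" unfolding \<delta>_def powr_powr using alpha by (simp add: z'_def)
    also have "\<dots> \<le> (y - x) powr (- \<alpha>)" using xy alpha by (intro powr_mono2') auto
    finally have "z \<le> (y - x) powr (- \<alpha>)" by (simp add: z'_def)
    then have "v \<le> \<Phi> ((y - x) powr (- \<alpha>))" using z Phi_le by metis
    then have "(\<Phi> ((y - x) powr (- \<alpha>))) powr (- \<gamma>) \<le> v powr (- \<gamma>)"
      using v gamma by (intro powr_mono2') auto
    then have "\<beta> * (\<Phi> ((y - x) powr (- \<alpha>))) powr (- \<gamma>) \<le> e / 2"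
      using ve beta by (metis mult_left_mono less_imp_le)
    then show ?thesis using u_increment_Phi[OF xy(1), of j] by simp
  qed
  have "\<bar>u j (ereal x) - u j (ereal y)\<bar> < e" if "\<bar>x - y\<bar> \<le> \<delta>" for j x y
  proof -
    consider "x < y" | "x = y" | "y < x" by linarith
    then show ?thesis
    proof cases
      case 1
      then have "u j (ereal x) \<le> u j (ereal y)" by (intro u_mono) simp
      then show ?thesis using one[OF 1, of j] that 1 e by simp
    next
      case 3
      then have "u j (ereal y) \<le> u j (ereal x)" by (intro u_mono) simp
      then show ?thesis using one[OF 3, of j] that 3 e by simp
    qed (use e in auto)
  qed
  then show ?thesis using d by blast
qed

lemma u_isCont: "isCont (\<lambda>x. u j (ereal x)) x"
  unfolding continuous_at_eps_delta
proof (intro allI impI)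
  fix e :: real assume "0 < e"
  then obtain \<delta> where \<delta>: "\<delta> > 0" "\<forall>j x y. \<bar>x - y\<bar> \<le> \<delta> \<longrightarrow> \<bar>u j (ereal x) - u j (ereal y)\<bar> < e"
    using u_uniform by blast
  then show "\<exists>d>0. \<forall>x'. dist x' x < d \<longrightarrow> dist (u j (ereal x')) (u j (ereal x)) < e"
    by (intro exI[of _ \<delta>]) (auto simp: dist_real_def)
qed

lemma u_at_top: "(\<lambda>N. u j (ereal (real N))) \<longlonglongrightarrow> 1"
proof -
  let ?A = "\<lambda>N. {\<omega> \<in> space M. ereal (X 0 \<omega> $ j) \<le> ereal (real N)}"
  have "(\<lambda>N. prob (?A N)) \<longlonglongrightarrow> prob (\<Union>N. ?A N)"
    by (rule finite_Lim_measure_incseq) (auto simp: incseq_def)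
  moreover have "(\<Union>N. ?A N) = space M" using real_arch_simple by auto
  ultimately show ?thesis by (simp add: u_def prob_space)
qed

lemma u_at_bot: "(\<lambda>N. u j (ereal (- real N))) \<longlonglongrightarrow> 0"
proof -
  let ?A = "\<lambda>N. {\<omega> \<in> space M. ereal (X 0 \<omega> $ j) \<le> ereal (- real N)}"
  have "(\<lambda>N. prob (?A N)) \<longlonglongrightarrow> prob (\<Inter>N. ?A N)"
    by (rule finite_Lim_measure_decseq) (auto simp: decseq_def)
  moreover have "(\<Inter>N. ?A N) = {}"
  proof -
    have "\<exists>N. \<not> X 0 \<omega> $ j \<le> - real N" for \<omega>
      using reals_Archimedean2[of "- (X 0 \<omega> $ j)"] by (metis add.inverse_inverse neg_less_iff_less not_le)
    then show ?thesis by auto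
  qed
  ultimately show ?thesis by (simp add: u_def)
qed

text \<open>\<open>u j\<close> may be flat, so a level can have many preimages, any of which serves;
  one exists at every level strictly between 0 and 1.\<close>

definition quant :: "'d \<Rightarrow> real \<Rightarrow> real" where
  "quant j a = (SOME x. u j (ereal x) = a)"

lemma u_quant:
  assumes a: "0 < a" "a < 1" shows "u j (ereal (quant j a)) = a"
  unfolding quant_def
proof (rule someI_ex)
  from order_tendstoD(1)[OF u_at_top a(2), of j] obtain N where N: "a < u j (ereal (real N))"
    using eventually_happens by force
  from order_tendstoD(2)[OF u_at_bot a(1), of j] obtain K where K: "u j (ereal (- real K)) < a"
    using eventually_happens by force
  have "- real K \<le> real N" by simp
  then have "\<exists>x. - real K \<le> x \<and> x \<le> real N \<and> u j (ereal x) = a"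
    using IVT[of "\<lambda>x. u j (ereal x)" "- real K" a "real N"] u_isCont N K by simp
  then show "\<exists>x. u j (ereal x) = a" by blast
qed

text \<open>Between \<open>u j t\<close> and a prescribed bound lies a level that has a quantile,
  and by monotonicity this quantile separates t from the times that violate the bound. The argument
  covers the infinite times as well.\<close>

lemma u_continuous: "continuous_on UNIV (u j)"
  unfolding continuous_on_def
proof
  fix t
  show "(u j \<longlongrightarrow> u j t) (at t within UNIV)"
  proof (rule order_tendstoI)
    fix a assume a: "a < u j t"
    show "eventually (\<lambda>s. a < u j s) (at t)"
    proof (cases "a < 0")
      case True
      then show ?thesis using u_bounds(1)[of j] by (intro always_eventually allI) (meson less_le_trans)
    next
      case False
      define a' where "a' = (a + u j t) / 2"
      have a': "0 < a'" "a' < 1" "a < a'" "a' < u j t" unfolding a'_def using False a u_bounds(2)[of j t] by auto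
      then have "ereal (quant j a') < t" by (intro u_less_imp[of j]) (simp add: u_quant)
      from order_tendstoD(1)[OF tendsto_ident_at this]
      show ?thesis
      proof eventually_elim
        case (elim s)
        then have "u j (ereal (quant j a')) \<le> u j s" by (intro u_mono) simp
        then show ?case using a' by (simp add: u_quant)
      qed
    qed
  next
    fix a assume a: "u j t < a"
    show "eventually (\<lambda>s. u j s < a) (at t)"
    proof (cases "1 < a")
      case True
      then show ?thesis using u_bounds(2)[of j] by (intro always_eventually allI) (meson le_less_trans)
    next
      case False
      define a' where "a' = (a + u j t) / 2"
      have a': "0 < a'" "a' < 1" "a' < a" "u j t < a'" unfolding a'_def using False a u_bounds(1)[of j t] by auto
      then have "t < ereal (quant j a')" by (intro u_less_imp[of j]) (simp add: u_quant)
      from order_tendstoD(2)[OF tendsto_ident_at this]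
      show ?thesis
      proof eventually_elim
        case (elim s)
        then have "u j s \<le> u j (ereal (quant j a'))" by (intro u_mono) simp
        then show ?case using a' by (simp add: u_quant)
      qed
    qed
  qed
qed

lemma u_measurable [measurable]: "(\<lambda>x. u j (ereal x)) \<in> borel_measurable borel"
  by (rule borel_measurable_mono) (auto simp: mono_def intro: u_mono)

text \<open>The probability integral transform makes a coordinate uniform: each tail is compared
  with the event below a quantile of level w, and w is then sent to the end of the interval.\<close>

lemma prob_u_between:
  assumes ab: "a \<le> b"
  shows "prob {\<omega> \<in> space M. a \<le> u j (ereal (X 0 \<omega> $ j)) \<and> u j (ereal (X 0 \<omega> $ j)) \<le> b} \<le> b - a"
proof -
  let ?V = "\<lambda>\<omega>. u j (ereal (X 0 \<omega> $ j))"
  have le: "prob {\<omega> \<in> space M. ?V \<omega> \<le> b} \<le> b" if b: "0 \<le> b" for b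
  proof (cases "1 \<le> b")
    case True then show ?thesis using prob_le_1 order_trans by blast
  next
    case False
    then have "b < 1" by simp
    then show ?thesis
    proof (rule dense_ge_bounded)
      fix w assume w: "b < w" "w < 1"
      have "prob {\<omega> \<in> space M. ?V \<omega> \<le> b} \<le> prob {\<omega> \<in> space M. ereal (X 0 \<omega> $ j) \<le> ereal (quant j w)}"
      proof (rule finite_measure_mono)
        show "{\<omega> \<in> space M. ?V \<omega> \<le> b} \<subseteq> {\<omega> \<in> space M. ereal (X 0 \<omega> $ j) \<le> ereal (quant j w)}"
        proof safe
          fix \<omega> assume "?V \<omega> \<le> b"
          then have "?V \<omega> < u j (ereal (quant j w))" using w b by (simp add: u_quant)
          from u_less_imp[OF this] show "ereal (X 0 \<omega> $ j) \<le> ereal (quant j w)" by simp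
        qed
      qed measurable
      also have "\<dots> = w" using u_quant[of w j] w b by (simp add: u_def)
      finally show "prob {\<omega> \<in> space M. ?V \<omega> \<le> b} \<le> w" .
    qed
  qed
  have ge: "a \<le> prob {\<omega> \<in> space M. ?V \<omega> < a}" if a: "a \<le> 1" for a
  proof (cases "a \<le> 0")
    case True then show ?thesis using order_trans by fastforce
  next
    case False
    then have "0 < a" by simp
    then show ?thesis
    proof (rule dense_le_bounded)
      fix w assume w: "0 < w" "w < a"
      have "w = prob {\<omega> \<in> space M. ereal (X 0 \<omega> $ j) \<le> ereal (quant j w)}"
        using u_quant[of w j] w a by (simp add: u_def)
      also have "\<dots> \<le> prob {\<omega> \<in> space M. ?V \<omega> < a}"
      proof (rule finite_measure_mono)
        show "{\<omega> \<in> space M. ereal (X 0 \<omega> $ j) \<le> ereal (quant j w)} \<subseteq> {\<omega> \<in> space M. ?V \<omega> < a}"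
        proof safe
          fix \<omega> assume "ereal (X 0 \<omega> $ j) \<le> ereal (quant j w)"
          from u_mono[OF this, of j] show "?V \<omega> < a" using w a by (simp add: u_quant)
        qed
      qed measurable
      finally show "w \<le> prob {\<omega> \<in> space M. ?V \<omega> < a}" .
    qed
  qed
  consider "b < 0" | "1 < a" | "0 \<le> b" "a \<le> 1" by linarith
  then show ?thesis
  proof cases
    case 1
    then have "\<not> (a \<le> ?V \<omega> \<and> ?V \<omega> \<le> b)" for \<omega> using u_bounds(1)[of j "ereal (X 0 \<omega> $ j)"] by linarith
    then have "{\<omega> \<in> space M. a \<le> ?V \<omega> \<and> ?V \<omega> \<le> b} = {}" by blast
    then show ?thesis using ab by (metis measure_empty diff_ge_0_iff_ge)
  next
    case 2
    then have "\<not> (a \<le> ?V \<omega> \<and> ?V \<omega> \<le> b)" for \<omega> using u_bounds(2)[of j "ereal (X 0 \<omega> $ j)"] by linarith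
    then have "{\<omega> \<in> space M. a \<le> ?V \<omega> \<and> ?V \<omega> \<le> b} = {}" by blast
    then show ?thesis using ab by (metis measure_empty diff_ge_0_iff_ge)
  next
    case 3
    have "{\<omega> \<in> space M. a \<le> ?V \<omega> \<and> ?V \<omega> \<le> b} = {\<omega> \<in> space M. ?V \<omega> \<le> b} - {\<omega> \<in> space M. ?V \<omega> < a}"
      by auto
    also have "prob \<dots> = prob {\<omega> \<in> space M. ?V \<omega> \<le> b} - prob {\<omega> \<in> space M. ?V \<omega> < a}"
      using ab by (intro finite_measure_Diff) auto
    finally show ?thesis using le[OF 3(1)] ge[OF 3(2)] by simp
  qed
qed

section \<open>Piecewise linear cut-offs between neighbouring quantiles\<close>

text \<open>The first two clauses avoid the quantiles of orders 0 and 1, which may be infinite; they cost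
  only a further 1/2^k in mean.\<close>
definition \<psi> :: "nat \<Rightarrow> 'd \<Rightarrow> nat \<Rightarrow> real \<Rightarrow> real" where
  "\<psi> k j l x = (if l \<le> 1 then 0 else if 2 ^ k \<le> l then 1 else
     max 0 (min 1 ((quant j (real l / 2 ^ k) - x) / (quant j (real l / 2 ^ k) - quant j ((real l - 1) / 2 ^ k)))))"

lemma psi_bounds: "0 \<le> \<psi> k j l x" "\<psi> k j l x \<le> 1"
  by (auto simp: \<psi>_def)

lemma psi_quant:
  assumes l: "1 < l" "l < 2 ^ k"
  shows "u j (ereal (quant j (real l / 2 ^ k))) = real l / 2 ^ k"
    and "u j (ereal (quant j ((real l - 1) / 2 ^ k))) = (real l - 1) / 2 ^ k"
    and "quant j ((real l - 1) / 2 ^ k) < quant j (real l / 2 ^ k)"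
proof -
  have lk: "real l < 2 ^ k" using l(2) by (metis of_nat_less_iff of_nat_numeral of_nat_power)
  then have "real l - 1 < 2 ^ k" by linarith
  with lk have b: "0 < real l / 2 ^ k" "real l / 2 ^ k < 1" "0 < (real l - 1) / 2 ^ k" "(real l - 1) / 2 ^ k < 1"
    using l(1) by (simp_all add: divide_less_eq)
  show 1: "u j (ereal (quant j (real l / 2 ^ k))) = real l / 2 ^ k"
    using b by (intro u_quant)
  show 2: "u j (ereal (quant j ((real l - 1) / 2 ^ k))) = (real l - 1) / 2 ^ k"
    using b by (intro u_quant)
  have "u j (ereal (quant j ((real l - 1) / 2 ^ k))) < u j (ereal (quant j (real l / 2 ^ k)))"
    unfolding 1 2 by (simp add: divide_strict_right_mono)
  from u_less_imp[OF this] show "quant j ((real l - 1) / 2 ^ k) < quant j (real l / 2 ^ k)" by simp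
qed

text \<open>The descent takes place between the quantiles of orders (l - 1) / 2^k and l / 2^k,
  whence the 1 subtracted. The clause \<open>l \<le> 1\<close> cannot occur here because
  \<open>u\<close> is nonnegative.\<close>

lemma psi_eq_1:
  assumes "2 ^ k * u j (ereal x) < real l - 1"
  shows "\<psi> k j l x = 1"
proof (cases "l \<le> 1 \<or> 2 ^ k \<le> l")
  case True
  have "0 \<le> 2 ^ k * u j (ereal x)" using u_bounds(1) by simp
  then have "\<not> l \<le> 1" using assms by linarith
  then show ?thesis using True by (simp add: \<psi>_def)
next
  case False
  then have l: "1 < l" "l < 2 ^ k" by auto
  have "u j (ereal x) < u j (ereal (quant j ((real l - 1) / 2 ^ k)))"
    unfolding psi_quant[OF l] using assms by (simp add: field_simps)
  from u_less_imp[OF this] have "x < quant j ((real l - 1) / 2 ^ k)" by simp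
  then show ?thesis using l psi_quant(3)[OF l, of j] by (simp add: \<psi>_def le_divide_eq)
qed

text \<open>Beyond the quantile of order l / 2^k the descent is complete. The clause
  \<open>2 ^ k \<le> l\<close> cannot occur here because \<open>u\<close> is at most 1.\<close>

lemma psi_eq_0:
  assumes "real l < 2 ^ k * u j (ereal x)"
  shows "\<psi> k j l x = 0"
proof (cases "l \<le> 1 \<or> 2 ^ k \<le> l")
  case True
  have "2 ^ k * u j (ereal x) \<le> 2 ^ k * 1" using u_bounds(2) by (intro mult_left_mono) auto
  then have "real l < 2 ^ k" using assms by linarith
  then have "\<not> 2 ^ k \<le> l" by (metis not_le of_nat_less_iff of_nat_numeral of_nat_power)
  then show ?thesis using True by (simp add: \<psi>_def)
next
  case False
  then have l: "1 < l" "l < 2 ^ k" by auto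
  have "u j (ereal (quant j (real l / 2 ^ k))) < u j (ereal x)"
    unfolding psi_quant[OF l] using assms by (simp add: field_simps)
  from u_less_imp[OF this] have "quant j (real l / 2 ^ k) < x" by simp
  then show ?thesis using l psi_quant(3)[OF l, of j] by (simp add: \<psi>_def divide_le_0_iff)
qed

text \<open>Neighbouring quantiles at level k have a gap D with 1/2^k at most the modulus of continuity at D,
  hence the Hoelder constant D powr (- \<alpha>) is at most this bound.\<close>
definition H :: "nat \<Rightarrow> real" where
  "H k = (SOME z. 0 \<le> z \<and> \<Phi> z = (\<beta> * 2 ^ k) powr (1 / \<gamma>))"

lemma H: "0 \<le> H k" "\<Phi> (H k) = (\<beta> * 2 ^ k) powr (1 / \<gamma>)"
proof -
  have "\<exists>z. 0 \<le> z \<and> \<Phi> z = (\<beta> * 2 ^ k) powr (1 / \<gamma>)"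
    using Phi_surj[of "(\<beta> * 2 ^ k) powr (1 / \<gamma>)"] by auto
  from someI_ex[OF this] show "0 \<le> H k" "\<Phi> (H k) = (\<beta> * 2 ^ k) powr (1 / \<gamma>)" by (auto simp: H_def)
qed

lemma H_mono: "H k \<le> H (Suc k)"
  by (rule Phi_le_cancel) (use H beta gamma in \<open>auto intro!: powr_mono2\<close>)

text \<open>With D the gap of the two quantiles and q = |x - y| / D, the increment is at most min 1
  q, hence at most q powr \<alpha>. This turns the slope 1 / D into the Hoelder constant D powr (-
  \<alpha>).\<close>

lemma psi_holder: "\<bar>\<psi> k j l x - \<psi> k j l y\<bar> \<le> H k * \<bar>x - y\<bar> powr \<alpha>"
proof (cases "l \<le> 1 \<or> 2 ^ k \<le> l")
  case True
  then have "\<psi> k j l x = \<psi> k j l y" by (auto simp: \<psi>_def)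
  then show ?thesis using H by simp
next
  case False
  then have l: "1 < l" "l < 2 ^ k" by auto
  define b where "b = quant j (real l / 2 ^ k)"
  define a where "a = quant j ((real l - 1) / 2 ^ k)"
  have ab: "a < b" unfolding a_def b_def by (rule psi_quant(3)[OF l])
  define D where "D = b - a"
  have D: "0 < D" using ab by (simp add: D_def)
  have "1 / 2 ^ k = u j (ereal b) - u j (ereal a)"
    unfolding a_def b_def psi_quant[OF l] by (simp add: diff_divide_distrib)
  also have "\<dots> \<le> \<beta> * (\<Phi> (D powr (- \<alpha>))) powr (- \<gamma>)" unfolding D_def by (rule u_increment_Phi[OF ab])
  finally have i: "1 / 2 ^ k \<le> \<beta> * (\<Phi> (D powr (- \<alpha>))) powr (- \<gamma>)" .
  define v where "v = \<Phi> (D powr (- \<alpha>))"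
  have v: "0 \<le> v" unfolding v_def by (rule Phi_nonneg) simp
  have "v \<noteq> 0" using i unfolding v_def[symmetric] by (auto simp: divide_le_eq)
  then have v: "0 < v" using v by simp
  have "v powr \<gamma> \<le> \<beta> * 2 ^ k"
    using i v unfolding v_def[symmetric] powr_minus_divide[of v] by (simp add: field_simps)
  then have "(v powr \<gamma>) powr (1 / \<gamma>) \<le> (\<beta> * 2 ^ k) powr (1 / \<gamma>)"
    using gamma by (intro powr_mono2) auto
  then have "\<Phi> (D powr (- \<alpha>)) \<le> \<Phi> (H k)"
    unfolding H powr_powr v_def[symmetric] using gamma v by simp
  then have DH: "D powr (- \<alpha>) \<le> H k" by (rule Phi_le_cancel[rotated 2]) (use H in auto)
  have eq: "\<psi> k j l z = max 0 (min 1 ((b - z) / D))" for z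
    using l by (simp add: \<psi>_def a_def b_def D_def)
  define q where "q = \<bar>x - y\<bar> / D"
  have q0: "0 \<le> q" using D by (simp add: q_def)
  have "(b - x) / D - (b - y) / D = (y - x) / D" by (simp add: diff_divide_distrib[symmetric])
  then have q: "\<bar>(b - x) / D - (b - y) / D\<bar> = q" using D by (simp add: q_def abs_minus_commute)
  have "\<bar>\<psi> k j l x - \<psi> k j l y\<bar> \<le> \<bar>(b - x) / D - (b - y) / D\<bar>" unfolding eq by linarith
  then have 1: "\<bar>\<psi> k j l x - \<psi> k j l y\<bar> \<le> q" using q by simp
  have 2: "\<bar>\<psi> k j l x - \<psi> k j l y\<bar> \<le> 1" using psi_bounds[of k j l x] psi_bounds[of k j l y] by (simp add: abs_le_iff)
  have "\<bar>\<psi> k j l x - \<psi> k j l y\<bar> \<le> q powr \<alpha>"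
  proof (cases "q \<le> 1")
    case True
    have "q powr 1 \<le> q powr \<alpha>" using alpha q0 True by (intro powr_mono') auto
    then show ?thesis using 1 q0 by simp
  next
    case False
    then have "1 \<le> q powr \<alpha>" using alpha by (intro ge_one_powr_ge_zero) auto
    then show ?thesis using 2 by simp
  qed
  also have "q powr \<alpha> = D powr (- \<alpha>) * \<bar>x - y\<bar> powr \<alpha>"
    unfolding q_def using D by (subst powr_divide) (auto simp: powr_minus_divide)
  also have "\<dots> \<le> H k * \<bar>x - y\<bar> powr \<alpha>" using DH by (intro mult_right_mono) auto
  finally show ?thesis .
qed

section \<open>Smoothed indicators of orthants\<close>

definition bump :: "nat \<times> ('d \<Rightarrow> nat) \<Rightarrow> real^'d \<Rightarrow> real" where
  "bump s x = (\<Prod>j\<in>UNIV. \<psi> (fst s) j (snd s j) (x $ j))"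

lemma bump_bounds: "0 \<le> bump s x" "bump s x \<le> 1"
  unfolding bump_def using psi_bounds by (auto intro!: prod_nonneg prod_le_1)

lemma bump_holder: "\<bar>bump s x - bump s y\<bar> \<le> real CARD('d) * H (fst s) * norm (x - y) powr \<alpha>"
proof -
  have "\<bar>bump s x - bump s y\<bar> \<le> (\<Sum>j\<in>UNIV. \<bar>\<psi> (fst s) j (snd s j) (x $ j) - \<psi> (fst s) j (snd s j) (y $ j)\<bar>)"
    unfolding bump_def using psi_bounds by (intro abs_prod_diff_le) auto
  also have "\<dots> \<le> (\<Sum>j\<in>(UNIV::'d set). H (fst s) * norm (x - y) powr \<alpha>)"
  proof (rule sum_mono)
    fix j
    have "\<bar>x $ j - y $ j\<bar> powr \<alpha> \<le> norm (x - y) powr \<alpha>"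
      using component_le_norm_cart[of "x - y" j] alpha by (intro powr_mono2) auto
    then have "H (fst s) * \<bar>x $ j - y $ j\<bar> powr \<alpha> \<le> H (fst s) * norm (x - y) powr \<alpha>"
      using H by (intro mult_left_mono) auto
    then show "\<bar>\<psi> (fst s) j (snd s j) (x $ j) - \<psi> (fst s) j (snd s j) (y $ j)\<bar> \<le> H (fst s) * norm (x - y) powr \<alpha>"
      using psi_holder order_trans by blast
  qed
  finally show ?thesis by simp
qed

lemma bump_measurable [measurable]: "bump s \<in> borel_measurable borel"
proof -
  have "(\<lambda>x. \<psi> k j l x) \<in> borel_measurable borel" for k j l unfolding \<psi>_def by measurable
  then show ?thesis unfolding bump_def by measurable
qed

end

section \<open>Interpolation on dyadic grids\<close>

definition hat :: "real \<Rightarrow> real" where "hat x = max 0 (1 - \<bar>x\<bar>)"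

lemma hat_bounds: "0 \<le> hat x" "hat x \<le> 1"
  by (auto simp: hat_def)

text \<open>Only the floor of x and its successor lie within distance 1 of x. The upper limit N + 2
  is that of the grids.\<close>

lemma sum_hat:
  fixes x :: real
  assumes x: "0 \<le> x" "x \<le> real N"
  shows "(\<Sum>l\<le>N + 2. hat (x - real l)) = 1"
proof -
  define m where "m = nat \<lfloor>x\<rfloor>"
  have m: "real m \<le> x" "x < real m + 1" unfolding m_def using x by linarith+
  have mN: "m \<le> N" using m x by linarith
  have z: "hat (x - real l) = 0" if "l \<noteq> m" "l \<noteq> Suc m" for l
  proof -
    have "real l + 1 \<le> real m \<or> real m + 2 \<le> real l" using that by linarith
    then have "1 \<le> \<bar>x - real l\<bar>" using m by linarith
    then show ?thesis by (simp add: hat_def)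
  qed
  have "(\<Sum>l\<le>N + 2. hat (x - real l)) = (\<Sum>l\<in>{m, Suc m}. hat (x - real l))"
    by (rule sum.mono_neutral_right) (use mN z in auto)
  also have "\<dots> = hat (x - real m) + hat (x - real (Suc m))" by simp
  also have "hat (x - real m) = 1 - (x - real m)" using m by (simp add: hat_def)
  also have "hat (x - real (Suc m)) = x - real m" using m by (simp add: hat_def)
  finally show ?thesis by simp
qed

text \<open>Indices run past 2^k because the upper function in the sandwich at a point has index
  floor + 2.\<close>

definition grid :: "nat \<Rightarrow> ('d::finite \<Rightarrow> nat) set" where
  "grid k = PiE UNIV (\<lambda>_. {..2 ^ k + 2})"

lemma finite_grid: "finite (grid k :: ('d::finite \<Rightarrow> nat) set)"
  unfolding grid_def by (rule finite_PiE) auto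

lemma grid_iff: "l \<in> grid k \<longleftrightarrow> (\<forall>j. l j \<le> 2 ^ k + 2)"
  by (auto simp: grid_def PiE_def Pi_def)

lemma divide_abs_eq:
  fixes x a b :: real
  assumes "0 < a" shows "\<bar>x - b / a\<bar> = \<bar>a * x - b\<bar> / a"
proof -
  have "x - b / a = (a * x - b) / a" using assms by (simp add: field_simps)
  then show ?thesis using assms by simp
qed

lemma card_grid: "card (grid k :: ('d::finite \<Rightarrow> nat) set) = (2 ^ k + 3) ^ CARD('d)"
  unfolding grid_def by (subst card_PiE) (auto simp: numeral_eq_Suc)

text \<open>The tolerance 2 covers the grid points of nonzero interpolation weight, which lie within
  1, as well as the sandwich indices floor - 1 and floor + 2.\<close>

definition near :: "nat \<Rightarrow> ('d \<Rightarrow> real) \<Rightarrow> ('d \<Rightarrow> nat) \<Rightarrow> bool" where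
  "near k v l \<longleftrightarrow> (\<forall>j. \<bar>2 ^ k * v j - real (l j)\<bar> \<le> 2)"

text \<open>Multilinear interpolation weights: continuous in v and, on the unit cube, a partition of
  unity.\<close>

definition wt :: "nat \<Rightarrow> ('d::finite \<Rightarrow> nat) \<Rightarrow> ('d \<Rightarrow> real) \<Rightarrow> real" where
  "wt k l v = (\<Prod>j\<in>UNIV. hat (2 ^ k * v j - real (l j)))"

lemma wt_bounds: "0 \<le> wt k l v" "wt k l v \<le> 1"
  unfolding wt_def using hat_bounds by (auto intro!: prod_nonneg prod_le_1)

lemma sum_wt:
  fixes v :: "'d::finite \<Rightarrow> real"
  assumes v: "\<forall>j. 0 \<le> v j \<and> v j \<le> 1"
  shows "(\<Sum>l\<in>grid k. wt k l v) = 1"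
proof -
  have "(\<Sum>l\<in>grid k. wt k l v) = (\<Prod>j\<in>UNIV. \<Sum>i\<le>2 ^ k + 2. hat (2 ^ k * v j - real i))"
    unfolding grid_def wt_def by (rule prod_sum_PiE[symmetric]) auto
  also have "\<dots> = (\<Prod>j\<in>(UNIV::'d set). 1)"
    by (intro prod.cong refl sum_hat) (use v in auto)
  finally show ?thesis by simp
qed

lemma wt_near: "wt k l v \<noteq> 0 \<Longrightarrow> near k v l"
proof -
  assume "wt k l v \<noteq> 0"
  then have h: "hat (2 ^ k * v j - real (l j)) \<noteq> 0" for j by (auto simp: wt_def)
  have "\<bar>2 ^ k * v j - real (l j)\<bar> \<le> 2" for j
    using h[of j] unfolding hat_def by (auto simp: max_def split: if_splits)
  then show ?thesis by (simp add: near_def)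
qed

definition interp :: "nat \<Rightarrow> (nat \<times> ('d::finite \<Rightarrow> nat) \<Rightarrow> real) \<Rightarrow> ('d \<Rightarrow> real) \<Rightarrow> real" where
  "interp k z v = (\<Sum>l\<in>grid k. wt k l v * z (k, l))"

lemma interp_lipschitz:
  "\<bar>interp k z v - interp k z' v\<bar> \<le> (\<Sum>l\<in>grid k. \<bar>z (k, l) - z' (k, l)\<bar>)"
proof -
  have "interp k z v - interp k z' v = (\<Sum>l\<in>grid k. wt k l v * (z (k, l) - z' (k, l)))"
    by (simp add: interp_def sum_subtractf right_diff_distrib)
  also have "\<bar>\<dots>\<bar> \<le> (\<Sum>l\<in>grid k. \<bar>wt k l v * (z (k, l) - z' (k, l))\<bar>)" by (rule sum_abs)
  also have "\<dots> \<le> (\<Sum>l\<in>grid k. \<bar>z (k, l) - z' (k, l)\<bar>)"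
    using wt_bounds
    by (intro sum_mono) (auto simp: abs_mult abs_of_nonneg[OF wt_bounds(1)] intro!: mult_left_le_one_le)
  finally show ?thesis .
qed

text \<open>Interpolation is a convex combination of the values at near grid points.\<close>

lemma interp_approx:
  fixes v :: "'d::finite \<Rightarrow> real"
  assumes v: "\<forall>j. 0 \<le> v j \<and> v j \<le> 1"
    and D: "\<And>l. l \<in> grid k \<Longrightarrow> near k v l \<Longrightarrow> \<bar>z (k, l) - c\<bar> \<le> D"
  shows "\<bar>interp k z v - c\<bar> \<le> D"
proof -
  have "interp k z v - c = (\<Sum>l\<in>grid k. wt k l v * (z (k, l) - c))"
    using sum_wt[OF v, of k]
    by (simp add: interp_def sum_subtractf right_diff_distrib flip: sum_distrib_right)
  also have "\<bar>\<dots>\<bar> \<le> (\<Sum>l\<in>grid k. \<bar>wt k l v * (z (k, l) - c)\<bar>)" by (rule sum_abs)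
  also have "\<dots> \<le> (\<Sum>l\<in>grid k. wt k l v * D)"
  proof (rule sum_mono)
    fix l assume l: "l \<in> (grid k :: ('d \<Rightarrow> nat) set)"
    show "\<bar>wt k l v * (z (k, l) - c)\<bar> \<le> wt k l v * D"
    proof (cases "wt k l v = 0")
      case False
      then show ?thesis using D[OF l wt_near[OF False]] wt_bounds(1)[of k l v]
        by (simp add: abs_mult mult_left_mono)
    qed simp
  qed
  also have "\<dots> = D" using sum_wt[OF v, of k] by (simp flip: sum_distrib_right)
  finally show ?thesis .
qed

text \<open>The pairs whose increments have to be controlled: two points of level k, or one of level
  k and one of the next. The width 4 = 2 + 2 admits any two grid points near a common v.\<close>

definition links :: "nat \<Rightarrow> ((nat \<times> ('d::finite \<Rightarrow> nat)) \<times> (nat \<times> ('d \<Rightarrow> nat))) set" where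
  "links k = {(a, b). fst b = k \<and> (fst a = k \<or> fst a = Suc k) \<and> snd b \<in> grid k \<and> snd a \<in> grid (fst a) \<and>
     (\<forall>j. \<bar>real (snd a j) / 2 ^ fst a - real (snd b j) / 2 ^ k\<bar> \<le> 4 / 2 ^ k)}"

lemma linksI:
  assumes "near k' v l'" "near k v l" "l \<in> grid k" "l' \<in> grid k'" "k' = k \<or> k' = Suc k"
  shows "((k', l'), (k, l)) \<in> links k"
proof -
  have "\<bar>real (l' j) / 2 ^ k' - real (l j) / 2 ^ k\<bar> \<le> 4 / 2 ^ k" for j
  proof -
    have 1: "\<bar>v j - real (l j) / 2 ^ k\<bar> \<le> 2 / 2 ^ k"
    proof -
      have "\<bar>v j - real (l j) / 2 ^ k\<bar> = \<bar>2 ^ k * v j - real (l j)\<bar> / 2 ^ k"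
        by (simp add: divide_abs_eq diff_divide_distrib)
      then show ?thesis using assms(2) by (simp add: near_def divide_right_mono)
    qed
    have "\<bar>v j - real (l' j) / 2 ^ k'\<bar> = \<bar>2 ^ k' * v j - real (l' j)\<bar> / 2 ^ k'"
      by (simp add: divide_abs_eq diff_divide_distrib)
    also have "\<dots> \<le> 2 / 2 ^ k'" using assms(1) by (simp add: near_def divide_right_mono)
    also have "\<dots> \<le> 2 / 2 ^ k" using assms(5) by (auto simp: field_simps)
    finally show ?thesis using 1 by linarith
  qed
  then show ?thesis using assms(3-5) by (auto simp: links_def)
qed

text \<open>A fine index lies within 8 = 2 * 4 of twice the coarse one, an index of the same level
  within 4; the factor \<open>2 ^ (k' - k)\<close> treats both cases at once. Truncated subtraction
  is harmless at the lower end.\<close>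

lemma links_subset:
  "links k \<subseteq> (\<Union>k'\<in>{k, Suc k}. \<Union>l\<in>grid k. (\<lambda>l'. ((k', l'), (k, l))) `
      PiE UNIV (\<lambda>j. {2 ^ (k' - k) * l j - 8..2 ^ (k' - k) * l j + 8}))" (is "_ \<subseteq> ?R")
proof
  fix x assume x: "x \<in> (links k :: ((nat \<times> ('a \<Rightarrow> nat)) \<times> (nat \<times> ('a \<Rightarrow> nat))) set)"
  obtain k' l' kk l where xe: "x = ((k', l'), (kk, l))" by (metis surj_pair)
  with x have kk: "kk = k" and k': "k' = k \<or> k' = Suc k" and l: "l \<in> grid k"
    and d: "\<And>j. \<bar>real (l' j) / 2 ^ k' - real (l j) / 2 ^ k\<bar> \<le> 4 / 2 ^ k"
    by (auto simp: links_def)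
  have "l' j \<in> {2 ^ (k' - k) * l j - 8..2 ^ (k' - k) * l j + 8}" for j
  proof -
    from k' show ?thesis
    proof
      assume e: "k' = k"
      have "\<bar>real (l' j) - real (l j)\<bar> / 2 ^ k \<le> 4 / 2 ^ k"
        using d[of j] e by (simp add: diff_divide_distrib[symmetric])
      then have "\<bar>real (l' j) - real (l j)\<bar> \<le> 4" by (simp add: divide_le_cancel)
      then have "l' j \<le> l j + 4" "l j \<le> l' j + 4" by linarith+
      then show ?thesis using e by auto
    next
      assume e: "k' = Suc k"
      have "real (l' j) / 2 ^ k' - real (l j) / 2 ^ k = (real (l' j) - 2 * real (l j)) / (2 * 2 ^ k)"
        using e by (simp add: field_simps)
      then have "\<bar>real (l' j) - 2 * real (l j)\<bar> / (2 * 2 ^ k) \<le> 4 / 2 ^ k"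
        using d[of j] by simp
      then have "\<bar>real (l' j) - 2 * real (l j)\<bar> \<le> 8" by (simp add: field_simps)
      then have "l' j \<le> 2 * l j + 8" "2 * l j \<le> l' j + 8" by linarith+
      then show ?thesis using e by auto
    qed
  qed
  then have "l' \<in> PiE UNIV (\<lambda>j. {2 ^ (k' - k) * l j - 8..2 ^ (k' - k) * l j + 8})" by auto
  then show "x \<in> ?R" unfolding xe kk
    by (intro UN_I[of k'] UN_I[of l] imageI) (use l k' in auto)
qed

lemma finite_links: "finite (links k :: ((nat \<times> ('d::finite \<Rightarrow> nat)) \<times> (nat \<times> ('d \<Rightarrow> nat))) set)"
  by (rule finite_subset[OF links_subset], rule finite_UN_I, simp, rule finite_UN_I, rule finite_grid,
      rule finite_imageI, rule finite_PiE) auto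

text \<open>A coarse point has at most 17 = 2 * 8 + 1 partners per coordinate at each of the two
  levels, and there are at most (4 * 2^k)^d coarse points; 68 = 4 * 17.\<close>

lemma card_links:
  "real (card (links k :: ((nat \<times> ('d::finite \<Rightarrow> nat)) \<times> (nat \<times> ('d \<Rightarrow> nat))) set))
     \<le> 2 * 68 ^ CARD('d) * (2 ^ CARD('d)) ^ k"
proof -
  let ?S = "\<lambda>k' l. (\<lambda>l'. ((k', l'), (k, l))) `
      PiE UNIV (\<lambda>j. {2 ^ (k' - k) * l j - 8..2 ^ (k' - k) * l j + 8}) :: ((nat \<times> ('d \<Rightarrow> nat)) \<times> (nat \<times> ('d \<Rightarrow> nat))) set"
  have fin: "finite (?S k' l)" for k' l by (auto intro!: finite_imageI finite_PiE)
  have S: "card (?S k' l) \<le> 17 ^ CARD('d)" for k' and l :: "'d \<Rightarrow> nat"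
  proof -
    have "card (?S k' l) \<le> card (PiE (UNIV :: 'd set) (\<lambda>j. {2 ^ (k' - k) * l j - 8..2 ^ (k' - k) * l j + 8}))"
      by (intro card_image_le finite_PiE) auto
    also have "\<dots> = (\<Prod>j\<in>(UNIV :: 'd set). card {2 ^ (k' - k) * l j - 8..2 ^ (k' - k) * l j + 8})"
      by (rule card_PiE) auto
    also have "\<dots> \<le> (\<Prod>j\<in>(UNIV :: 'd set). 17)" by (intro prod_mono) auto
    finally show ?thesis by simp
  qed
  have "card (links k :: ((nat \<times> ('d \<Rightarrow> nat)) \<times> (nat \<times> ('d \<Rightarrow> nat))) set) \<le> card (\<Union>k'\<in>{k, Suc k}. \<Union>l\<in>grid k. ?S k' l)"
    by (rule card_mono[OF _ links_subset], rule finite_UN_I, simp, rule finite_UN_I, rule finite_grid, rule fin)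
  also have "\<dots> \<le> (\<Sum>k'\<in>{k, Suc k}. card (\<Union>l\<in>grid k. ?S k' l))" by (rule card_UN_le) simp
  also have "\<dots> \<le> (\<Sum>k'\<in>{k, Suc k}. \<Sum>l\<in>grid k. card (?S k' l))"
    by (intro sum_mono card_UN_le finite_grid)
  also have "\<dots> \<le> (\<Sum>k'\<in>{k, Suc k}. \<Sum>l\<in>(grid k :: ('d \<Rightarrow> nat) set). 17 ^ CARD('d))"
    by (intro sum_mono S)
  also have "\<dots> = 2 * ((2 ^ k + 3) ^ CARD('d) * 17 ^ CARD('d))" by (simp add: card_grid)
  also have "\<dots> \<le> 2 * ((4 * 2 ^ k) ^ CARD('d) * 17 ^ CARD('d))"
  proof -
    have "(2::nat) ^ k + 3 \<le> 4 * 2 ^ k" using one_le_power[of "2::nat" k] by simp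
    then show ?thesis by (intro mult_left_mono mult_right_mono power_mono) auto
  qed
  also have "\<dots> = 2 * 68 ^ CARD('d) * (2 ^ CARD('d)) ^ k"
  proof -
    have "(68::nat) ^ CARD('d) = 4 ^ CARD('d) * 17 ^ CARD('d)" by (simp flip: power_mult_distrib)
    then show ?thesis by (simp add: power_mult_distrib ac_simps flip: power_mult)
  qed
  finally have "card (links k :: ((nat \<times> ('d \<Rightarrow> nat)) \<times> (nat \<times> ('d \<Rightarrow> nat))) set) \<le> 2 * 68 ^ CARD('d) * (2 ^ CARD('d)) ^ k" .
  then have "real (card (links k :: ((nat \<times> ('d \<Rightarrow> nat)) \<times> (nat \<times> ('d \<Rightarrow> nat))) set)) \<le> real (2 * 68 ^ CARD('d) * (2 ^ CARD('d)) ^ k)"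
    by (rule of_nat_mono)
  then show ?thesis by simp
qed

text \<open>A smooth substitute for the maximum of the link increments: it dominates each of them,
  and its expectation is controlled by their moments of order 2p.\<close>
definition osc :: "real \<Rightarrow> nat \<Rightarrow> nat \<Rightarrow> (nat \<times> ('d::finite \<Rightarrow> nat) \<Rightarrow> real) \<Rightarrow> real" where
  "osc q p k z = q ^ k + (\<Sum>(a, b)\<in>links k. \<bar>z a - z b\<bar> ^ (2 * p)) / (q ^ k) ^ (2 * p - 1)"

text \<open>With Q = q^k, an increment y above Q satisfies y \<le> y^(2p) / Q^(2p-1), and one below
  Q is dominated by the first summand.\<close>

lemma osc_bound:
  assumes q: "0 < q" and p: "1 \<le> p" and ab: "(a, b) \<in> links k"
  shows "\<bar>z a - z b\<bar> \<le> osc q p k z"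
proof -
  define Q where "Q = q ^ k"
  define y where "y = \<bar>z a - z b\<bar>"
  have Q: "0 < Q" unfolding Q_def using q by simp
  have y: "0 \<le> y" by (simp add: y_def)
  have "y \<le> Q + y ^ (2 * p) / Q ^ (2 * p - 1)"
  proof (cases "y \<le> Q")
    case True then show ?thesis using Q y by (simp add: add_increasing2)
  next
    case False
    have "2 * p = Suc (2 * p - 1)" using p by simp
    then have e: "y ^ (2 * p) = y * y ^ (2 * p - 1)" by (metis power_Suc)
    have "Q ^ (2 * p - 1) \<le> y ^ (2 * p - 1)" using False Q by (intro power_mono) auto
    then have "y * Q ^ (2 * p - 1) \<le> y ^ (2 * p)" unfolding e using y by (rule mult_left_mono)
    then have "y \<le> y ^ (2 * p) / Q ^ (2 * p - 1)" using Q by (simp add: le_divide_eq)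
    then show ?thesis using Q by simp
  qed
  also have "y ^ (2 * p) \<le> (\<Sum>(a, b)\<in>links k. \<bar>z a - z b\<bar> ^ (2 * p))"
    unfolding y_def
    using member_le_sum[OF ab _ finite_links, of "\<lambda>(a, b). \<bar>z a - z b\<bar> ^ (2 * p)"] by auto
  finally show ?thesis unfolding y_def osc_def Q_def using Q q by (simp add: divide_right_mono)
qed

lemma osc_nonneg: "0 < q \<Longrightarrow> 0 \<le> osc q p k z"
  unfolding osc_def by (auto intro!: add_nonneg_nonneg divide_nonneg_nonneg sum_nonneg)

lemma interp_osc_same:
  fixes v :: "'d::finite \<Rightarrow> real"
  assumes v: "\<forall>j. 0 \<le> v j \<and> v j \<le> 1" and q: "0 < q" and p: "1 \<le> p"
    and l: "l \<in> grid k" "near k v l"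
  shows "\<bar>interp k z v - z (k, l)\<bar> \<le> osc q p k z"
  by (rule interp_approx[OF v]) (use l in \<open>auto intro!: osc_bound[OF q p] linksI[where v=v]\<close>)

text \<open>Two nested convex combinations, over the fine and over the coarse indices near v; every
  such pair is a link of level k.\<close>

lemma interp_osc_step:
  fixes v :: "'d::finite \<Rightarrow> real"
  assumes v: "\<forall>j. 0 \<le> v j \<and> v j \<le> 1" and q: "0 < q" and p: "1 \<le> p"
  shows "\<bar>interp (Suc k) z v - interp k z v\<bar> \<le> osc q p k z"
proof (rule interp_approx[OF v])
  fix l' assume l': "l' \<in> grid (Suc k)" "near (Suc k) v l'"
  have "\<bar>interp k z v - z (Suc k, l')\<bar> \<le> osc q p k z"
  proof (rule interp_approx[OF v])
    fix l assume l: "l \<in> grid k" "near k v l"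
    have "\<bar>z (Suc k, l') - z (k, l)\<bar> \<le> osc q p k z"
      by (rule osc_bound[OF q p linksI[OF l'(2) l(2,1) l'(1)]]) simp
    then show "\<bar>z (k, l) - z (Suc k, l')\<bar> \<le> osc q p k z" by (simp add: abs_minus_commute)
  qed
  then show "\<bar>z (Suc k, l') - interp k z v\<bar> \<le> osc q p k z" by (simp add: abs_minus_commute)
qed

lemma interp_osc_chain:
  fixes v :: "'d::finite \<Rightarrow> real"
  assumes v: "\<forall>j. 0 \<le> v j \<and> v j \<le> 1" and q: "0 < q" and p: "1 \<le> p"
  shows "\<bar>interp (m + i) z v - interp m z v\<bar> \<le> (\<Sum>k=m..<m + i. osc q p k z)"
proof (induction i)
  case (Suc i)
  then show ?case using interp_osc_step[OF v q p, of "m + i" z] by simp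
qed simp

section \<open>Moment bounds\<close>

context empirical_setup
begin

abbreviation mean :: "(real^'d \<Rightarrow> real) \<Rightarrow> real" where
  "mean f \<equiv> (\<integral>\<omega>. f (X 0 \<omega>) \<partial>M)"

definition G :: "nat \<Rightarrow> (real^'d \<Rightarrow> real) \<Rightarrow> 'a \<Rightarrow> real" where
  "G n f \<omega> = (\<Sum>i=1..n. f (X i \<omega>) - mean f) / sqrt (real n)"

definition Zn :: "nat \<Rightarrow> 'a \<Rightarrow> nat \<times> ('d \<Rightarrow> nat) \<Rightarrow> real" where
  "Zn n \<omega> s = G n (bump s) \<omega>"

lemma measurable_X: "f \<in> borel_measurable borel \<Longrightarrow> (\<lambda>\<omega>. f (X i \<omega>)) \<in> borel_measurable M"
  using meas[of i] by (rule measurable_compose)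

lemma integrable_bounded_X:
  fixes f :: "real^'d \<Rightarrow> real"
  assumes "f \<in> borel_measurable borel" "\<And>x. \<bar>f x\<bar> \<le> S"
  shows "integrable M (\<lambda>\<omega>. f (X i \<omega>))"
  by (rule integrable_const_bound[where B=S]) (use assms in \<open>auto intro: measurable_X\<close>)

lemma mean_abs_le:
  assumes "f \<in> borel_measurable borel" "\<And>x. \<bar>f x\<bar> \<le> S"
  shows "\<bar>mean f\<bar> \<le> S"
proof -
  have "\<bar>mean f\<bar> \<le> (\<integral>\<omega>. \<bar>f (X 0 \<omega>)\<bar> \<partial>M)" by (rule integral_abs_bound)
  also have "\<dots> \<le> (\<integral>\<omega>. S \<partial>M)"
    by (rule integral_mono) (use integrable_bounded_X[OF assms] assms in auto)
  finally show ?thesis by (simp add: prob_space)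
qed

lemma G_measurable: "f \<in> borel_measurable borel \<Longrightarrow> G n f \<in> borel_measurable M"
  unfolding G_def[abs_def]
  by (intro borel_measurable_divide borel_measurable_sum borel_measurable_diff borel_measurable_const measurable_X)

text \<open>Crude in n; its purpose is to make all moments exist at fixed n.\<close>

lemma G_bound:
  assumes "f \<in> borel_measurable borel" "\<And>x. \<bar>f x\<bar> \<le> S"
  shows "\<bar>G n f \<omega>\<bar> \<le> real n * (2 * S)"
proof (cases "n = 0")
  case False
  have "\<bar>G n f \<omega>\<bar> = \<bar>\<Sum>i=1..n. f (X i \<omega>) - mean f\<bar> / sqrt (real n)" by (simp add: G_def)
  also have "\<dots> \<le> \<bar>\<Sum>i=1..n. f (X i \<omega>) - mean f\<bar> / 1"
    using False by (intro divide_left_mono) auto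
  also have "\<dots> \<le> (\<Sum>i=1..n. \<bar>f (X i \<omega>) - mean f\<bar>)" by (simp add: sum_abs)
  also have "\<dots> \<le> (\<Sum>i=1..n. 2 * S)"
  proof (rule sum_mono)
    fix i show "\<bar>f (X i \<omega>) - mean f\<bar> \<le> 2 * S"
      using abs_triangle_ineq4[of "f (X i \<omega>)" "mean f"] assms(2)[of "X i \<omega>"] mean_abs_le[OF assms] by linarith
  qed
  finally show ?thesis by simp
qed (simp add: G_def)

lemma G_power_integrable:
  assumes f: "f \<in> borel_measurable borel" "\<And>x. \<bar>f x\<bar> \<le> S"
  shows "integrable M (\<lambda>\<omega>. \<bar>G n f \<omega>\<bar> ^ m)" "integrable M (\<lambda>\<omega>. G n f \<omega> ^ m)"
proof -
  note [measurable] = G_measurable[OF f(1)]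
  have b: "\<bar>G n f \<omega>\<bar> ^ m \<le> (real n * (2 * S)) ^ m" for \<omega>
    by (intro power_mono G_bound f) auto
  show "integrable M (\<lambda>\<omega>. \<bar>G n f \<omega>\<bar> ^ m)"
    by (rule integrable_const_bound[where B="(real n * (2 * S)) ^ m"]) (use b in auto)
  show "integrable M (\<lambda>\<omega>. G n f \<omega> ^ m)"
    by (rule integrable_const_bound[where B="(real n * (2 * S)) ^ m"]) (use b in \<open>auto simp: power_abs\<close>)
qed

lemma p_pos: "1 \<le> p"
proof -
  have "0 < r * real CARD('d)" using r by simp
  then have "0 < real p" using p by linarith
  then show ?thesis by simp
qed

lemma G_moment:
  assumes f: "f \<in> borel_measurable borel" "\<And>x. \<bar>f x\<bar> \<le> 1" "\<And>x y. \<bar>f x - f y\<bar> \<le> K * norm (x - y) powr \<alpha>"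
    and n: "1 \<le> n"
  shows "(\<integral>\<omega>. \<bar>G n f \<omega>\<bar> ^ (2 * p) \<partial>M)
     \<le> C * (\<Sum>i=1..p. real n ^ i * ((\<integral>\<omega>. \<bar>f (X 0 \<omega>) - mean f\<bar> powr r \<partial>M) powr (1 / r)) ^ i
                    * (\<Phi> (holder_norm \<alpha> (\<lambda>x. f x - mean f))) powr (\<kappa> i)) / real n ^ p"
proof -
  have h: "f \<in> holder_space \<alpha>" by (rule holder_spaceI[OF f(2,3)])
  have s: "sup_norm f \<le> 1" by (rule sup_norm_le[OF f(2)])
  have "sqrt (real n) ^ (2 * p) = real n ^ p" by (simp add: power_mult)
  then have "\<bar>G n f \<omega>\<bar> ^ (2 * p) = \<bar>\<Sum>i=1..n. f (X i \<omega>) - mean f\<bar> ^ (2 * p) / real n ^ p" for \<omega>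
    by (simp add: G_def power_divide)
  then have "(\<integral>\<omega>. \<bar>G n f \<omega>\<bar> ^ (2 * p) \<partial>M) = (\<integral>\<omega>. \<bar>\<Sum>i=1..n. f (X i \<omega>) - mean f\<bar> ^ (2 * p) \<partial>M) / real n ^ p"
    by simp
  also have "\<dots> \<le> C * (\<Sum>i=1..p. real n ^ i * ((\<integral>\<omega>. \<bar>f (X 0 \<omega>) - mean f\<bar> powr r \<partial>M) powr (1 / r)) ^ i
                    * (\<Phi> (holder_norm \<alpha> (\<lambda>x. f x - mean f))) powr (\<kappa> i)) / real n ^ p"
    by (intro divide_right_mono moment[OF h s n]) simp
  finally show ?thesis .
qed

text \<open>Rescaling f to sup norm at most 1 makes the moment hypothesis applicable, and n^i / n^p
  \<le> 1 then removes n.\<close>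

lemma G_moment_bounded:
  assumes f: "f \<in> borel_measurable borel" "\<And>x. \<bar>f x\<bar> \<le> S" "\<And>x y. \<bar>f x - f y\<bar> \<le> K * norm (x - y) powr \<alpha>"
  shows "\<exists>C'. \<forall>n\<ge>1. (\<integral>\<omega>. \<bar>G n f \<omega>\<bar> ^ (2 * p) \<partial>M) \<le> C'"
proof -
  define S' where "S' = max 1 S"
  define g where "g x = f x / S'" for x
  have S': "1 \<le> S'" "S \<le> S'" by (auto simp: S'_def)
  have g1: "g \<in> borel_measurable borel" using f(1) unfolding g_def by measurable
  have g2: "\<bar>g x\<bar> \<le> 1" for x
    using S' f(2)[of x] unfolding g_def by (simp add: divide_le_eq)
  have g3: "\<bar>g x - g y\<bar> \<le> (K / S') * norm (x - y) powr \<alpha>" for x y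
  proof -
    have "\<bar>g x - g y\<bar> = \<bar>f x - f y\<bar> / S'"
      using S' unfolding g_def by (simp add: diff_divide_distrib[symmetric])
    then show ?thesis using f(3)[of x y] S' by (simp add: divide_right_mono)
  qed
  have mg: "mean g = mean f / S'" unfolding g_def by simp
  have Gg: "G n f \<omega> = S' * G n g \<omega>" for n \<omega>
  proof -
    have "(\<Sum>i=1..n. f (X i \<omega>) - mean f) = S' * (\<Sum>i=1..n. g (X i \<omega>) - mean g)"
      unfolding sum_distrib_left mg using S' by (intro sum.cong refl) (simp add: g_def field_simps)
    then show ?thesis by (simp add: G_def)
  qed
  define a where "a i = ((\<integral>\<omega>. \<bar>g (X 0 \<omega>) - mean g\<bar> powr r \<partial>M) powr (1 / r)) ^ i
                    * (\<Phi> (holder_norm \<alpha> (\<lambda>x. g x - mean g))) powr (\<kappa> i)" for i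
  have a: "0 \<le> a i" for i unfolding a_def by simp
  have "(\<integral>\<omega>. \<bar>G n f \<omega>\<bar> ^ (2 * p) \<partial>M) \<le> S' ^ (2 * p) * (C * (\<Sum>i=1..p. a i))" if n: "1 \<le> n" for n
  proof -
    have "(\<integral>\<omega>. \<bar>G n g \<omega>\<bar> ^ (2 * p) \<partial>M) \<le> C * (\<Sum>i=1..p. real n ^ i * a i) / real n ^ p"
      using G_moment[OF g1 g2 g3 n] by (simp add: a_def mult.assoc)
    also have "\<dots> = C * (\<Sum>i=1..p. real n ^ i / real n ^ p * a i)"
      unfolding times_divide_eq_right[symmetric] sum_divide_distrib by simp
    also have "\<dots> \<le> C * (\<Sum>i=1..p. 1 * a i)"
    proof (intro mult_left_mono sum_mono mult_right_mono a)
      fix i assume "i \<in> {1..p}"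
      then have "real n ^ i \<le> real n ^ p" using n by (intro power_increasing) auto
      then show "real n ^ i / real n ^ p \<le> 1" using n by simp
    qed (use C in auto)
    finally have "(\<integral>\<omega>. \<bar>G n g \<omega>\<bar> ^ (2 * p) \<partial>M) \<le> C * (\<Sum>i=1..p. a i)" by simp
    moreover have "(\<integral>\<omega>. \<bar>G n f \<omega>\<bar> ^ (2 * p) \<partial>M) = S' ^ (2 * p) * (\<integral>\<omega>. \<bar>G n g \<omega>\<bar> ^ (2 * p) \<partial>M)"
      using S' by (simp add: Gg abs_mult power_mult_distrib)
    ultimately show ?thesis using S' by (simp add: mult_left_mono)
  qed
  then show ?thesis by blast
qed

text \<open>Two linked bumps differ only where some coordinate of the marginal distribution
  function lies in an interval of length 9/2^k.\<close>
lemma bump_link_L1: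
  assumes ab: "(a, b) \<in> links k"
  shows "(\<integral>\<omega>. \<bar>bump a (X 0 \<omega>) - bump b (X 0 \<omega>)\<bar> \<partial>M) \<le> 9 * real CARD('d) / 2 ^ k"
proof -
  obtain k' l' l where e: "a = (k', l')" "b = (k, l)" and k': "k' = k \<or> k' = Suc k"
    and d: "\<And>j. \<bar>real (l' j) / 2 ^ k' - real (l j) / 2 ^ k\<bar> \<le> 4 / 2 ^ k"
    using ab by (cases a; cases b) (auto simp: links_def)
  \<comment> \<open>Left of \<open>lo\<close> both cut-offs are 1, right of \<open>hi\<close> both
    are 0. To the left, 4 is due to the link and 1 to the width of the descent; to the right only 4
    is needed, so the interval has length 9 / 2^k.\<close>
  define lo hi where "lo j = (real (l j) - 5) / 2 ^ k" and "hi j = (real (l j) + 4) / 2 ^ k" for j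
  define B where "B j = {\<omega> \<in> space M. lo j \<le> u j (ereal (X 0 \<omega> $ j)) \<and> u j (ereal (X 0 \<omega> $ j)) \<le> hi j}" for j
  have Bm [measurable]: "B j \<in> sets M" for j unfolding B_def by measurable
  have pB: "prob (B j) \<le> 9 / 2 ^ k" for j
  proof -
    have "lo j \<le> hi j" unfolding lo_def hi_def by (intro divide_right_mono) auto
    from prob_u_between[OF this, of j] have "prob (B j) \<le> hi j - lo j" by (simp add: B_def)
    also have "hi j - lo j = 9 / 2 ^ k" unfolding lo_def hi_def by (simp add: diff_divide_distrib[symmetric])
    finally show ?thesis .
  qed
  have k2: "(1::real) / 2 ^ k' \<le> 1 / 2 ^ k" using k' by (auto simp: field_simps)
  have pt: "\<bar>\<psi> k' j (l' j) (X 0 \<omega> $ j) - \<psi> k j (l j) (X 0 \<omega> $ j)\<bar> \<le> indicator (B j) \<omega>" if w: "\<omega> \<in> space M" for \<omega> j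
  proof -
    let ?x = "X 0 \<omega> $ j"
    let ?u = "u j (ereal ?x)"
    have l': "real (l j) / 2 ^ k - 4 / 2 ^ k \<le> real (l' j) / 2 ^ k'" "real (l' j) / 2 ^ k' \<le> real (l j) / 2 ^ k + 4 / 2 ^ k"
      using d[of j] unfolding abs_le_iff by linarith+
    consider "?u < lo j" | "hi j < ?u" | "\<omega> \<in> B j" using w by (force simp: B_def)
    then show ?thesis
    proof cases
      case 1
      then have c: "?u < real (l j) / 2 ^ k - 5 / 2 ^ k" by (simp add: lo_def diff_divide_distrib)
      then have "?u < real (l j) / 2 ^ k - 1 / 2 ^ k"
        by (rule less_le_trans) (simp add: divide_right_mono)
      then have "2 ^ k * ?u < real (l j) - 1" by (simp add: field_simps)
      then have 2: "\<psi> k j (l j) ?x = 1" by (rule psi_eq_1)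
      have "real (l j) / 2 ^ k - 5 / 2 ^ k = (real (l j) / 2 ^ k - 4 / 2 ^ k) - 1 / 2 ^ k"
        by (simp add: diff_divide_distrib[symmetric])
      with c l'(1) k2 have "?u < real (l' j) / 2 ^ k' - 1 / 2 ^ k'" by linarith
      then have "2 ^ k' * ?u < real (l' j) - 1" by (simp add: field_simps)
      then have "\<psi> k' j (l' j) ?x = 1" by (rule psi_eq_1)
      then show ?thesis using 2 by simp
    next
      case 2
      then have c: "real (l j) / 2 ^ k + 4 / 2 ^ k < ?u" by (simp add: hi_def add_divide_distrib)
      moreover have "0 \<le> (4::real) / 2 ^ k" by simp
      ultimately have "real (l j) / 2 ^ k < ?u" by linarith
      then have "real (l j) < 2 ^ k * ?u" by (simp add: field_simps)
      then have 3: "\<psi> k j (l j) ?x = 0" by (rule psi_eq_0)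
      have "real (l' j) / 2 ^ k' < ?u" using c l'(2) by linarith
      then have "real (l' j) < 2 ^ k' * ?u" by (simp add: field_simps)
      then have "\<psi> k' j (l' j) ?x = 0" by (rule psi_eq_0)
      then show ?thesis using 3 by simp
    next
      case 3
      then show ?thesis
        using psi_bounds[of k' j "l' j" ?x] psi_bounds[of k j "l j" ?x] by (simp add: abs_le_iff)
    qed
  qed
  have "(\<integral>\<omega>. \<bar>bump a (X 0 \<omega>) - bump b (X 0 \<omega>)\<bar> \<partial>M) \<le> (\<integral>\<omega>. (\<Sum>j\<in>UNIV. indicator (B j) \<omega>) \<partial>M)"
  proof (rule integral_mono)
    show "integrable M (\<lambda>\<omega>. \<bar>bump a (X 0 \<omega>) - bump b (X 0 \<omega>)\<bar>)"
      using bump_bounds by (intro integrable_abs Bochner_Integration.integrable_diff integrable_bounded_X[where S=1]) auto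
    show "integrable M (\<lambda>\<omega>. \<Sum>j\<in>UNIV. indicator (B j) \<omega> :: real)"
      by (intro Bochner_Integration.integrable_sum integrable_real_indicator) (auto simp: emeasure_finite less_top[symmetric])
    fix \<omega> assume w: "\<omega> \<in> space M"
    have "\<bar>bump a (X 0 \<omega>) - bump b (X 0 \<omega>)\<bar> \<le> (\<Sum>j\<in>UNIV. \<bar>\<psi> k' j (l' j) (X 0 \<omega> $ j) - \<psi> k j (l j) (X 0 \<omega> $ j)\<bar>)"
      unfolding bump_def e fst_conv snd_conv using psi_bounds by (intro abs_prod_diff_le) auto
    also have "\<dots> \<le> (\<Sum>j\<in>UNIV. indicator (B j) \<omega>)" by (intro sum_mono pt w)
    finally show "\<bar>bump a (X 0 \<omega>) - bump b (X 0 \<omega>)\<bar> \<le> (\<Sum>j\<in>UNIV. indicator (B j) \<omega>)" .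
  qed
  also have "\<dots> = (\<Sum>j\<in>UNIV. prob (B j))"
    by (subst Bochner_Integration.integral_sum) (auto simp: emeasure_finite less_top[symmetric])
  also have "\<dots> \<le> (\<Sum>j\<in>(UNIV::'d set). 9 / 2 ^ k)" by (intro sum_mono pB)
  finally show ?thesis by (simp add: mult.commute)
qed

section \<open>Growth of \<open>\<Phi>\<close> along the levels and moments of link
  increments\<close>

lemma Phi_doubling_iter: "z0 \<le> z \<Longrightarrow> \<Phi> (2 ^ J * z) \<le> lam ^ J * \<Phi> z"
proof (induction J)
  case (Suc J)
  have "z \<le> 2 ^ J * z" using Suc.prems z0 by (simp add: mult_le_cancel_right1)
  then have "\<Phi> (2 * (2 ^ J * z)) \<le> lam * \<Phi> (2 ^ J * z)" using Suc.prems by (intro doubling) simp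
  also have "\<dots> \<le> lam * (lam ^ J * \<Phi> z)" using Suc lam by (intro mult_left_mono) auto
  finally show ?case by (simp add: mult.assoc)
qed simp

text \<open>The argument will bound the Hoelder norm of a centred difference of linked bumps: 2 for
  the sup norm, the rest for two bumps of level at most k + 1. It is at most 2^J times the larger of
  \<open>H (Suc k)\<close> and a constant; J doublings cost a constant factor, and at
  \<open>H (Suc k)\<close> itself \<open>\<Phi>\<close> is explicit.\<close>

lemma Phi_H_bound:
  "\<exists>c\<ge>1. \<forall>k. \<Phi> (2 + 2 * real CARD('d) * H (Suc k)) \<le> c * 2 powr (real k / \<gamma>)"
proof -
  obtain J :: nat where J: "2 + 2 * real CARD('d) < 2 ^ J" using real_arch_pow[of 2] by auto
  \<comment> \<open>At least \<open>z0\<close> so that doubling applies, at least 1 so that the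
    summand 2 is absorbed.\<close>
  define z1 where "z1 = max 1 z0"
  have z1: "1 \<le> z1" "z0 \<le> z1" "0 \<le> z1" by (auto simp: z1_def)
  define b where "b = (2 * \<beta>) powr (1 / \<gamma>)"
  define c where "c = max 1 (lam ^ J * (\<Phi> z1 + b))"
  have b: "0 \<le> b" by (simp add: b_def)
  have "\<Phi> (2 + 2 * real CARD('d) * H (Suc k)) \<le> c * 2 powr (real k / \<gamma>)" for k
  proof -
    define z where "z = max z1 (H (Suc k))"
    have z: "z1 \<le> z" "H (Suc k) \<le> z" by (auto simp: z_def)
    have g: "1 \<le> (2::real) powr (real k / \<gamma>)" using gamma by (intro ge_one_powr_ge_zero) auto
    have "2 + 2 * real CARD('d) * H (Suc k) \<le> 2 * z + 2 * real CARD('d) * z"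
      using z z1 by (intro add_mono mult_left_mono) auto
    also have "\<dots> = (2 + 2 * real CARD('d)) * z" by (simp add: algebra_simps)
    also have "\<dots> \<le> 2 ^ J * z" using J z z1 by (intro mult_right_mono) auto
    finally have "\<Phi> (2 + 2 * real CARD('d) * H (Suc k)) \<le> \<Phi> (2 ^ J * z)"
      using H(1)[of "Suc k"] by (intro Phi_le) auto
    also have "\<dots> \<le> lam ^ J * \<Phi> z" using z z1 by (intro Phi_doubling_iter) simp
    also have "\<Phi> z \<le> \<Phi> z1 + \<Phi> (H (Suc k))"
      using Phi_nonneg[of z1] Phi_nonneg[OF H(1)[of "Suc k"]] z1 unfolding z_def max_def by auto
    also have "\<Phi> (H (Suc k)) = b * 2 powr (real k / \<gamma>)"
    proof -
      have "\<beta> * 2 ^ Suc k = (2 * \<beta>) * 2 powr real k" by (simp add: powr_realpow)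
      then show ?thesis unfolding H b_def using beta by (simp add: powr_mult powr_powr)
    qed
    also have "\<Phi> z1 + b * 2 powr (real k / \<gamma>) \<le> (\<Phi> z1 + b) * 2 powr (real k / \<gamma>)"
      using g Phi_nonneg[of z1] z1 by (simp add: distrib_right mult_le_cancel_left1)
    finally have "\<Phi> (2 + 2 * real CARD('d) * H (Suc k)) \<le> lam ^ J * ((\<Phi> z1 + b) * 2 powr (real k / \<gamma>))"
      using lam by (simp add: mult_left_mono)
    also have "\<dots> = (lam ^ J * (\<Phi> z1 + b)) * 2 powr (real k / \<gamma>)" by simp
    also have "\<dots> \<le> c * 2 powr (real k / \<gamma>)" by (intro mult_right_mono) (auto simp: c_def)
    finally show ?thesis .
  qed
  then show ?thesis by (intro exI[of _ c]) (auto simp: c_def)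
qed

lemma bump_link_holder:
  assumes ab: "(a, b) \<in> links k"
  shows "\<bar>(bump a x - bump b x) - (bump a y - bump b y)\<bar> \<le> (2 * real CARD('d) * H (Suc k)) * norm (x - y) powr \<alpha>"
proof -
  have lev: "fst b = k" "fst a = k \<or> fst a = Suc k" using ab by (auto simp: links_def)
  then have "H (fst a) \<le> H (Suc k)" "H (fst b) \<le> H (Suc k)" using H_mono by auto
  then have h: "real CARD('d) * H (fst s) * norm (x - y) powr \<alpha> \<le> real CARD('d) * H (Suc k) * norm (x - y) powr \<alpha>"
    if "s = a \<or> s = b" for s
    using that by (intro mult_right_mono mult_left_mono) auto
  have "(bump a x - bump b x) - (bump a y - bump b y) = (bump a x - bump a y) - (bump b x - bump b y)" by simp
  also have "\<bar>\<dots>\<bar> \<le> \<bar>bump a x - bump a y\<bar> + \<bar>bump b x - bump b y\<bar>" by (rule abs_triangle_ineq4)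
  also have "\<dots> \<le> real CARD('d) * H (Suc k) * norm (x - y) powr \<alpha> + real CARD('d) * H (Suc k) * norm (x - y) powr \<alpha>"
    by (intro add_mono order_trans[OF bump_holder h]) auto
  finally show ?thesis by simp
qed

text \<open>The smallest slack in the conditions on \<open>\<kappa>\<close> after division by
  \<open>\<gamma>\<close>: the exponent by which the moments of increments beat the number of
  links.\<close>

definition \<eta> :: real where
  "\<eta> = Min ((\<lambda>i. real i / r + 2 * (real p - real i) - real CARD('d) - \<kappa> i / \<gamma>) ` {1..p})"

lemma eta_pos: "0 < \<eta>"
  unfolding \<eta>_def
proof (subst Min_gr_iff)
  show "\<forall>a\<in>(\<lambda>i. real i / r + 2 * (real p - real i) - real CARD('d) - \<kappa> i / \<gamma>) ` {1..p}. 0 < a"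
    using kappa gamma by (auto simp: divide_less_eq mult.commute)
qed (use p_pos in auto)

lemma kappa_le_eta:
  assumes "i \<in> {1..p}"
  shows "\<kappa> i / \<gamma> - real i / r \<le> 2 * (real p - real i) - (real CARD('d) + \<eta>)"
proof -
  have "\<eta> \<le> real i / r + 2 * (real p - real i) - real CARD('d) - \<kappa> i / \<gamma>"
    unfolding \<eta>_def using assms by (intro Min_le) auto
  then show ?thesis by simp
qed

lemma integrable_bump: "integrable M (\<lambda>\<omega>. bump s (X i \<omega>))"
  by (rule integrable_bounded_X[where S=1]) (use bump_bounds in auto)

lemma Zn_diff: "Zn n \<omega> a - Zn n \<omega> b = G n (\<lambda>x. bump a x - bump b x) \<omega>"
proof -
  have m: "mean (\<lambda>x. bump a x - bump b x) = mean (bump a) - mean (bump b)"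
    using integrable_bump by simp
  show ?thesis
    unfolding Zn_def G_def m diff_divide_distrib[symmetric] sum_subtractf[symmetric]
    by (intro arg_cong2[where f="(/)"] sum.cong refl) simp
qed

lemma powr_times_nat: "(x powr a) ^ n = (x::real) powr (a * real n)" if "0 < x"
  using that by (simp add: powr_power mult.commute)

text \<open>For a link, the L^r norm is of order 2^(-k/r) and the argument of the power \<kappa>_i
  is of order 2^(k/\<gamma>). In the i-th term they combine to at most a constant times 4^(k(p-i))
  2^(-k(d+\<eta>)). The restriction 4^k \<le> D n bounds the first factor by D^p n^(p-i), which
  cancels against n^i / n^p.\<close>

lemma bump_link_moment:
  "\<exists>K\<ge>0. \<forall>k n a b D. (a, b) \<in> links k \<longrightarrow> 1 \<le> n \<longrightarrow> 1 \<le> D \<longrightarrow> 4 ^ k \<le> D * real n \<longrightarrow>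
     (\<integral>\<omega>. \<bar>Zn n \<omega> a - Zn n \<omega> b\<bar> ^ (2 * p) \<partial>M) \<le> K * D ^ p * 2 powr (- (real k * (real CARD('d) + \<eta>)))"
proof -
  obtain c where c: "1 \<le> c" "\<And>k. \<Phi> (2 + 2 * real CARD('d) * H (Suc k)) \<le> c * 2 powr (real k / \<gamma>)"
    using Phi_H_bound by blast
  define d where "d = real CARD('d)"
  have d1: "1 \<le> d" unfolding d_def by (simp add: Suc_leI)
  define K where "K = C * (\<Sum>i=1..p. (18 * d) ^ i * c powr \<kappa> i)"
  have K: "0 \<le> K" unfolding K_def using C d1 by (auto intro!: mult_nonneg_nonneg sum_nonneg)
  have "(\<integral>\<omega>. \<bar>Zn n \<omega> a - Zn n \<omega> b\<bar> ^ (2 * p) \<partial>M) \<le> K * D ^ p * 2 powr (- (real k * (d + \<eta>)))"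
    if ab: "(a, b) \<in> links k" and n: "1 \<le> n" and D: "1 \<le> D" and kn: "4 ^ k \<le> D * real n" for k n a b D
  proof -
    define f where "f x = bump a x - bump b x" for x
    have fm: "f \<in> borel_measurable borel" unfolding f_def by measurable
    have f1: "\<bar>f x\<bar> \<le> 1" for x
      unfolding f_def using bump_bounds[of a x] bump_bounds[of b x] by (simp add: abs_le_iff)
    have fh: "\<bar>f x - f y\<bar> \<le> (2 * d * H (Suc k)) * norm (x - y) powr \<alpha>" for x y
      unfolding f_def d_def by (rule bump_link_holder[OF ab])
    have ZG: "Zn n \<omega> a - Zn n \<omega> b = G n f \<omega>" for \<omega>
      unfolding f_def by (rule Zn_diff)
    define A where "A = (\<integral>\<omega>. \<bar>f (X 0 \<omega>) - mean f\<bar> powr r \<partial>M) powr (1 / r)"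
    define P where "P = \<Phi> (holder_norm \<alpha> (\<lambda>x. f x - mean f))"
    have mf1: "\<bar>mean f\<bar> \<le> 1" by (rule mean_abs_le[OF fm f1])
    have fm2: "\<bar>f x - mean f\<bar> \<le> 2" for x
      using abs_triangle_ineq4[of "f x" "mean f"] f1[of x] mf1 by linarith
    have L1: "(\<integral>\<omega>. \<bar>f (X 0 \<omega>)\<bar> \<partial>M) \<le> 9 * d / 2 ^ k"
      unfolding f_def d_def by (rule bump_link_L1[OF ab])
    have fi: "integrable M (\<lambda>\<omega>. f (X 0 \<omega>))" by (rule integrable_bounded_X[OF fm f1])
    have A: "A \<le> 18 * d * 2 powr (- (real k / r))"
    proof -
      \<comment> \<open>Half the deviation is at most 1, so its r-th power is at most itself; this
        reduces the L^r norm to the L1 bound.\<close>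
      have pw: "\<bar>f x - mean f\<bar> powr r \<le> 2 powr r / 2 * (\<bar>f x\<bar> + \<bar>mean f\<bar>)" for x
      proof -
        have "(\<bar>f x - mean f\<bar> / 2) powr r \<le> (\<bar>f x - mean f\<bar> / 2) powr 1"
          using fm2[of x] r by (intro powr_mono') auto
        then have "\<bar>f x - mean f\<bar> powr r \<le> 2 powr r / 2 * \<bar>f x - mean f\<bar>"
          by (simp add: powr_divide field_simps)
        also have "\<dots> \<le> 2 powr r / 2 * (\<bar>f x\<bar> + \<bar>mean f\<bar>)" by (intro mult_left_mono abs_triangle_ineq4) simp
        finally show ?thesis .
      qed
      have "(\<integral>\<omega>. \<bar>f (X 0 \<omega>) - mean f\<bar> powr r \<partial>M) \<le> (\<integral>\<omega>. 2 powr r / 2 * (\<bar>f (X 0 \<omega>)\<bar> + \<bar>mean f\<bar>) \<partial>M)"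
      proof (rule integral_mono)
        show "integrable M (\<lambda>\<omega>. \<bar>f (X 0 \<omega>) - mean f\<bar> powr r)"
        proof (rule integrable_bounded_X[where f="\<lambda>x. \<bar>f x - mean f\<bar> powr r" and S="2 powr r"])
          show "(\<lambda>x. \<bar>f x - mean f\<bar> powr r) \<in> borel_measurable borel" using fm by measurable
          show "\<bar>\<bar>f x - mean f\<bar> powr r\<bar> \<le> 2 powr r" for x using fm2[of x] r by (simp add: powr_mono2)
        qed
        show "integrable M (\<lambda>\<omega>. 2 powr r / 2 * (\<bar>f (X 0 \<omega>)\<bar> + \<bar>mean f\<bar>))"
          using fi by simp
      qed (rule pw)
      also have "\<dots> = 2 powr r / 2 * ((\<integral>\<omega>. \<bar>f (X 0 \<omega>)\<bar> \<partial>M) + \<bar>mean f\<bar>)"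
        using fi by (simp add: prob_space)
      also have "\<dots> \<le> 2 powr r / 2 * (9 * d / 2 ^ k + 9 * d / 2 ^ k)"
        using L1 order_trans[OF integral_abs_bound L1] by (intro mult_left_mono add_mono) auto
      also have "\<dots> = 2 powr r * ((9 * d) * (1 / 2 ^ k))" by simp
      also have "1 / 2 ^ k = (2::real) powr (- real k)" by (simp add: powr_minus_divide powr_realpow)
      finally have I: "(\<integral>\<omega>. \<bar>f (X 0 \<omega>) - mean f\<bar> powr r \<partial>M) \<le> 2 powr r * ((9 * d) * 2 powr (- real k))" .
      have "A \<le> (2 powr r * ((9 * d) * 2 powr (- real k))) powr (1 / r)"
        unfolding A_def by (rule powr_mono2[OF _ _ I]) (use r in simp_all)
      also have "\<dots> = 2 * ((9 * d) powr (1 / r) * 2 powr (- (real k / r)))"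
        using r d1 by (simp add: powr_mult powr_powr)
      also have "\<dots> \<le> 2 * ((9 * d) * 2 powr (- (real k / r)))"
      proof -
        have "(9 * d) powr (1 / r) \<le> (9 * d) powr 1" using d1 r by (intro powr_mono) auto
        then show ?thesis using d1 by (intro mult_left_mono mult_right_mono) auto
      qed
      finally show ?thesis by simp
    qed
    have P: "P \<le> c * 2 powr (real k / \<gamma>)"
    proof -
      have h: "\<bar>(f x - mean f) - (f y - mean f)\<bar> \<le> (2 * d * H (Suc k)) * norm (x - y) powr \<alpha>" for x y
        using fh[of x y] by simp
      have "P \<le> \<Phi> (2 + 2 * d * H (Suc k))"
        unfolding P_def using holder_norm_bounds[of "\<lambda>x. f x - mean f", OF fm2 h] by (intro Phi_le)
      then show ?thesis using c(2)[of k] unfolding d_def by simp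
    qed
    have A0: "0 \<le> A" unfolding A_def by simp
    have P0: "0 \<le> P" unfolding P_def
      by (rule Phi_nonneg) (rule holder_norm_bounds(2)[where S=2 and K="2 * d * H (Suc k)"], use fm2 fh in auto)
    define E where "E = 2 powr (- (real k * (d + \<eta>)))"
    have summand: "real n ^ i * A ^ i * P powr \<kappa> i / real n ^ p \<le> (18 * d) ^ i * c powr \<kappa> i * (D ^ p * E)"
      if i: "i \<in> {1..p}" for i
    proof -
      have ip: "i \<le> p" using i by simp
      have k0: "0 \<le> \<kappa> i" using kappa[OF i] by simp
      have "A ^ i * P powr \<kappa> i \<le> (18 * d * 2 powr (- (real k / r))) ^ i * (c * 2 powr (real k / \<gamma>)) powr \<kappa> i"
        using A P A0 P0 k0 by (intro mult_mono power_mono powr_mono2) auto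
      also have "\<dots> = (18 * d) ^ i * c powr \<kappa> i * (2 powr (- (real k / r) * real i) * 2 powr (real k / \<gamma> * \<kappa> i))"
        using c(1) by (simp add: power_mult_distrib powr_mult powr_powr powr_times_nat)
      also have "2 powr (- (real k / r) * real i) * 2 powr (real k / \<gamma> * \<kappa> i) = 2 powr (real k * (\<kappa> i / \<gamma> - real i / r))"
        by (simp add: powr_add[symmetric] algebra_simps)
      also have "\<dots> \<le> 2 powr (real k * (2 * (real p - real i) - (d + \<eta>)))"
        using kappa_le_eta[OF i] unfolding d_def by (intro powr_mono mult_left_mono) auto
      also have "\<dots> = 2 powr (2 * real k * real (p - i)) * E"
        unfolding E_def powr_add[symmetric] using ip by (simp add: of_nat_diff algebra_simps)
      also have "2 powr (2 * real k * real (p - i)) = (4 ^ k) ^ (p - i)"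
      proof -
        have "2 powr (2 * real k) = (2 powr 2 :: real) ^ k" by (rule powr_times_nat[symmetric]) simp
        then have "2 powr (2 * real k) = (4::real) ^ k" by simp
        moreover have "2 powr (2 * real k * real (p - i)) = (2 powr (2 * real k) :: real) ^ (p - i)"
          by (rule powr_times_nat[symmetric]) simp
        ultimately show ?thesis by simp
      qed
      also have "(4 ^ k) ^ (p - i) \<le> D ^ p * real n ^ (p - i)"
      proof -
        have "((4::real) ^ k) ^ (p - i) \<le> (D * real n) ^ (p - i)" using kn by (intro power_mono) auto
        also have "\<dots> = D ^ (p - i) * real n ^ (p - i)" by (rule power_mult_distrib)
        also have "\<dots> \<le> D ^ p * real n ^ (p - i)" using D by (intro mult_right_mono power_increasing) auto
        finally show ?thesis .
      qed
      finally have "A ^ i * P powr \<kappa> i \<le> (18 * d) ^ i * c powr \<kappa> i * (D ^ p * real n ^ (p - i) * E)"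
        using d1 by (simp add: mult_left_mono mult_right_mono E_def)
      then have "real n ^ i * (A ^ i * P powr \<kappa> i) / real n ^ p
          \<le> real n ^ i * ((18 * d) ^ i * c powr \<kappa> i * (D ^ p * real n ^ (p - i) * E)) / real n ^ p"
        by (intro divide_right_mono mult_left_mono) auto
      also have "\<dots> = (18 * d) ^ i * c powr \<kappa> i * (D ^ p * E) * ((real n ^ i * real n ^ (p - i)) / real n ^ p)"
        by simp
      also have "real n ^ i * real n ^ (p - i) = real n ^ p" using ip by (simp flip: power_add)
      finally show ?thesis using n by (simp add: mult.assoc)
    qed
    have "(\<integral>\<omega>. \<bar>Zn n \<omega> a - Zn n \<omega> b\<bar> ^ (2 * p) \<partial>M) = (\<integral>\<omega>. \<bar>G n f \<omega>\<bar> ^ (2 * p) \<partial>M)" by (simp add: ZG)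
    also have "\<dots> \<le> C * (\<Sum>i=1..p. real n ^ i * A ^ i * P powr \<kappa> i) / real n ^ p"
      using G_moment[OF fm f1 fh n] by (simp add: A_def P_def)
    also have "\<dots> = C * (\<Sum>i=1..p. real n ^ i * A ^ i * P powr \<kappa> i / real n ^ p)"
      unfolding times_divide_eq_right[symmetric] sum_divide_distrib by simp
    also have "\<dots> \<le> C * (\<Sum>i=1..p. (18 * d) ^ i * c powr \<kappa> i * (D ^ p * E))"
      using C by (intro mult_left_mono sum_mono summand) auto
    also have "\<dots> = K * D ^ p * E" by (simp add: K_def sum_distrib_right mult.assoc)
    finally show ?thesis unfolding E_def .
  qed
  then show ?thesis using K unfolding d_def by blast
qed

end

section \<open>The sandwich for the empirical process\<close>

context empirical_setup
begin

text \<open>The 2p-th root of 2^(-\<eta>): the base for which both summands of \<open>osc\<close>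
  have means of the same order.\<close>

definition \<rho> :: real where "\<rho> = 2 powr (- \<eta> / (2 * real p))"

lemma rho: "0 < \<rho>" "\<rho> < 1"
proof -
  show "0 < \<rho>" by (simp add: \<rho>_def)
  have "- \<eta> / (2 * real p) < 0" using eta_pos p_pos by (simp add: divide_less_0_iff)
  then have "2 powr (- \<eta> / (2 * real p)) < (2::real) powr 0" by (intro powr_less_mono) auto
  then show "\<rho> < 1" by (simp add: \<rho>_def)
qed

lemma rho_power: "(\<rho> ^ k) ^ (2 * p) = 2 powr (- (real k * \<eta>))"
proof -
  have "(\<rho> ^ k) ^ (2 * p) = 2 powr (- \<eta> / (2 * real p) * real k * real (2 * p))"
    unfolding \<rho>_def by (simp only: powr_times_nat)
  also have "- \<eta> / (2 * real p) * real k * real (2 * p) = - (real k * \<eta>)"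
    using p_pos by simp
  finally show ?thesis .
qed

text \<open>At most a multiple of 2^(kd) links, with moments of order 2^(-k(d+\<eta>)), add up to
  order 2^(-k \<eta>), which is the 2p-th power of \<open>\<rho> ^ k\<close>; dividing by its
  (2p-1)-th power leaves \<open>\<rho> ^ k\<close>. The family is abstract so that the estimate
  serves both the normalised sums and their Gaussian limit.\<close>

lemma osc_expectation_le:
  fixes Z :: "'w \<Rightarrow> nat \<times> ('d \<Rightarrow> nat) \<Rightarrow> real"
  assumes int: "\<And>a b. (a, b) \<in> links k \<Longrightarrow> integrable Q (\<lambda>\<omega>. \<bar>Z \<omega> a - Z \<omega> b\<bar> ^ (2 * p))"
    and K: "\<And>a b. (a, b) \<in> links k \<Longrightarrow>
      (\<integral>\<omega>. \<bar>Z \<omega> a - Z \<omega> b\<bar> ^ (2 * p) \<partial>Q) \<le> K * 2 powr (- (real k * (real CARD('d) + \<eta>)))"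
    and Q: "prob_space Q" and K0: "0 \<le> K"
  shows "integrable Q (\<lambda>\<omega>. osc \<rho> p k (Z \<omega>))"
    and "(\<integral>\<omega>. osc \<rho> p k (Z \<omega>) \<partial>Q) \<le> (1 + 2 * 68 ^ CARD('d) * K) * \<rho> ^ k"
proof -
  interpret Q: prob_space Q by fact
  let ?L = "links k :: ((nat \<times> ('d \<Rightarrow> nat)) \<times> (nat \<times> ('d \<Rightarrow> nat))) set"
  have i: "integrable Q (\<lambda>\<omega>. \<Sum>(a, b)\<in>?L. \<bar>Z \<omega> a - Z \<omega> b\<bar> ^ (2 * p))"
    using int by (intro Bochner_Integration.integrable_sum) auto
  show "integrable Q (\<lambda>\<omega>. osc \<rho> p k (Z \<omega>))"
    unfolding osc_def using i by (intro Bochner_Integration.integrable_add) auto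
  have "(\<integral>\<omega>. osc \<rho> p k (Z \<omega>) \<partial>Q) = \<rho> ^ k + (\<integral>\<omega>. (\<Sum>(a, b)\<in>?L. \<bar>Z \<omega> a - Z \<omega> b\<bar> ^ (2 * p)) \<partial>Q) / (\<rho> ^ k) ^ (2 * p - 1)"
    unfolding osc_def using i by (simp add: Q.prob_space)
  also have "(\<integral>\<omega>. (\<Sum>(a, b)\<in>?L. \<bar>Z \<omega> a - Z \<omega> b\<bar> ^ (2 * p)) \<partial>Q) = (\<Sum>(a, b)\<in>?L. (\<integral>\<omega>. \<bar>Z \<omega> a - Z \<omega> b\<bar> ^ (2 * p) \<partial>Q))"
    using int by (subst Bochner_Integration.integral_sum) (auto simp: case_prod_beta)
  also have "\<dots> \<le> (\<Sum>(a, b)\<in>?L. K * 2 powr (- (real k * (real CARD('d) + \<eta>))))"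
    using K by (intro sum_mono) auto
  also have "\<dots> = real (card ?L) * (K * 2 powr (- (real k * (real CARD('d) + \<eta>))))"
    by (simp add: case_prod_beta)
  also have "\<dots> \<le> (2 * 68 ^ CARD('d) * (2 ^ CARD('d)) ^ k) * (K * 2 powr (- (real k * (real CARD('d) + \<eta>))))"
    using K0 by (intro mult_right_mono card_links) auto
  also have "\<dots> = 2 * 68 ^ CARD('d) * K * (\<rho> ^ k) ^ (2 * p)"
  proof -
    have "((2::real) ^ CARD('d)) ^ k = 2 powr (real k * real CARD('d))"
      by (simp add: powr_realpow[symmetric] powr_powr mult.commute)
    then have "((2::real) ^ CARD('d)) ^ k * 2 powr (- (real k * (real CARD('d) + \<eta>))) = 2 powr (- (real k * \<eta>))"
      by (simp add: powr_add[symmetric] algebra_simps)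
    then show ?thesis unfolding rho_power by simp
  qed
  finally have "(\<integral>\<omega>. osc \<rho> p k (Z \<omega>) \<partial>Q) \<le> \<rho> ^ k + 2 * 68 ^ CARD('d) * K * (\<rho> ^ k) ^ (2 * p) / (\<rho> ^ k) ^ (2 * p - 1)"
    using rho by (simp add: divide_right_mono)
  also have "2 * 68 ^ CARD('d) * K * (\<rho> ^ k) ^ (2 * p) / (\<rho> ^ k) ^ (2 * p - 1) = 2 * 68 ^ CARD('d) * K * \<rho> ^ k"
  proof -
    have "2 * p = Suc (2 * p - 1)" using p_pos by simp
    then have "(\<rho> ^ k) ^ (2 * p) = \<rho> ^ k * (\<rho> ^ k) ^ (2 * p - 1)" by (metis power_Suc)
    moreover have "(\<rho> ^ k) ^ (2 * p - 1) \<noteq> 0" using rho by simp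
    ultimately show ?thesis by simp
  qed
  finally show "(\<integral>\<omega>. osc \<rho> p k (Z \<omega>) \<partial>Q) \<le> (1 + 2 * 68 ^ CARD('d) * K) * \<rho> ^ k"
    by (simp add: algebra_simps)
qed

lemma Zn_diff_integrable: "integrable M (\<lambda>\<omega>. \<bar>Zn n \<omega> a - Zn n \<omega> b\<bar> ^ m)"
  unfolding Zn_diff
proof (rule G_power_integrable(1)[where S=1])
  show "\<bar>bump a x - bump b x\<bar> \<le> 1" for x
    using bump_bounds[of a x] bump_bounds[of b x] by (simp add: abs_le_iff)
qed measurable

lemma osc_Zn_expectation:
  "\<exists>K\<ge>0. \<forall>k n D. 1 \<le> n \<longrightarrow> 1 \<le> D \<longrightarrow> 4 ^ k \<le> D * real n \<longrightarrow>
     integrable M (\<lambda>\<omega>. osc \<rho> p k (Zn n \<omega>)) \<and> (\<integral>\<omega>. osc \<rho> p k (Zn n \<omega>) \<partial>M) \<le> (1 + K * D ^ p) * \<rho> ^ k"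
proof -
  obtain K where K: "0 \<le> K" "\<forall>k n a b D. (a, b) \<in> links k \<longrightarrow> 1 \<le> n \<longrightarrow> 1 \<le> D \<longrightarrow> 4 ^ k \<le> D * real n \<longrightarrow>
     (\<integral>\<omega>. \<bar>Zn n \<omega> a - Zn n \<omega> b\<bar> ^ (2 * p) \<partial>M) \<le> K * D ^ p * 2 powr (- (real k * (real CARD('d) + \<eta>)))"
    using bump_link_moment by blast
  have "integrable M (\<lambda>\<omega>. osc \<rho> p k (Zn n \<omega>)) \<and>
      (\<integral>\<omega>. osc \<rho> p k (Zn n \<omega>) \<partial>M) \<le> (1 + (2 * 68 ^ CARD('d) * K) * D ^ p) * \<rho> ^ k"
    if "1 \<le> n" "1 \<le> D" "4 ^ k \<le> D * real n" for k n D
  proof -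
    have K0: "0 \<le> K * D ^ p" using K that by simp
    have le: "(\<integral>\<omega>. \<bar>Zn n \<omega> a - Zn n \<omega> b\<bar> ^ (2 * p) \<partial>M) \<le> K * D ^ p * 2 powr (- (real k * (real CARD('d) + \<eta>)))"
      if "(a, b) \<in> links k" for a b
      using K(2) that \<open>1 \<le> n\<close> \<open>1 \<le> D\<close> \<open>4 ^ k \<le> D * real n\<close> by blast
    note osc_expectation_le[where Z="Zn n" and k=k and Q=M and K="K * D ^ p",
      OF Zn_diff_integrable le prob_space_axioms K0]
    then show ?thesis by (simp add: mult.assoc)
  qed
  then show ?thesis using K(1) by (intro exI[of _ "2 * 68 ^ CARD('d) * K"]) auto
qed

section \<open>The multidimensional distribution function at extended times\<close>

abbreviation F :: "ereal^'d \<Rightarrow> real" where "F \<equiv> dfun_ext M X"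

definition uv :: "ereal^'d \<Rightarrow> 'd \<Rightarrow> real" where "uv t j = u j (t $ j)"

lemma uv_bounds: "\<forall>j. 0 \<le> uv t j \<and> uv t j \<le> 1"
  by (simp add: uv_def u_bounds)

lemma measurable_ext_le [measurable]: "{\<omega> \<in> space M. ext_le (X i \<omega>) t} \<in> sets M"
proof -
  have "{\<omega> \<in> space M. ext_le (X i \<omega>) t} = {\<omega> \<in> space M. \<forall>j\<in>UNIV. ereal (X i \<omega> $ j) \<le> t $ j}"
    by (simp add: ext_le_def)
  also have "\<dots> \<in> sets M" by (intro sets.sets_Collect_finite_All) auto
  finally show ?thesis .
qed

text \<open>The part of one lower orthant outside another is covered by one strip per
  coordinate.\<close>

lemma F_diff_le: "F s - F t \<le> (\<Sum>j\<in>UNIV. \<bar>uv s j - uv t j\<bar>)"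
proof -
  let ?B = "\<lambda>j. {\<omega> \<in> space M. ereal (X 0 \<omega> $ j) \<le> s $ j} - {\<omega> \<in> space M. ereal (X 0 \<omega> $ j) \<le> t $ j}"
  have "F s \<le> prob ({\<omega> \<in> space M. ext_le (X 0 \<omega>) t} \<union> (\<Union>j\<in>UNIV. ?B j))"
    unfolding dfun_ext_def by (rule finite_measure_mono) (auto simp: ext_le_def)
  also have "\<dots> \<le> F t + prob (\<Union>j\<in>UNIV. ?B j)"
    unfolding dfun_ext_def by (rule measure_Un_le) auto
  also have "prob (\<Union>j\<in>UNIV. ?B j) \<le> (\<Sum>j\<in>UNIV. prob (?B j))"
    by (rule finite_measure_subadditive_finite) auto
  also have "\<dots> \<le> (\<Sum>j\<in>UNIV. \<bar>uv s j - uv t j\<bar>)"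
  proof (rule sum_mono)
    fix j
    show "prob (?B j) \<le> \<bar>uv s j - uv t j\<bar>"
    proof (cases "t $ j \<le> s $ j")
      case True
      have "prob (?B j) = uv s j - uv t j"
        unfolding uv_def u_def using True by (intro finite_measure_Diff) (auto intro: order_trans)
      then show ?thesis by simp
    next
      case False
      then have "?B j = {}" by (auto intro: order_trans less_imp_le)
      then show ?thesis by (simp only: measure_empty abs_ge_zero)
    qed
  qed
  finally show ?thesis by simp
qed

lemma F_lipschitz: "\<bar>F s - F t\<bar> \<le> (\<Sum>j\<in>UNIV. \<bar>uv s j - uv t j\<bar>)"
  using F_diff_le[of s t] F_diff_le[of t s] by (simp add: abs_minus_commute abs_le_iff)

lemma uv_continuous: "continuous_on UNIV (\<lambda>t. uv t j)"
proof -
  have "continuous_on UNIV (\<lambda>t :: ereal^'d. t $ j)" by (intro continuous_intros)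
  from continuous_on_compose2[OF u_continuous this, of j] show ?thesis unfolding uv_def by simp
qed

lemma F_continuous: "continuous_on UNIV F"
  unfolding continuous_on_def
proof
  fix t
  have "((\<lambda>s. \<Sum>j\<in>UNIV. \<bar>uv s j - uv t j\<bar>) \<longlongrightarrow> (\<Sum>j\<in>UNIV. \<bar>uv t j - uv t j\<bar>)) (at t within UNIV)"
    using uv_continuous unfolding continuous_on_def by (intro tendsto_intros) auto
  then have "((\<lambda>s. \<Sum>j\<in>UNIV. \<bar>uv s j - uv t j\<bar>) \<longlongrightarrow> 0) (at t within UNIV)" by simp
  then have "((\<lambda>s. F s - F t) \<longlongrightarrow> 0) (at t within UNIV)"
    by (rule Lim_null_comparison[rotated]) (use F_lipschitz in auto)
  then show "(F \<longlongrightarrow> F t) (at t within UNIV)" by (rule LIM_zero_cancel)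
qed

lemma F_near_times:
  assumes e: "0 < e"
  shows "\<exists>\<delta>>0. \<forall>s t. near_times \<delta> s t \<longrightarrow> \<bar>F s - F t\<bar> < e"
proof -
  have "0 < e / (2 * real CARD('d))" using e by simp
  from u_uniform[OF this] obtain \<delta> where \<delta>: "\<delta> > 0"
    "\<And>j x y. \<bar>x - y\<bar> \<le> \<delta> \<Longrightarrow> \<bar>u j (ereal x) - u j (ereal y)\<bar> < e / (2 * real CARD('d))" by blast
  have "\<bar>F s - F t\<bar> < e" if n: "near_times \<delta> s t" for s t
  proof -
    have "\<bar>uv s j - uv t j\<bar> \<le> e / (2 * real CARD('d))" for j
    proof -
      consider "s $ j = t $ j" | a b where "s $ j = ereal a" "t $ j = ereal b" "\<bar>a - b\<bar> \<le> \<delta>"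
        using n unfolding near_times_def by blast
      then show ?thesis
        by cases (use e \<delta>(2) in \<open>auto simp: uv_def less_imp_le\<close>)
    qed
    then have "(\<Sum>j\<in>UNIV. \<bar>uv s j - uv t j\<bar>) \<le> (\<Sum>j\<in>(UNIV :: 'd set). e / (2 * real CARD('d)))"
      by (intro sum_mono)
    also have "\<dots> = e / 2" by simp
    finally show ?thesis using F_lipschitz[of s t] e by simp
  qed
  then show ?thesis using \<delta>(1) by blast
qed

lemma empirical_process_eq: "empirical_process M X n \<omega> = emp F n (\<lambda>i. X i \<omega>)"
  by (simp add: empirical_process_def emp_def fun_eq_iff)

lemma empirical_in_Dspace: "empirical_process M X n \<omega> \<in> Dspace"
  unfolding empirical_process_eq by (rule emp_in_Dspace[OF continuous_in_Dspace[OF F_continuous]])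

lemma empirical_measurable:
  assumes "skor_continuous g"
  shows "(\<lambda>\<omega>. g (empirical_process M X n \<omega>)) \<in> borel_measurable M"
  unfolding empirical_process_eq
  by (rule borel_measurable_skor_continuous_emp[OF assms continuous_in_Dspace[OF F_continuous] F_near_times meas])

text \<open>The two sandwiching bumps are linked, so one \<open>osc\<close> bounds their distance
  and another the distance of the interpolation from the lower one. The mean gap is at most 9 d /
  2^k, and n such errors divided by sqrt n give the last term.\<close>

lemma empirical_sandwich:
  fixes t :: "ereal^'d"
  assumes w: "\<omega> \<in> space M"
  shows "\<bar>empirical_process M X n \<omega> t - interp k (Zn n \<omega>) (uv t)\<bar>
     \<le> 2 * osc \<rho> p k (Zn n \<omega>) + sqrt (real n) * (9 * real CARD('d) / 2 ^ k)"
proof -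
  define fl where "fl j = nat \<lfloor>2 ^ k * uv t j\<rfloor>" for j
  \<comment> \<open>A cut-off of index l is 0 where l < 2^k \<open>u\<close> and 1 where 2^k
    \<open>u\<close> < l - 1, which calls for the indices floor - 1 and floor + 2. Truncation of
    floor - 1 at 0 is harmless, as \<open>\<psi>\<close> vanishes for indices up to 1.\<close>
  define lo where "lo j = fl j - 1" for j
  define hi where "hi j = fl j + 2" for j
  have nn: "0 \<le> 2 ^ k * uv t j" "2 ^ k * uv t j \<le> 2 ^ k" for j
    using uv_bounds[of t] by (auto simp: mult_left_le)
  have fl: "real (fl j) \<le> 2 ^ k * uv t j" "2 ^ k * uv t j < real (fl j) + 1" for j
    unfolding fl_def using nn[of j] by linarith+
  have flk: "fl j \<le> 2 ^ k" for j
  proof -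
    have "real (fl j) \<le> 2 ^ k" using fl(1)[of j] nn(2)[of j] by linarith
    then show ?thesis by (metis of_nat_le_iff of_nat_numeral of_nat_power)
  qed
  have glo: "lo \<in> grid k" unfolding grid_iff lo_def
  proof
    fix j show "fl j - 1 \<le> 2 ^ k + 2" using flk[of j] by linarith
  qed
  have ghi: "hi \<in> grid k" unfolding grid_iff hi_def using flk by simp
  have nlo: "near k (uv t) lo"
    unfolding near_def
  proof
    fix j
    have "real (fl j) - 1 \<le> real (lo j)" "real (lo j) \<le> real (fl j)" unfolding lo_def by linarith+
    then show "\<bar>2 ^ k * uv t j - real (lo j)\<bar> \<le> 2" using fl[of j] unfolding abs_le_iff by linarith
  qed
  have nhi: "near k (uv t) hi"
    unfolding near_def
  proof
    fix j
    have "real (hi j) = real (fl j) + 2" unfolding hi_def by simp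
    then show "\<bar>2 ^ k * uv t j - real (hi j)\<bar> \<le> 2" using fl[of j] unfolding abs_le_iff by linarith
  qed
  have link: "((k, hi), (k, lo)) \<in> links k" by (rule linksI[OF nhi nlo glo ghi]) simp
  let ?I = "\<lambda>x. if ext_le x t then 1 else (0::real)"
  have lower: "bump (k, lo) x \<le> ?I x" for x
  proof (cases "ext_le x t")
    case True then show ?thesis using bump_bounds by simp
  next
    case False
    then obtain j where j: "t $ j < ereal (x $ j)" by (auto simp: ext_le_def not_le)
    have "\<psi> k j (lo j) (x $ j) = 0"
    proof (cases "lo j \<le> 1")
      case True then show ?thesis by (simp add: \<psi>_def)
    next
      case False
      then have "real (lo j) < real (fl j)" unfolding lo_def by linarith
      also have "\<dots> \<le> 2 ^ k * uv t j" by (rule fl)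
      also have "\<dots> \<le> 2 ^ k * u j (ereal (x $ j))"
        unfolding uv_def using j by (intro mult_left_mono u_mono) auto
      finally show ?thesis by (rule psi_eq_0)
    qed
    then have "bump (k, lo) x = 0" unfolding bump_def by (auto intro!: prod_zero)
    then show ?thesis by simp
  qed
  have upper: "?I x \<le> bump (k, hi) x" for x
  proof (cases "ext_le x t")
    case False then show ?thesis using bump_bounds by simp
  next
    case True
    have "\<psi> k j (hi j) (x $ j) = 1" for j
    proof (rule psi_eq_1)
      have "2 ^ k * u j (ereal (x $ j)) \<le> 2 ^ k * uv t j"
        unfolding uv_def using True by (intro mult_left_mono u_mono) (auto simp: ext_le_def)
      also have "\<dots> < real (hi j) - 1" using fl(2)[of j] by (simp add: hi_def)
      finally show "2 ^ k * u j (ereal (x $ j)) < real (hi j) - 1" .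
    qed
    then show ?thesis using True by (simp add: bump_def)
  qed
  have Fi: "F t = (\<integral>\<omega>. ?I (X 0 \<omega>) \<partial>M)"
  proof -
    have "(\<integral>\<omega>. ?I (X 0 \<omega>) \<partial>M) = (\<integral>\<omega>. indicator {\<omega> \<in> space M. ext_le (X 0 \<omega>) t} \<omega> \<partial>M)"
      by (rule Bochner_Integration.integral_cong) (auto simp: indicator_def)
    then show ?thesis by (simp add: dfun_ext_def)
  qed
  have Ii: "integrable M (\<lambda>\<omega>. ?I (X 0 \<omega>))"
  proof -
    have "integrable M (indicator {\<omega> \<in> space M. ext_le (X 0 \<omega>) t} :: 'a \<Rightarrow> real)"
      by (intro integrable_real_indicator) (auto simp: emeasure_finite less_top[symmetric])
    then show ?thesis by (rule Bochner_Integration.integrable_cong[THEN iffD1, rotated 2]) (auto simp: indicator_def)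
  qed
  have Flo: "mean (bump (k, lo)) \<le> F t"
    unfolding Fi by (rule integral_mono[OF integrable_bump Ii]) (rule lower)
  have Fhi: "F t \<le> mean (bump (k, hi))"
    unfolding Fi by (rule integral_mono[OF Ii integrable_bump]) (rule upper)
  have gap: "mean (bump (k, hi)) - mean (bump (k, lo)) \<le> 9 * real CARD('d) / 2 ^ k"
  proof -
    have "mean (bump (k, hi)) - mean (bump (k, lo)) = (\<integral>\<omega>. bump (k, hi) (X 0 \<omega>) - bump (k, lo) (X 0 \<omega>) \<partial>M)"
      using integrable_bump by simp
    also have "\<dots> \<le> (\<integral>\<omega>. \<bar>bump (k, hi) (X 0 \<omega>) - bump (k, lo) (X 0 \<omega>)\<bar> \<partial>M)"
      by (rule integral_mono) (use integrable_bump in \<open>auto intro!: integrable_abs Bochner_Integration.integrable_diff\<close>)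
    also have "\<dots> \<le> 9 * real CARD('d) / 2 ^ k" by (rule bump_link_L1[OF link])
    finally show ?thesis .
  qed
  define \<Delta> where "\<Delta> = 9 * real CARD('d) / 2 ^ k"
  define U where "U = empirical_process M X n \<omega> t"
  have root: "real n / sqrt (real n) = sqrt (real n)" by (simp add: real_div_sqrt)
  have Ulo: "Zn n \<omega> (k, lo) - sqrt (real n) * \<Delta> \<le> U"
  proof -
    have "(\<Sum>i=1..n. bump (k, lo) (X i \<omega>) - mean (bump (k, lo))) - real n * \<Delta>
        = (\<Sum>i=1..n. bump (k, lo) (X i \<omega>) - mean (bump (k, lo)) - \<Delta>)" by (simp add: sum_subtractf)
    also have "\<dots> \<le> (\<Sum>i=1..n. ?I (X i \<omega>) - F t)"
    proof (rule sum_mono)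
      fix i show "bump (k, lo) (X i \<omega>) - mean (bump (k, lo)) - \<Delta> \<le> ?I (X i \<omega>) - F t"
        using lower[of "X i \<omega>"] Fhi gap unfolding \<Delta>_def by linarith
    qed
    finally have "((\<Sum>i=1..n. bump (k, lo) (X i \<omega>) - mean (bump (k, lo))) - real n * \<Delta>) / sqrt (real n) \<le> U"
      unfolding U_def empirical_process_def by (rule divide_right_mono) simp
    then show ?thesis unfolding Zn_def G_def diff_divide_distrib using root
      by (metis times_divide_eq_left)
  qed
  have Uhi: "U \<le> Zn n \<omega> (k, hi) + sqrt (real n) * \<Delta>"
  proof -
    have "(\<Sum>i=1..n. ?I (X i \<omega>) - F t) \<le> (\<Sum>i=1..n. bump (k, hi) (X i \<omega>) - mean (bump (k, hi)) + \<Delta>)"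
    proof (rule sum_mono)
      fix i show "?I (X i \<omega>) - F t \<le> bump (k, hi) (X i \<omega>) - mean (bump (k, hi)) + \<Delta>"
        using upper[of "X i \<omega>"] Flo gap unfolding \<Delta>_def by linarith
    qed
    also have "\<dots> = (\<Sum>i=1..n. bump (k, hi) (X i \<omega>) - mean (bump (k, hi))) + real n * \<Delta>" by (simp add: sum.distrib)
    finally have "U \<le> ((\<Sum>i=1..n. bump (k, hi) (X i \<omega>) - mean (bump (k, hi))) + real n * \<Delta>) / sqrt (real n)"
      unfolding U_def empirical_process_def by (rule divide_right_mono) simp
    then show ?thesis unfolding Zn_def G_def add_divide_distrib using root
      by (metis times_divide_eq_left)
  qed
  have o1: "\<bar>Zn n \<omega> (k, hi) - Zn n \<omega> (k, lo)\<bar> \<le> osc \<rho> p k (Zn n \<omega>)"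
    by (rule osc_bound[OF rho(1) p_pos link])
  have o2: "\<bar>interp k (Zn n \<omega>) (uv t) - Zn n \<omega> (k, lo)\<bar> \<le> osc \<rho> p k (Zn n \<omega>)"
    by (rule interp_osc_same[OF uv_bounds rho(1) p_pos glo nlo])
  have "\<bar>U - interp k (Zn n \<omega>) (uv t)\<bar> \<le> 2 * osc \<rho> p k (Zn n \<omega>) + sqrt (real n) * \<Delta>"
    using o1 o2 Ulo Uhi unfolding abs_le_iff by linarith
  then show ?thesis unfolding U_def \<Delta>_def .
qed

end

section \<open>The limiting Gaussian family\<close>

context empirical_setup
begin

definition comb :: "(nat \<times> ('d \<Rightarrow> nat)) set \<Rightarrow> (nat \<times> ('d \<Rightarrow> nat) \<Rightarrow> real) \<Rightarrow> real^'d \<Rightarrow> real" where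
  "comb S c x = (\<Sum>s\<in>S. c s * bump s x)"

lemma comb_measurable [measurable]: "comb S c \<in> borel_measurable borel"
  unfolding comb_def[abs_def] by measurable

lemma comb_bounds:
  shows "\<bar>comb S c x\<bar> \<le> (\<Sum>s\<in>S. \<bar>c s\<bar>)"
    and "\<bar>comb S c x - comb S c y\<bar> \<le> (\<Sum>s\<in>S. \<bar>c s\<bar> * (real CARD('d) * H (fst s))) * norm (x - y) powr \<alpha>"
proof -
  have "\<bar>comb S c x\<bar> \<le> (\<Sum>s\<in>S. \<bar>c s * bump s x\<bar>)" unfolding comb_def by (rule sum_abs)
  also have "\<dots> \<le> (\<Sum>s\<in>S. \<bar>c s\<bar>)"
    using bump_bounds by (intro sum_mono) (simp add: abs_mult mult_left_le)
  finally show "\<bar>comb S c x\<bar> \<le> (\<Sum>s\<in>S. \<bar>c s\<bar>)" .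
  have "comb S c x - comb S c y = (\<Sum>s\<in>S. c s * (bump s x - bump s y))"
    unfolding comb_def by (simp add: sum_subtractf right_diff_distrib)
  also have "\<bar>\<dots>\<bar> \<le> (\<Sum>s\<in>S. \<bar>c s * (bump s x - bump s y)\<bar>)" by (rule sum_abs)
  also have "\<dots> \<le> (\<Sum>s\<in>S. \<bar>c s\<bar> * (real CARD('d) * H (fst s) * norm (x - y) powr \<alpha>))"
    unfolding abs_mult by (intro sum_mono mult_left_mono bump_holder) auto
  finally show "\<bar>comb S c x - comb S c y\<bar> \<le> (\<Sum>s\<in>S. \<bar>c s\<bar> * (real CARD('d) * H (fst s))) * norm (x - y) powr \<alpha>"
    by (simp add: sum_distrib_right mult.assoc)
qed

lemma G_comb: "G n (comb S c) \<omega> = (\<Sum>s\<in>S. c s * Zn n \<omega> s)"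
proof -
  have "mean (comb S c) = (\<Sum>s\<in>S. c s * mean (bump s))"
    unfolding comb_def using integrable_bump by (subst Bochner_Integration.integral_sum) auto
  then have "(\<Sum>i=1..n. comb S c (X i \<omega>) - mean (comb S c)) = (\<Sum>i=1..n. \<Sum>s\<in>S. c s * (bump s (X i \<omega>) - mean (bump s)))"
    by (simp add: comb_def sum_subtractf right_diff_distrib)
  also have "\<dots> = (\<Sum>s\<in>S. c s * (\<Sum>i=1..n. bump s (X i \<omega>) - mean (bump s)))"
    by (subst sum.swap) (simp add: sum_distrib_left)
  finally have *: "(\<Sum>i=1..n. comb S c (X i \<omega>) - mean (comb S c))
     = (\<Sum>s\<in>S. c s * (\<Sum>i=1..n. bump s (X i \<omega>) - mean (bump s)))" .
  show ?thesis unfolding G_def Zn_def * by (subst sum_divide_distrib) simp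
qed

lemma Zn_measurable [measurable]: "(\<lambda>\<omega>. Zn n \<omega> s) \<in> borel_measurable M"
  unfolding Zn_def by (rule G_measurable) measurable

text \<open>The Cramer-Wold device: a linear combination of bumps is itself a Hoelder function, so
  after centring the one-dimensional hypothesis applies to it.\<close>

lemma comb_clt:
  "\<exists>\<sigma>\<ge>0. weak_conv_m (\<lambda>n. distr M borel (\<lambda>\<omega>. \<Sum>s\<in>S. c s * Zn n \<omega> s)) (normal_law \<sigma>)"
proof -
  define f where "f x = comb S c x - mean (comb S c)" for x
  have i: "integrable M (\<lambda>\<omega>. comb S c (X 0 \<omega>))"
    by (rule integrable_bounded_X[OF comb_measurable comb_bounds(1)])
  have "f \<in> holder_space \<alpha>"
  proof (rule holder_spaceI)
    show "\<bar>f x\<bar> \<le> (\<Sum>s\<in>S. \<bar>c s\<bar>) + (\<Sum>s\<in>S. \<bar>c s\<bar>)" for x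
      unfolding f_def
      by (rule order_trans[OF abs_triangle_ineq4 add_mono[OF comb_bounds(1) mean_abs_le[OF comb_measurable comb_bounds(1)]]])
    show "\<bar>f x - f y\<bar> \<le> (\<Sum>s\<in>S. \<bar>c s\<bar> * (real CARD('d) * H (fst s))) * norm (x - y) powr \<alpha>" for x y
      using comb_bounds(2)[of S c x y] by (simp add: f_def)
  qed
  moreover have "mean f = 0" unfolding f_def using i by (simp add: prob_space)
  moreover have "(\<Sum>i=1..n. f (X i \<omega>)) / sqrt (real n) = (\<Sum>s\<in>S. c s * Zn n \<omega> s)" for n \<omega>
    unfolding G_comb[symmetric] G_def f_def ..
  ultimately show ?thesis using clt[of f] by simp
qed

text \<open>Moments of order 2p thus control fourth moments, under which variances converge along
  with the laws.\<close>

lemma p_ge_2: "2 \<le> p"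
proof -
  have "1 * 1 \<le> r * real CARD('d)" using r by (intro mult_mono) (auto simp: Suc_leI)
  then have "1 < real p" using p by linarith
  then show ?thesis by simp
qed

text \<open>Identifies the variance of the central limit theorem as a limit of second moments, whose
  quadratic dependence on c is visible.\<close>

lemma comb_second_moment:
  "\<exists>v\<ge>0. (\<lambda>n. \<integral>\<omega>. (\<Sum>s\<in>S. c s * Zn n \<omega> s)\<^sup>2 \<partial>M) \<longlonglongrightarrow> v \<and>
     weak_conv_m (\<lambda>n. distr M borel (\<lambda>\<omega>. \<Sum>s\<in>S. c s * Zn n \<omega> s)) (normal_law (sqrt v))"
proof -
  obtain \<sigma> where \<sigma>: "0 \<le> \<sigma>" "weak_conv_m (\<lambda>n. distr M borel (\<lambda>\<omega>. \<Sum>s\<in>S. c s * Zn n \<omega> s)) (normal_law \<sigma>)"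
    using comb_clt by blast
  obtain C' where C': "\<And>n. n \<ge> 1 \<Longrightarrow> (\<integral>\<omega>. \<bar>G n (comb S c) \<omega>\<bar> ^ (2 * p) \<partial>M) \<le> C'"
    using G_moment_bounded[OF comb_measurable comb_bounds] by blast
  note int = G_power_integrable[OF comb_measurable comb_bounds(1)]
  have "(\<lambda>n. \<integral>\<omega>. (\<Sum>s\<in>S. c s * Zn n \<omega> s)\<^sup>2 \<partial>M) \<longlonglongrightarrow> \<sigma>\<^sup>2"
  proof (rule weak_conv_normal_second_moment[OF prob_space_axioms _ \<sigma>])
    show "integrable M (\<lambda>\<omega>. (\<Sum>s\<in>S. c s * Zn n \<omega> s) ^ 4)" for n
      using int(2)[of n S c 4] by (simp add: G_comb)
    show "\<forall>\<^sub>F n in sequentially. (\<integral>\<omega>. (\<Sum>s\<in>S. c s * Zn n \<omega> s) ^ 4 \<partial>M) \<le> 1 + C'"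
      using eventually_ge_at_top[of 1]
    proof eventually_elim
      case (elim n)
      have y: "y ^ 4 \<le> 1 + \<bar>y\<bar> ^ (2 * p)" for y :: real
      proof -
        have "\<bar>y\<bar> ^ 4 \<le> 1 + \<bar>y\<bar> ^ (2 * p)"
        proof (cases "\<bar>y\<bar> \<le> 1")
          case True
          then have "\<bar>y\<bar> ^ 4 \<le> 1" by (intro power_le_one) auto
          then show ?thesis by (simp add: add_increasing2)
        next
          case False
          then have "\<bar>y\<bar> ^ 4 \<le> \<bar>y\<bar> ^ (2 * p)" using p_ge_2 by (intro power_increasing) auto
          then show ?thesis by simp
        qed
        then show ?thesis by simp
      qed
      have "(\<integral>\<omega>. (\<Sum>s\<in>S. c s * Zn n \<omega> s) ^ 4 \<partial>M) \<le> (\<integral>\<omega>. 1 + \<bar>G n (comb S c) \<omega>\<bar> ^ (2 * p) \<partial>M)"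
        unfolding G_comb[symmetric] by (rule integral_mono) (use int y in auto)
      also have "\<dots> = 1 + (\<integral>\<omega>. \<bar>G n (comb S c) \<omega>\<bar> ^ (2 * p) \<partial>M)" using int by (simp add: prob_space)
      finally show ?case using C'[OF elim] by simp
    qed
  qed measurable
  then show ?thesis using \<sigma> by (intro exI[of _ "\<sigma>\<^sup>2"]) auto
qed

lemma Zn_product_integrable: "integrable M (\<lambda>\<omega>. Zn n \<omega> s * Zn n \<omega> t)"
proof (rule integrable_const_bound[where B="(real n * 2) * (real n * 2)"])
  have b: "\<bar>Zn n \<omega> s\<bar> \<le> real n * 2" for \<omega> s
    unfolding Zn_def using G_bound[of "bump s" 1 n \<omega>] bump_bounds by auto
  have "norm (Zn n \<omega> s * Zn n \<omega> t) \<le> (real n * 2) * (real n * 2)" for \<omega>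
    unfolding real_norm_def abs_mult by (intro mult_mono b) auto
  then show "AE \<omega> in M. norm (Zn n \<omega> s * Zn n \<omega> t) \<le> (real n * 2) * (real n * 2)" by simp
qed measurable

text \<open>Polarisation. The diagonal is treated separately because \<open>{s, t}\<close> has only
  one element there.\<close>

lemma covariance_limit: "\<exists>v. (\<lambda>n. \<integral>\<omega>. Zn n \<omega> s * Zn n \<omega> t \<partial>M) \<longlonglongrightarrow> v"
proof (cases "s = t")
  case True
  obtain v where "(\<lambda>n. \<integral>\<omega>. (\<Sum>x\<in>{s}. 1 * Zn n \<omega> x)\<^sup>2 \<partial>M) \<longlonglongrightarrow> v"
    using comb_second_moment[where S="{s}" and c="\<lambda>_. 1"] by blast
  then show ?thesis using True by (auto simp: power2_eq_square)
next
  case False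
  obtain v where v: "(\<lambda>n. \<integral>\<omega>. (\<Sum>x\<in>{s, t}. 1 * Zn n \<omega> x)\<^sup>2 \<partial>M) \<longlonglongrightarrow> v"
    using comb_second_moment[where S="{s, t}" and c="\<lambda>_. 1"] by blast
  obtain w where w: "(\<lambda>n. \<integral>\<omega>. (\<Sum>x\<in>{s, t}. (if x = s then 1 else -1) * Zn n \<omega> x)\<^sup>2 \<partial>M) \<longlonglongrightarrow> w"
    using comb_second_moment[where S="{s, t}" and c="\<lambda>x. if x = s then 1 else -1"] by blast
  have eq: "(\<integral>\<omega>. Zn n \<omega> s * Zn n \<omega> t \<partial>M) = ((\<integral>\<omega>. (\<Sum>x\<in>{s, t}. 1 * Zn n \<omega> x)\<^sup>2 \<partial>M)
     - (\<integral>\<omega>. (\<Sum>x\<in>{s, t}. (if x = s then 1 else -1) * Zn n \<omega> x)\<^sup>2 \<partial>M)) / 4" for n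
  proof -
    have 1: "(\<Sum>x\<in>{s, t}. 1 * Zn n \<omega> x)\<^sup>2 = Zn n \<omega> s * Zn n \<omega> s + 2 * (Zn n \<omega> s * Zn n \<omega> t) + Zn n \<omega> t * Zn n \<omega> t" for \<omega>
      using False by (simp add: power2_eq_square algebra_simps)
    have 2: "(\<Sum>x\<in>{s, t}. (if x = s then 1 else -1) * Zn n \<omega> x)\<^sup>2 = Zn n \<omega> s * Zn n \<omega> s - 2 * (Zn n \<omega> s * Zn n \<omega> t) + Zn n \<omega> t * Zn n \<omega> t" for \<omega>
      using False by (simp add: power2_eq_square algebra_simps)
    show ?thesis unfolding 1 2 using Zn_product_integrable by simp
  qed
  have "(\<lambda>n. ((\<integral>\<omega>. (\<Sum>x\<in>{s, t}. 1 * Zn n \<omega> x)\<^sup>2 \<partial>M)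
     - (\<integral>\<omega>. (\<Sum>x\<in>{s, t}. (if x = s then 1 else -1) * Zn n \<omega> x)\<^sup>2 \<partial>M)) / 4) \<longlonglongrightarrow> (v - w) / 4"
    by (intro tendsto_divide tendsto_diff v w tendsto_const) simp
  then show ?thesis unfolding eq[symmetric] by blast
qed

definition \<Gamma> where "\<Gamma> s t = lim (\<lambda>n. \<integral>\<omega>. Zn n \<omega> s * Zn n \<omega> t \<partial>M)"

lemma Gamma_limit: "(\<lambda>n. \<integral>\<omega>. Zn n \<omega> s * Zn n \<omega> t \<partial>M) \<longlonglongrightarrow> \<Gamma> s t"
proof -
  obtain v where v: "(\<lambda>n. \<integral>\<omega>. Zn n \<omega> s * Zn n \<omega> t \<partial>M) \<longlonglongrightarrow> v"
    using covariance_limit by blast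
  then show ?thesis unfolding \<Gamma>_def using limI[OF v] by simp
qed

lemma Gamma_quadratic:
  "(\<lambda>n. \<integral>\<omega>. (\<Sum>s\<in>S. c s * Zn n \<omega> s)\<^sup>2 \<partial>M) \<longlonglongrightarrow> (\<Sum>s\<in>S. \<Sum>t\<in>S. c s * c t * \<Gamma> s t)"
proof -
  have eq: "(\<integral>\<omega>. (\<Sum>s\<in>S. c s * Zn n \<omega> s)\<^sup>2 \<partial>M) = (\<Sum>s\<in>S. \<Sum>t\<in>S. c s * c t * (\<integral>\<omega>. Zn n \<omega> s * Zn n \<omega> t \<partial>M))" for n
  proof -
    have "(\<Sum>s\<in>S. c s * Zn n \<omega> s)\<^sup>2 = (\<Sum>s\<in>S. \<Sum>t\<in>S. c s * c t * (Zn n \<omega> s * Zn n \<omega> t))" for \<omega>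
      unfolding power2_eq_square sum_product by (intro sum.cong refl) simp
    then have "(\<integral>\<omega>. (\<Sum>s\<in>S. c s * Zn n \<omega> s)\<^sup>2 \<partial>M) = (\<integral>\<omega>. (\<Sum>s\<in>S. \<Sum>t\<in>S. c s * c t * (Zn n \<omega> s * Zn n \<omega> t)) \<partial>M)"
      by simp
    also have "\<dots> = (\<Sum>s\<in>S. \<integral>\<omega>. (\<Sum>t\<in>S. c s * c t * (Zn n \<omega> s * Zn n \<omega> t)) \<partial>M)"
      by (intro Bochner_Integration.integral_sum Bochner_Integration.integrable_sum integrable_mult_right Zn_product_integrable)
    also have "\<dots> = (\<Sum>s\<in>S. \<Sum>t\<in>S. c s * c t * (\<integral>\<omega>. Zn n \<omega> s * Zn n \<omega> t \<partial>M))"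
      by (intro sum.cong refl) (subst Bochner_Integration.integral_sum,
          auto intro!: integrable_mult_right Zn_product_integrable simp del: integrable_mult_right_iff)
    finally show ?thesis .
  qed
  show ?thesis unfolding eq by (intro tendsto_sum tendsto_mult tendsto_const Gamma_limit)
qed

lemma Gamma_psd: "psd_kernel \<Gamma>"
  unfolding psd_kernel_def
proof (intro conjI allI impI)
  show "\<Gamma> s t = \<Gamma> t s" for s t unfolding \<Gamma>_def by (simp add: mult.commute)
  fix S :: "(nat \<times> ('d \<Rightarrow> nat)) set" and c :: "nat \<times> ('d \<Rightarrow> nat) \<Rightarrow> real"
  show "0 \<le> (\<Sum>s\<in>S. \<Sum>t\<in>S. c s * c t * \<Gamma> s t)"
    by (rule LIMSEQ_le_const[OF Gamma_quadratic]) auto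
qed

text \<open>For each c, the variance of the central limit theorem and the quadratic form of
  \<open>\<Gamma>\<close> are limits of the same sequence, so the Gaussian family with kernel
  \<open>\<Gamma>\<close> has the right linear combinations.\<close>

lemma gaussian_limit:
  obtains P :: "(nat \<Rightarrow> real) measure" and Z
  where "prob_space P" "\<And>s. Z s \<in> borel_measurable P"
    "\<And>S c. finite S \<Longrightarrow> \<exists>\<sigma>\<ge>0. distr P borel (\<lambda>\<omega>. \<Sum>s\<in>S. c s * Z s \<omega>) = normal_law \<sigma>"
    "\<And>S c. finite S \<Longrightarrow> weak_conv_m (\<lambda>n. distr M borel (\<lambda>\<omega>. \<Sum>s\<in>S. c s * Zn n \<omega> s))
        (distr P borel (\<lambda>\<omega>. \<Sum>s\<in>S. c s * Z s \<omega>))"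
proof -
  from gaussian_family_exists[OF Gamma_psd] obtain P :: "(nat \<Rightarrow> real) measure" and Z where
    P: "prob_space P" "\<And>s. Z s \<in> borel_measurable P"
    "\<And>S c. finite S \<Longrightarrow> distr P borel (\<lambda>\<omega>. \<Sum>s\<in>S. c s * Z s \<omega>)
        = normal_law (sqrt (\<Sum>s\<in>S. \<Sum>t\<in>S. c s * c t * \<Gamma> s t))" by blast
  have nn: "0 \<le> (\<Sum>s\<in>S. \<Sum>t\<in>S. c s * c t * \<Gamma> s t)" if "finite S" for S c
    using Gamma_psd that unfolding psd_kernel_def by simp
  have wc: "weak_conv_m (\<lambda>n. distr M borel (\<lambda>\<omega>. \<Sum>s\<in>S. c s * Zn n \<omega> s))
        (distr P borel (\<lambda>\<omega>. \<Sum>s\<in>S. c s * Z s \<omega>))" if S: "finite S" for S c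
  proof -
    obtain v where v: "(\<lambda>n. \<integral>\<omega>. (\<Sum>s\<in>S. c s * Zn n \<omega> s)\<^sup>2 \<partial>M) \<longlonglongrightarrow> v"
      "weak_conv_m (\<lambda>n. distr M borel (\<lambda>\<omega>. \<Sum>s\<in>S. c s * Zn n \<omega> s)) (normal_law (sqrt v))"
      using comb_second_moment by blast
    have "v = (\<Sum>s\<in>S. \<Sum>t\<in>S. c s * c t * \<Gamma> s t)" by (rule LIMSEQ_unique[OF v(1) Gamma_quadratic])
    then show ?thesis using v(2) P(3)[OF S] by simp
  qed
  have ga: "\<exists>\<sigma>\<ge>0. distr P borel (\<lambda>\<omega>. \<Sum>s\<in>S. c s * Z s \<omega>) = normal_law \<sigma>" if fin: "finite S" for S c
  proof (intro exI conjI)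
    show "0 \<le> sqrt (\<Sum>s\<in>S. \<Sum>t\<in>S. c s * c t * \<Gamma> s t)" using nn[OF fin] by simp
  qed (rule P(3)[OF fin])
  show ?thesis by (rule that[OF P(1) P(2) ga wc])
qed

end

section \<open>The limit process\<close>

text \<open>D carries the largest sigma-algebra for which \<open>W\<close> is measurable. A
  functional is then measurable as soon as its composition with \<open>W\<close> is, and no relation
  to a topology on D has to be established.\<close>

lemma pushforward_exists:
  assumes P: "prob_space P" and W: "\<And>\<omega>. \<omega> \<in> space P \<Longrightarrow> W \<omega> \<in> D"
  obtains N where "prob_space N" "space N = D"
    "\<And>f :: _ \<Rightarrow> real. (\<lambda>\<omega>. f (W \<omega>)) \<in> borel_measurable P \<Longrightarrow>
       f \<in> borel_measurable N \<and> integral\<^sup>L N f = (\<integral>\<omega>. f (W \<omega>) \<partial>P) \<and> distr N borel f = distr P borel (\<lambda>\<omega>. f (W \<omega>))"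
    "\<And>A. (\<And>\<omega>. \<omega> \<in> space P \<Longrightarrow> W \<omega> \<in> A) \<Longrightarrow> AE x in N. x \<in> A"
proof -
  define S where "S = {A. A \<subseteq> D \<and> W -` A \<inter> space P \<in> sets P}"
  have sa: "sigma_algebra D S"
    unfolding sigma_algebra_iff2
  proof (intro conjI ballI allI impI)
    show "S \<subseteq> Pow D" by (auto simp: S_def)
    show "{} \<in> S" by (simp add: S_def)
    fix A assume A: "A \<in> S"
    have "W -` (D - A) \<inter> space P = space P - (W -` A \<inter> space P)" using W by auto
    then show "D - A \<in> S" using A by (auto simp: S_def)
  next
    fix A :: "nat \<Rightarrow> _ set" assume A: "range A \<subseteq> S"
    have "W -` (\<Union>i. A i) \<inter> space P = (\<Union>i. W -` A i \<inter> space P)" by auto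
    also have "\<dots> \<in> sets P" using A by (intro sets.countable_UN) (auto simp: S_def)
    finally show "(\<Union>i. A i) \<in> S" using A by (auto simp: S_def)
  qed
  define Q where "Q = sigma D S"
  have Q: "space Q = D" "sets Q = S"
    unfolding Q_def using sigma_algebra.sets_measure_of_eq[OF sa] by (auto simp: space_measure_of_conv)
  have WQ: "W \<in> measurable P Q"
    by (rule measurableI) (use W Q in \<open>auto simp: S_def\<close>)
  interpret P: prob_space P by fact
  define N where "N = distr P Q W"
  have "prob_space N" unfolding N_def by (rule P.prob_space_distr[OF WQ])
  moreover have "space N = D" by (simp add: N_def Q)
  moreover have "f \<in> borel_measurable N \<and> integral\<^sup>L N f = (\<integral>\<omega>. f (W \<omega>) \<partial>P) \<and> distr N borel f = distr P borel (\<lambda>\<omega>. f (W \<omega>))"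
    if f: "(\<lambda>\<omega>. f (W \<omega>)) \<in> borel_measurable P" for f :: "_ \<Rightarrow> real"
  proof -
    have fQ: "f \<in> borel_measurable Q"
    proof (rule measurableI)
      fix B :: "real set" assume B: "B \<in> sets borel"
      have "W -` (f -` B \<inter> D) \<inter> space P = (\<lambda>\<omega>. f (W \<omega>)) -` B \<inter> space P" using W by auto
      also have "\<dots> \<in> sets P" using f B by (rule measurable_sets)
      finally show "f -` B \<inter> space Q \<in> sets Q" unfolding Q by (simp add: S_def)
    qed simp
    then show ?thesis unfolding N_def
      using WQ by (auto simp: integral_distr distr_distr comp_def)
  qed
  moreover have "AE x in N. x \<in> A" if "\<And>\<omega>. \<omega> \<in> space P \<Longrightarrow> W \<omega> \<in> A" for A
  proof -
    have "W -` (A \<inter> D) \<inter> space P = space P" using that W by auto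
    then have "A \<inter> D \<in> sets Q" unfolding Q by (simp add: S_def)
    moreover have "{x \<in> space Q. x \<in> A \<inter> D} = A \<inter> D" using Q(1) by auto
    ultimately have "AE x in N. x \<in> A \<inter> D"
      unfolding N_def by (subst AE_distr_iff[OF WQ]) (use that W in auto)
    then show ?thesis by eventually_elim simp
  qed
  ultimately show ?thesis using that by blast
qed

lemma skor_continuous_sup:
  assumes "skor_continuous g" "x \<in> Dspace" "0 < e"
  obtains \<delta> where "0 < \<delta>" "\<And>y c. y \<in> Dspace \<Longrightarrow> c < \<delta> \<Longrightarrow> (\<And>t. \<bar>x t - y t\<bar> \<le> c) \<Longrightarrow> \<bar>g y - g x\<bar> < e"
proof -
  from assms(1)[unfolded skor_continuous_def, rule_format, OF assms(2,3)]
  obtain \<delta> where \<delta>: "0 < \<delta>" "\<And>y. y \<in> Dspace \<Longrightarrow> skor_dist x y < \<delta> \<Longrightarrow> \<bar>g y - g x\<bar> < e" by blast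
  have "\<bar>g y - g x\<bar> < e" if "y \<in> Dspace" "c < \<delta>" "\<And>t. \<bar>x t - y t\<bar> \<le> c" for y c
    using skor_dist_le_uniform[of x y c, OF that(3)] that(2) by (intro \<delta>(2) that(1)) simp
  with \<delta>(1) that show ?thesis by blast
qed

lemma skor_continuous_uminus: "skor_continuous g \<Longrightarrow> skor_continuous (\<lambda>x. - g x)"
  unfolding skor_continuous_def by (simp add: abs_minus_commute)

lemma sum_power_le:
  fixes x :: real
  assumes "0 < x" "x < 1"
  shows "(\<Sum>i=m..<m + j. x ^ i) \<le> x ^ m / (1 - x)"
proof -
  have "(\<Sum>i=m..<m + j. x ^ i) = (x ^ m - x ^ (m + j)) / (1 - x)"
  proof (induction j)
    case (Suc j)
    have "(\<Sum>i=m..<m + Suc j. x ^ i) = (x ^ m - x ^ (m + j)) / (1 - x) + x ^ (m + j)"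
      using Suc by simp
    also have "\<dots> = (x ^ m - x ^ (m + Suc j)) / (1 - x)" using assms by (simp add: field_simps)
    finally show ?case .
  qed simp
  also have "\<dots> \<le> x ^ m / (1 - x)" using assms by (intro divide_right_mono) auto
  finally show ?thesis .
qed

section \<open>Interpolated processes and their almost sure limit\<close>

context empirical_setup
begin

definition V :: "nat \<Rightarrow> (nat \<times> ('d \<Rightarrow> nat) \<Rightarrow> real) \<Rightarrow> ereal^'d \<Rightarrow> real" where
  "V m z t = interp m z (uv t)"

lemma V_continuous: "continuous_on UNIV (V m z)"
proof -
  have "continuous_on UNIV (\<lambda>t. wt m l (uv t))" for l
    unfolding wt_def hat_def by (intro continuous_intros uv_continuous)
  then show ?thesis unfolding V_def[abs_def] interp_def by (intro continuous_intros)
qed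

lemma V_in_Dspace: "V m z \<in> Dspace"
  by (rule continuous_in_Dspace[OF V_continuous])

lemma V_lipschitz: "\<bar>V m z t - V m z' t\<bar> \<le> (\<Sum>s\<in>Pair m ` grid m. \<bar>z s - z' s\<bar>)"
  using interp_lipschitz[of m z "uv t" z'] unfolding V_def by (simp add: sum.reindex inj_on_def)

text \<open>In the uniform distance the interpolation depends continuously on finitely many grid
  values, so g becomes a continuous and hence measurable function of the family.\<close>

lemma continuous_on_g_V:
  assumes g: "skor_continuous g"
  shows "continuous_on UNIV (\<lambda>z. g (V m z))"
  unfolding continuous_on_def
proof (intro ballI tendstoI)
  fix z :: "nat \<times> ('d \<Rightarrow> nat) \<Rightarrow> real" and e :: real assume e: "0 < e"
  obtain \<delta> where \<delta>: "0 < \<delta>" "\<And>y c. y \<in> Dspace \<Longrightarrow> c < \<delta> \<Longrightarrow> (\<And>t. \<bar>V m z t - y t\<bar> \<le> c) \<Longrightarrow> \<bar>g y - g (V m z)\<bar> < e"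
    using skor_continuous_sup[OF g V_in_Dspace e] by blast
  have c: "continuous_on UNIV (\<lambda>y :: nat \<times> ('d \<Rightarrow> nat) \<Rightarrow> real. \<Sum>s\<in>Pair m ` grid m. \<bar>z s - y s\<bar>)"
    by (intro continuous_intros continuous_on_product_coordinates)
  have "((\<lambda>y. \<Sum>s\<in>Pair m ` grid m. \<bar>z s - y s\<bar>) \<longlongrightarrow> (\<Sum>s\<in>Pair m ` grid m. \<bar>z s - z s\<bar>)) (at z within UNIV)"
    using c unfolding continuous_on_def by blast
  then have "((\<lambda>y. \<Sum>s\<in>Pair m ` grid m. \<bar>z s - y s\<bar>) \<longlongrightarrow> 0) (at z within UNIV)" by simp
  from order_tendstoD(2)[OF this \<delta>(1)]
  show "\<forall>\<^sub>F y in at z within UNIV. dist (g (V m y)) (g (V m z)) < e"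
  proof eventually_elim
    case (elim y)
    show ?case unfolding dist_real_def
      by (rule \<delta>(2)[OF V_in_Dspace elim]) (rule V_lipschitz)
  qed
qed

text \<open>Chaining descends from the sandwich level k to the fixed level m. The top level enters
  twice through the sandwich; doubling the whole sum simplifies the bound.\<close>

lemma empirical_V_bound:
  assumes w: "\<omega> \<in> space M" and mk: "m \<le> k"
  shows "\<bar>empirical_process M X n \<omega> t - V m (Zn n \<omega>) t\<bar>
    \<le> 2 * (\<Sum>i=m..<Suc k. osc \<rho> p i (Zn n \<omega>)) + sqrt (real n) * (9 * real CARD('d) / 2 ^ k)"
proof -
  let ?o = "\<lambda>i. osc \<rho> p i (Zn n \<omega>)"
  have 1: "\<bar>empirical_process M X n \<omega> t - interp k (Zn n \<omega>) (uv t)\<bar> \<le> 2 * ?o k + sqrt (real n) * (9 * real CARD('d) / 2 ^ k)"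
    by (rule empirical_sandwich[OF w])
  have 2: "\<bar>interp k (Zn n \<omega>) (uv t) - interp m (Zn n \<omega>) (uv t)\<bar> \<le> (\<Sum>i=m..<k. ?o i)"
    using interp_osc_chain[OF uv_bounds[of t] rho(1) p_pos, of m "k - m" "Zn n \<omega>"] mk by simp
  have 3: "0 \<le> (\<Sum>i=m..<k. ?o i)" using osc_nonneg[OF rho(1)] by (intro sum_nonneg)
  have "(\<Sum>i=m..<Suc k. ?o i) = (\<Sum>i=m..<k. ?o i) + ?o k" using mk by simp
  then show ?thesis unfolding V_def using 1 2 3 by linarith
qed

text \<open>Geometrically decaying expectations make the series of all \<open>osc\<close> almost
  surely finite, and its tails are rates of convergence uniform in t. On the exceptional set the
  limit is replaced by 0, so that every path is continuous.\<close>

lemma limit_process: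
  fixes P :: "'w measure" and Z :: "nat \<times> ('d \<Rightarrow> nat) \<Rightarrow> 'w \<Rightarrow> real"
  assumes P: "prob_space P" and Zm: "\<And>s. Z s \<in> borel_measurable P"
    and oi: "\<And>k. integrable P (\<lambda>\<omega>. osc \<rho> p k (\<lambda>s. Z s \<omega>))"
    and ob: "\<And>k. (\<integral>\<omega>. osc \<rho> p k (\<lambda>s. Z s \<omega>) \<partial>P) \<le> K * \<rho> ^ k"
  obtains A W where "A \<in> sets P" "AE \<omega> in P. \<omega> \<in> A"
    "\<And>\<omega>. \<omega> \<in> A \<Longrightarrow> \<exists>R. R \<longlonglongrightarrow> 0 \<and> (\<forall>m t. \<bar>V m (\<lambda>s. Z s \<omega>) t - W \<omega> t\<bar> \<le> R m)"
    "\<And>\<omega>. \<omega> \<notin> A \<Longrightarrow> W \<omega> = (\<lambda>_. 0)" "\<And>\<omega>. continuous_on UNIV (W \<omega>)"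
proof -
  interpret P: prob_space P by fact
  let ?z = "\<lambda>\<omega> s. Z s \<omega>"
  let ?o = "\<lambda>k \<omega>. osc \<rho> p k (?z \<omega>)"
  have o0: "0 \<le> ?o k \<omega>" for k \<omega> by (rule osc_nonneg[OF rho(1)])
  have om: "?o k \<in> borel_measurable P" for k using oi by (rule borel_measurable_integrable)
  have "(\<integral>\<^sup>+\<omega>. (\<Sum>k. ennreal (?o k \<omega>)) \<partial>P) = (\<Sum>k. \<integral>\<^sup>+\<omega>. ennreal (?o k \<omega>) \<partial>P)"
    using om by (intro nn_integral_suminf) auto
  also have "\<dots> \<le> (\<Sum>k. ennreal (K * \<rho> ^ k))"
    using oi ob o0 by (intro suminf_le summableI) (simp add: nn_integral_eq_integral ennreal_leI)
  also have "\<dots> = ennreal (\<Sum>k. K * \<rho> ^ k)"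
  proof (rule suminf_ennreal_eq)
    have K: "0 \<le> K"
    proof -
      have "0 \<le> (\<integral>\<omega>. ?o 0 \<omega> \<partial>P)" by (rule Bochner_Integration.integral_nonneg) (rule o0)
      then show ?thesis using ob[of 0] by simp
    qed
    then show "0 \<le> K * \<rho> ^ k" for k using rho by simp
    show "(\<lambda>k. K * \<rho> ^ k) sums (\<Sum>k. K * \<rho> ^ k)"
      using rho by (intro summable_sums summable_mult summable_geometric) auto
  qed
  finally have "(\<integral>\<^sup>+\<omega>. (\<Sum>k. ennreal (?o k \<omega>)) \<partial>P) < \<infinity>" by (rule le_less_trans) simp
  then have "AE \<omega> in P. (\<Sum>k. ennreal (?o k \<omega>)) \<noteq> \<infinity>"
    using om by (intro nn_integral_PInf_AE) auto
  then have "AE \<omega> in P. summable (\<lambda>k. ?o k \<omega>)"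
    by eventually_elim (rule summable_suminf_not_top, use o0 in auto)
  \<comment> \<open>A measurable null set is fixed, so that its complement \<open>A\<close> can
    enter measurability arguments.\<close>
  then obtain N0 where N0: "{\<omega> \<in> space P. \<not> summable (\<lambda>k. ?o k \<omega>)} \<subseteq> N0" "emeasure P N0 = 0" "N0 \<in> sets P"
    by (rule AE_E)
  define A where "A = space P - N0"
  have As: "A \<in> sets P" using N0 by (simp add: A_def)
  have AE_A: "AE \<omega> in P. \<omega> \<in> A"
    by (rule AE_I[where N=N0]) (use N0 in \<open>auto simp: A_def\<close>)
  have sm: "summable (\<lambda>k. ?o k \<omega>)" if "\<omega> \<in> A" for \<omega> using that N0(1) by (auto simp: A_def)
  define W where "W \<omega> t = (if \<omega> \<in> A then lim (\<lambda>m. V m (?z \<omega>) t) else 0)" for \<omega> t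
  have R: "\<exists>R. R \<longlonglongrightarrow> 0 \<and> (\<forall>m t. \<bar>V m (?z \<omega>) t - W \<omega> t\<bar> \<le> R m)" if w: "\<omega> \<in> A" for \<omega>
  proof (intro exI conjI allI)
    let ?R = "\<lambda>m. \<Sum>k. ?o (k + m) \<omega>"
    show "?R \<longlonglongrightarrow> 0" by (rule suminf_exist_split2[OF sm[OF w]])
    fix m t
    have step: "\<bar>V (Suc m) (?z \<omega>) t - V m (?z \<omega>) t\<bar> \<le> ?o m \<omega>" for m
      unfolding V_def by (rule interp_osc_step[OF uv_bounds rho(1) p_pos])
    have "summable (\<lambda>m. V (Suc m) (?z \<omega>) t - V m (?z \<omega>) t)"
      by (rule summable_comparison_test[OF _ sm[OF w]]) (use step in auto)
    from tendsto_add[OF summable_LIMSEQ[OF this] tendsto_const[of "V 0 (?z \<omega>) t"]]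
    have "(\<lambda>m. V m (?z \<omega>) t) \<longlonglongrightarrow> (\<Sum>m. V (Suc m) (?z \<omega>) t - V m (?z \<omega>) t) + V 0 (?z \<omega>) t"
      unfolding sum_lessThan_telescope[of "\<lambda>i. V i (?z \<omega>) t"] by simp
    then have "convergent (\<lambda>m. V m (?z \<omega>) t)" by (rule convergentI)
    then have lim: "(\<lambda>m. V m (?z \<omega>) t) \<longlonglongrightarrow> W \<omega> t"
      using w by (simp add: W_def convergent_LIMSEQ_iff)
    have "\<bar>V (m + i) (?z \<omega>) t - V m (?z \<omega>) t\<bar> \<le> ?R m" for i
    proof -
      have "\<bar>V (m + i) (?z \<omega>) t - V m (?z \<omega>) t\<bar> \<le> (\<Sum>k=m..<m + i. ?o k \<omega>)"
        unfolding V_def by (rule interp_osc_chain[OF uv_bounds rho(1) p_pos])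
      also have "\<dots> = (\<Sum>k<i. ?o (k + m) \<omega>)"
        by (rule sum.reindex_bij_witness[of _ "\<lambda>k. k + m" "\<lambda>k. k - m"]) auto
      also have "\<dots> \<le> ?R m"
        using o0 by (intro sum_le_suminf summable_ignore_initial_segment[OF sm[OF w]]) auto
      finally show ?thesis .
    qed
    moreover have "(\<lambda>i. \<bar>V (m + i) (?z \<omega>) t - V m (?z \<omega>) t\<bar>) \<longlonglongrightarrow> \<bar>W \<omega> t - V m (?z \<omega>) t\<bar>"
      using LIMSEQ_ignore_initial_segment[OF lim, of m] by (intro tendsto_intros) (simp add: add.commute)
    ultimately have "\<bar>W \<omega> t - V m (?z \<omega>) t\<bar> \<le> ?R m" by (intro LIMSEQ_le_const2) auto
    then show "\<bar>V m (?z \<omega>) t - W \<omega> t\<bar> \<le> ?R m" by (simp add: abs_minus_commute)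
  qed
  have W0: "W \<omega> = (\<lambda>_. 0)" if "\<omega> \<notin> A" for \<omega> using that by (auto simp: W_def)
  have "continuous_on UNIV (W \<omega>)" for \<omega>
  proof (cases "\<omega> \<in> A")
    case True
    then obtain R where R': "R \<longlonglongrightarrow> 0" "\<And>m t. \<bar>V m (?z \<omega>) t - W \<omega> t\<bar> \<le> R m" using R by blast
    have "uniform_limit UNIV (\<lambda>m. V m (?z \<omega>)) (W \<omega>) sequentially"
    proof (rule uniform_limitI)
      fix e :: real assume "0 < e"
      from order_tendstoD(2)[OF R'(1) this]
      show "\<forall>\<^sub>F m in sequentially. \<forall>t\<in>UNIV. dist (V m (?z \<omega>) t) (W \<omega> t) < e"
        by eventually_elim (use R'(2) in \<open>auto simp: dist_real_def intro: le_less_trans\<close>)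
    qed
    then show ?thesis by (rule uniform_limit_theorem[rotated]) (simp_all add: V_continuous)
  next
    case False
    then show ?thesis using W0 by simp
  qed
  then show ?thesis using that[OF As AE_A R W0] by blast
qed

end

section \<open>Convergence\<close>

lemma exists_dyadic:
  fixes x :: real
  assumes "1 \<le> x"
  shows "\<exists>k. x \<le> 2 ^ k \<and> 2 ^ k \<le> 2 * x"
proof -
  have ex: "\<exists>k. x \<le> 2 ^ k" using real_arch_pow[of 2 x] less_imp_le by auto
  define k where "k = (LEAST k. x \<le> 2 ^ k)"
  have k: "x \<le> 2 ^ k" unfolding k_def using ex by (rule LeastI_ex)
  have "2 ^ k \<le> 2 * x"
  proof (cases k)
    case 0 then show ?thesis using assms by simp
  next
    case (Suc j)
    then have "\<not> x \<le> 2 ^ j" using not_less_Least[of j "\<lambda>k. x \<le> 2 ^ k"] unfolding k_def by simp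
    then show ?thesis using Suc by simp
  qed
  with k show ?thesis by blast
qed

text \<open>Isolates the properties of the Gaussian family on which convergence rests from its
  construction.\<close>

locale empirical_limit = empirical_setup +
  fixes P :: "(nat \<Rightarrow> real) measure" and Z :: "nat \<times> ('b \<Rightarrow> nat) \<Rightarrow> (nat \<Rightarrow> real) \<Rightarrow> real"
  assumes P: "prob_space P" and Zm: "\<And>s. Z s \<in> borel_measurable P"
    and gauss: "\<And>S c. finite S \<Longrightarrow> \<exists>\<sigma>\<ge>0. distr P borel (\<lambda>\<omega>. \<Sum>s\<in>S. c s * Z s \<omega>) = normal_law \<sigma>"
    and wc: "\<And>S c. finite S \<Longrightarrow> weak_conv_m (\<lambda>n. distr M borel (\<lambda>\<omega>. \<Sum>s\<in>S. c s * Zn n \<omega> s))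
        (distr P borel (\<lambda>\<omega>. \<Sum>s\<in>S. c s * Z s \<omega>))"
begin

sublocale P: prob_space P by (rule P)

abbreviation z where "z \<omega> \<equiv> (\<lambda>s. Z s \<omega>)"

text \<open>At a fixed level k the bound on link moments holds with D = 1 for all n \<ge> 4^k, so it
  passes to the weak limit. Every level is reached in this way, which permits chaining to infinite
  depth in the limit family.\<close>

lemma limit_osc: "\<exists>K. \<forall>k. integrable P (\<lambda>\<omega>. osc \<rho> p k (z \<omega>)) \<and> (\<integral>\<omega>. osc \<rho> p k (z \<omega>) \<partial>P) \<le> K * \<rho> ^ k"
proof -
  obtain K where K: "0 \<le> K" "\<forall>k n a b D. (a, b) \<in> links k \<longrightarrow> 1 \<le> n \<longrightarrow> 1 \<le> D \<longrightarrow> 4 ^ k \<le> D * real n \<longrightarrow>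
     (\<integral>\<omega>. \<bar>Zn n \<omega> a - Zn n \<omega> b\<bar> ^ (2 * p) \<partial>M) \<le> K * D ^ p * 2 powr (- (real k * (real CARD('b) + \<eta>)))"
    using bump_link_moment by blast
  have "integrable P (\<lambda>\<omega>. \<bar>Z a \<omega> - Z b \<omega>\<bar> ^ (2 * p)) \<and>
     (\<integral>\<omega>. \<bar>Z a \<omega> - Z b \<omega>\<bar> ^ (2 * p) \<partial>P) \<le> K * 2 powr (- (real k * (real CARD('b) + \<eta>)))"
    if ab: "(a, b) \<in> links k" for a b k
  proof (cases "a = b")
    case True
    then show ?thesis using K(1) p_pos by (simp add: power_0_left)
  next
    case False
    define c where "c x = (if x = a then 1 else - 1 :: real)" for x
    have 1: "(\<Sum>s\<in>{a, b}. c s * Zn n \<omega> s) = Zn n \<omega> a - Zn n \<omega> b" for n \<omega> using False by (simp add: c_def)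
    have 2: "(\<Sum>s\<in>{a, b}. c s * Z s \<omega>) = Z a \<omega> - Z b \<omega>" for \<omega> using False by (simp add: c_def)
    have w: "weak_conv_m (\<lambda>n. distr M borel (\<lambda>\<omega>. Zn n \<omega> a - Zn n \<omega> b)) (distr P borel (\<lambda>\<omega>. Z a \<omega> - Z b \<omega>))"
      using wc[of "{a, b}" c] unfolding 1 2 by simp
    have ev: "\<forall>\<^sub>F n in sequentially. (\<integral>\<omega>. \<bar>Zn n \<omega> a - Zn n \<omega> b\<bar> ^ (2 * p) \<partial>M) \<le> K * 2 powr (- (real k * (real CARD('b) + \<eta>)))"
      using eventually_ge_at_top[of "4 ^ k"]
    proof eventually_elim
      case (elim n)
      then have "real (4 ^ k) \<le> real n" by (simp only: of_nat_le_iff)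
      then have "4 ^ k \<le> 1 * real n" by simp
      moreover have "1 \<le> n"
      proof -
        have "(0::nat) < 4 ^ k" by simp
        then show ?thesis using elim by linarith
      qed
      ultimately show ?case using K(2)[rule_format, OF ab, of n 1] by simp
    qed
    have mz: "(\<lambda>\<omega>. Z a \<omega> - Z b \<omega>) \<in> borel_measurable P" using Zm by (intro borel_measurable_diff)
    have mn: "(\<lambda>\<omega>. Zn n \<omega> a - Zn n \<omega> b) \<in> borel_measurable M" for n by measurable
    have K0: "0 \<le> K * 2 powr (- (real k * (real CARD('b) + \<eta>)))" using K(1) by simp
    show ?thesis
      using weak_conv_moment_bound[OF prob_space_axioms P mn mz w Zn_diff_integrable ev K0] by simp
  qed
  then have "integrable P (\<lambda>\<omega>. osc \<rho> p k (z \<omega>)) \<and> (\<integral>\<omega>. osc \<rho> p k (z \<omega>) \<partial>P) \<le> (1 + 2 * 68 ^ CARD('b) * K) * \<rho> ^ k" for k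
    using osc_expectation_le[where Z="\<lambda>\<omega> s. Z s \<omega>" and Q=P and k=k and K=K, OF _ _ P K(1)] by simp
  then show ?thesis by blast
qed

text \<open>The joint characteristic function at c is that of the combination with coefficients c at
  the point 1, and the latter converges by Levy's continuity theorem.\<close>

lemma lipschitz_limit:
  assumes fin: "finite S" and B: "\<And>y. \<bar>h y\<bar> \<le> B" and L: "0 \<le> L"
    and lip: "\<And>x y. \<bar>h x - h y\<bar> \<le> L * (\<Sum>s\<in>S. \<bar>x s - y s\<bar>)"
  shows "(\<lambda>n. \<integral>\<omega>. h (Zn n \<omega>) \<partial>M) \<longlonglongrightarrow> (\<integral>\<omega>. h (z \<omega>) \<partial>P)"
proof (rule lipschitz_expectation_convergence[OF prob_space_axioms P fin Zn_measurable Zm _ B lip L])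
  fix c
  have m1: "(\<lambda>\<omega>. \<Sum>s\<in>S. c s * Zn n \<omega> s) \<in> borel_measurable M" for n by measurable
  have m2: "(\<lambda>\<omega>. \<Sum>s\<in>S. c s * Z s \<omega>) \<in> borel_measurable P"
    using Zm by (intro borel_measurable_sum borel_measurable_times borel_measurable_const)
  have "(\<lambda>n. char (distr M borel (\<lambda>\<omega>. \<Sum>s\<in>S. c s * Zn n \<omega> s)) 1) \<longlonglongrightarrow> char (distr P borel (\<lambda>\<omega>. \<Sum>s\<in>S. c s * Z s \<omega>)) 1"
    by (rule levy_continuity1[OF real_distribution_distr[OF m1] P.real_distribution_distr[OF m2] wc[OF fin]])
  then show "(\<lambda>n. \<integral>\<omega>. iexp (\<Sum>s\<in>S. c s * Zn n \<omega> s) \<partial>M) \<longlonglongrightarrow> (\<integral>\<omega>. iexp (\<Sum>s\<in>S. c s * Z s \<omega>) \<partial>P)"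
    unfolding char_distr_borel[OF m1] char_distr_borel[OF m2] by simp
qed

context
  fixes A and W
  assumes A: "A \<in> sets P" "AE \<omega> in P. \<omega> \<in> A"
    and R: "\<And>\<omega>. \<omega> \<in> A \<Longrightarrow> \<exists>R. R \<longlonglongrightarrow> 0 \<and> (\<forall>m t. \<bar>V m (z \<omega>) t - W \<omega> t\<bar> \<le> R m)"
    and W0: "\<And>\<omega>. \<omega> \<notin> A \<Longrightarrow> W \<omega> = (\<lambda>_. 0)" and W: "\<And>\<omega>. continuous_on UNIV (W \<omega>)"
begin

lemma W_in_Dspace: "W \<omega> \<in> Dspace"
  by (rule continuous_in_Dspace[OF W])

text \<open>For fixed m the composition is continuous in a countable family of random variables. Off
  \<open>A\<close> the value at the zero path is inserted, so that convergence holds at every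
  point.\<close>

lemma measurable_functional_W:
  fixes f :: "(ereal^'b \<Rightarrow> real) \<Rightarrow> real"
  assumes f: "\<And>m. continuous_on UNIV (\<lambda>y. f (V m y))"
    and lim: "\<And>\<omega>. \<omega> \<in> A \<Longrightarrow> (\<lambda>m. f (V m (z \<omega>))) \<longlonglongrightarrow> f (W \<omega>)"
  shows "(\<lambda>\<omega>. f (W \<omega>)) \<in> borel_measurable P"
    and "(\<lambda>\<omega>. f (V m (z \<omega>))) \<in> borel_measurable P"
proof -
  show m: "(\<lambda>\<omega>. f (V m (z \<omega>))) \<in> borel_measurable P" for m
    by (rule borel_measurable_continuous_family[OF f Zm])
  show "(\<lambda>\<omega>. f (W \<omega>)) \<in> borel_measurable P"
  proof (rule borel_measurable_LIMSEQ_real)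
    show "(\<lambda>\<omega>. if \<omega> \<in> A then f (V m (z \<omega>)) else f (\<lambda>_. 0)) \<in> borel_measurable P" for m
      using m A by (intro measurable_If_set) (auto simp: sets.Int_space_eq2)
    show "(\<lambda>m. if \<omega> \<in> A then f (V m (z \<omega>)) else f (\<lambda>_. 0)) \<longlonglongrightarrow> f (W \<omega>)" for \<omega>
      using lim W0 by (cases "\<omega> \<in> A") auto
  qed
qed

lemma W_coordinate: "\<omega> \<in> A \<Longrightarrow> (\<lambda>m. V m (z \<omega>) t) \<longlonglongrightarrow> W \<omega> t"
proof -
  assume "\<omega> \<in> A"
  then obtain R' where R': "R' \<longlonglongrightarrow> 0" "\<And>m t. \<bar>V m (z \<omega>) t - W \<omega> t\<bar> \<le> R' m" using R by blast
  have "(\<lambda>m. V m (z \<omega>) t - W \<omega> t) \<longlonglongrightarrow> 0"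
    by (rule Lim_null_comparison[OF _ R'(1)]) (use R'(2) in auto)
  then show ?thesis by (rule LIM_zero_cancel)
qed

lemma W_coordinate_measurable: "(\<lambda>\<omega>. W \<omega> t) \<in> borel_measurable P"
proof (rule measurable_functional_W(1)[where f="\<lambda>x. x t"])
  show "continuous_on UNIV (\<lambda>y. V m y t)" for m
    by (rule continuous_on_lipschitz_finite_coordinates[where L=1 and S="Pair m ` grid m"])
      (use V_lipschitz in simp)
qed (rule W_coordinate)

text \<open>A finite combination of values of \<open>V m\<close> is a finite combination of the
  family, hence normal; normality survives the almost sure limit.\<close>

lemma W_gaussian:
  assumes T: "finite T"
  shows "\<exists>\<sigma>\<ge>0. distr P borel (\<lambda>\<omega>. \<Sum>t\<in>T. c t * W \<omega> t) = normal_law \<sigma>"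
proof (rule AE_limit_normal_law[OF P])
  have eq: "(\<Sum>t\<in>T. c t * V m (z \<omega>) t) = (\<Sum>s\<in>Pair m ` grid m. (\<Sum>t\<in>T. c t * wt m (snd s) (uv t)) * Z s \<omega>)" for m \<omega>
  proof -
    have "(\<Sum>t\<in>T. c t * V m (z \<omega>) t) = (\<Sum>t\<in>T. \<Sum>l\<in>grid m. c t * wt m l (uv t) * Z (m, l) \<omega>)"
      by (simp add: V_def interp_def sum_distrib_left mult.assoc)
    also have "\<dots> = (\<Sum>l\<in>grid m. (\<Sum>t\<in>T. c t * wt m l (uv t)) * Z (m, l) \<omega>)"
      by (subst sum.swap) (simp add: sum_distrib_right)
    finally show ?thesis by (simp add: sum.reindex inj_on_def)
  qed
  show "(\<lambda>\<omega>. \<Sum>t\<in>T. c t * V m (z \<omega>) t) \<in> borel_measurable P" for m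
    unfolding eq using Zm by (intro borel_measurable_sum borel_measurable_times borel_measurable_const)
  show "\<exists>\<sigma>\<ge>0. distr P borel (\<lambda>\<omega>. \<Sum>t\<in>T. c t * V m (z \<omega>) t) = normal_law \<sigma>" for m
    unfolding eq by (rule gauss) (simp add: finite_grid)
  show "(\<lambda>\<omega>. \<Sum>t\<in>T. c t * W \<omega> t) \<in> borel_measurable P"
    using W_coordinate_measurable by (intro borel_measurable_sum borel_measurable_times borel_measurable_const)
  show "AE \<omega> in P. (\<lambda>m. \<Sum>t\<in>T. c t * V m (z \<omega>) t) \<longlonglongrightarrow> (\<Sum>t\<in>T. c t * W \<omega> t)"
    using A(2) by eventually_elim (intro tendsto_sum tendsto_mult tendsto_const W_coordinate)
qed

lemma skor_continuous_W:
  assumes g: "skor_continuous g" and w: "\<omega> \<in> A"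
  shows "(\<lambda>m. g (V m (z \<omega>))) \<longlonglongrightarrow> g (W \<omega>)"
proof (rule tendstoI)
  fix e :: real assume e: "0 < e"
  obtain R' where R': "R' \<longlonglongrightarrow> 0" "\<And>m t. \<bar>V m (z \<omega>) t - W \<omega> t\<bar> \<le> R' m" using R[OF w] by blast
  obtain \<delta> where \<delta>: "0 < \<delta>" "\<And>y c. y \<in> Dspace \<Longrightarrow> c < \<delta> \<Longrightarrow> (\<And>t. \<bar>W \<omega> t - y t\<bar> \<le> c) \<Longrightarrow> \<bar>g y - g (W \<omega>)\<bar> < e"
    using skor_continuous_sup[OF g W_in_Dspace e] by blast
  from order_tendstoD(2)[OF R'(1) \<delta>(1)]
  show "\<forall>\<^sub>F m in sequentially. dist (g (V m (z \<omega>))) (g (W \<omega>)) < e"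
  proof eventually_elim
    case (elim m)
    show ?case unfolding dist_real_def
      by (rule \<delta>(2)[OF V_in_Dspace elim]) (use R'(2)[of m] in \<open>simp add: abs_minus_commute\<close>)
  qed
qed

lemma g_W_measurable:
  assumes g: "skor_continuous g" shows "(\<lambda>\<omega>. g (W \<omega>)) \<in> borel_measurable P"
  by (rule measurable_functional_W(1)[OF continuous_on_g_V[OF g] skor_continuous_W[OF g]])

section \<open>Lower bounds through Lipschitz functionals\<close>

context
  fixes g :: "(ereal^'b \<Rightarrow> real) \<Rightarrow> real" and B :: real
  assumes g: "skor_continuous g" and B: "\<And>x. x \<in> Dspace \<Longrightarrow> \<bar>g x\<bar> \<le> B"
begin

lemma lip_reg_V_lipschitz:
  assumes k: "0 \<le> k"
  shows "\<bar>lip_reg g k (V m y) - lip_reg g k (V m y')\<bar> \<le> k * (\<Sum>s\<in>Pair m ` grid m. \<bar>y s - y' s\<bar>)"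
  by (rule lip_reg_lipschitz[OF B k V_in_Dspace V_in_Dspace]) (auto intro: V_lipschitz)

lemma lip_reg_V_continuous: "0 \<le> k \<Longrightarrow> continuous_on UNIV (\<lambda>y. lip_reg g k (V m y))"
  by (rule continuous_on_lipschitz_finite_coordinates) (rule lip_reg_V_lipschitz)

lemma lip_reg_V_W:
  assumes k: "0 \<le> k" and w: "\<omega> \<in> A"
  shows "(\<lambda>m. lip_reg g k (V m (z \<omega>))) \<longlonglongrightarrow> lip_reg g k (W \<omega>)"
proof -
  obtain R' where R': "R' \<longlonglongrightarrow> 0" "\<And>m t. \<bar>V m (z \<omega>) t - W \<omega> t\<bar> \<le> R' m" using R[OF w] by blast
  have "(\<lambda>m. lip_reg g k (V m (z \<omega>)) - lip_reg g k (W \<omega>)) \<longlonglongrightarrow> 0"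
  proof (rule Lim_null_comparison)
    show "\<forall>\<^sub>F m in sequentially. norm (lip_reg g k (V m (z \<omega>)) - lip_reg g k (W \<omega>)) \<le> k * R' m"
    proof (intro always_eventually allI)
      fix m
      show "norm (lip_reg g k (V m (z \<omega>)) - lip_reg g k (W \<omega>)) \<le> k * R' m"
        unfolding real_norm_def by (rule lip_reg_lipschitz[OF B k V_in_Dspace W_in_Dspace R'(2)])
    qed
    show "(\<lambda>m. k * R' m) \<longlonglongrightarrow> 0" using tendsto_mult_right_zero[OF R'(1)] .
  qed
  then show ?thesis by (rule LIM_zero_cancel)
qed

lemma lip_reg_W_measurable:
  assumes "0 \<le> k"
  shows "(\<lambda>\<omega>. lip_reg g k (W \<omega>)) \<in> borel_measurable P" "(\<lambda>\<omega>. lip_reg g k (V m (z \<omega>))) \<in> borel_measurable P"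
  using measurable_functional_W[where f="lip_reg g k", OF lip_reg_V_continuous lip_reg_V_W] assms by auto

text \<open>Four errors of at most e / 4 each: regularising g, interpolating \<open>W\<close>, the
  weak convergence at level m, and chaining together with the sandwich bias. The order of choices
  matters: k fixes a, a fixes D and c, these fix m, and only then is n taken large.\<close>

lemma empirical_lower_bound:
  assumes e: "0 < e"
  shows "\<forall>\<^sub>F n in sequentially. (\<integral>\<omega>. g (W \<omega>) \<partial>P) - e \<le> (\<integral>\<omega>. g (empirical_process M X n \<omega>) \<partial>M)"
proof -
  have b: "\<bar>lip_reg g (real k) x\<bar> \<le> B" if "x \<in> Dspace" for k x
    by (rule lip_reg_bound[OF B _ that]) auto
  have "(\<lambda>k. \<integral>\<omega>. lip_reg g (real k) (W \<omega>) \<partial>P) \<longlonglongrightarrow> (\<integral>\<omega>. g (W \<omega>) \<partial>P)"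
  proof (rule integral_dominated_convergence[where w="\<lambda>_. B"])
    show "AE \<omega> in P. (\<lambda>k. lip_reg g (real k) (W \<omega>)) \<longlonglongrightarrow> g (W \<omega>)"
      by (intro AE_I2 lip_reg_tendsto[OF B g W_in_Dspace])
  qed (use g_W_measurable[OF g] lip_reg_W_measurable(1) b W_in_Dspace in auto)
  then have "\<forall>\<^sub>F k in sequentially. dist (\<integral>\<omega>. lip_reg g (real k) (W \<omega>) \<partial>P) (\<integral>\<omega>. g (W \<omega>) \<partial>P) < e / 4"
    using e by (intro tendstoD) auto
  then obtain k where k: "dist (\<integral>\<omega>. lip_reg g (real k) (W \<omega>) \<partial>P) (\<integral>\<omega>. g (W \<omega>) \<partial>P) < e / 4"
    using eventually_happens by force
  let ?l = "lip_reg g (real k)"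
  obtain K where K: "0 \<le> K" "\<forall>i n D. 1 \<le> n \<longrightarrow> 1 \<le> D \<longrightarrow> 4 ^ i \<le> D * real n \<longrightarrow>
     integrable M (\<lambda>\<omega>. osc \<rho> p i (Zn n \<omega>)) \<and> (\<integral>\<omega>. osc \<rho> p i (Zn n \<omega>) \<partial>M) \<le> (1 + K * D ^ p) * \<rho> ^ i"
    using osc_Zn_expectation by blast
  define d where "d = real CARD('b)"
  \<comment> \<open>72 = 8 * 9: for 2^q \<ge> a sqrt n the bias is at most 9 d / a, and k times this
    must not exceed e / 8.\<close>
  define a where "a = max 1 (72 * real k * d / e)"
  have a: "1 \<le> a" "real k * (9 * d / a) \<le> e / 8"
  proof -
    show "1 \<le> a" by (simp add: a_def)
    have "72 * real k * d / e \<le> a" by (simp add: a_def)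
    then have "72 * real k * d \<le> a * e" using e by (simp add: divide_le_eq)
    then show "real k * (9 * d / a) \<le> e / 8" using \<open>1 \<le> a\<close> by (simp add: field_simps)
  qed
  \<comment> \<open>The last level will satisfy 2^q \<le> 2 a sqrt n, hence 4^q \<le> 4 a^2
    n.\<close>
  define D where "D = 4 * a\<^sup>2"
  have "1 \<le> a\<^sup>2" using a(1) by simp
  then have D: "1 \<le> D" by (simp add: D_def)
  define c where "c = 1 + K * D ^ p"
  have "(\<lambda>m. real k * (2 * (c * (\<rho> ^ m / (1 - \<rho>))))) \<longlonglongrightarrow> real k * (2 * (c * (0 / (1 - \<rho>))))"
    using rho by (intro tendsto_intros LIMSEQ_power_zero) auto
  then have ev1: "\<forall>\<^sub>F m in sequentially. real k * (2 * (c * (\<rho> ^ m / (1 - \<rho>)))) < e / 8"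
    using e by (intro order_tendstoD(2)) auto
  have "(\<lambda>m. \<integral>\<omega>. ?l (V m (z \<omega>)) \<partial>P) \<longlonglongrightarrow> (\<integral>\<omega>. ?l (W \<omega>) \<partial>P)"
  proof (rule integral_dominated_convergence[where w="\<lambda>_. B"])
    show "AE \<omega> in P. (\<lambda>m. ?l (V m (z \<omega>))) \<longlonglongrightarrow> ?l (W \<omega>)"
      using A(2) by eventually_elim (rule lip_reg_V_W, auto)
  qed (use lip_reg_W_measurable b V_in_Dspace in auto)
  then have "\<forall>\<^sub>F m in sequentially. dist (\<integral>\<omega>. ?l (V m (z \<omega>)) \<partial>P) (\<integral>\<omega>. ?l (W \<omega>) \<partial>P) < e / 4"
    using e by (intro tendstoD) auto
  from eventually_happens[OF eventually_conj[OF ev1 this]] obtain m where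
    m: "real k * (2 * (c * (\<rho> ^ m / (1 - \<rho>)))) < e / 8"
      "dist (\<integral>\<omega>. ?l (V m (z \<omega>)) \<partial>P) (\<integral>\<omega>. ?l (W \<omega>) \<partial>P) < e / 4"
    by auto
  have "(\<lambda>n. \<integral>\<omega>. ?l (V m (Zn n \<omega>)) \<partial>M) \<longlonglongrightarrow> (\<integral>\<omega>. ?l (V m (z \<omega>)) \<partial>P)"
    by (rule lipschitz_limit[where S="Pair m ` grid m" and B=B and L="real k"])
      (auto simp: finite_grid b V_in_Dspace intro: lip_reg_V_lipschitz)
  then have "\<forall>\<^sub>F n in sequentially. dist (\<integral>\<omega>. ?l (V m (Zn n \<omega>)) \<partial>M) (\<integral>\<omega>. ?l (V m (z \<omega>)) \<partial>P) < e / 4"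
    using e by (intro tendstoD) auto
  then show ?thesis
    using eventually_ge_at_top[of "4 ^ m"]
  proof eventually_elim
    case (elim n)
    have "(0::nat) < 4 ^ m" by simp
    then have n1: "1 \<le> n" using elim(2) by linarith
    have "real (4 ^ m) \<le> real n" using elim(2) by (simp only: of_nat_le_iff)
    moreover have "((2::real) ^ m)\<^sup>2 = real (4 ^ m)" by (simp add: power2_eq_square flip: power_mult_distrib)
    ultimately have sq: "2 ^ m \<le> sqrt (real n)" by (intro real_le_rsqrt) simp
    have s1: "1 \<le> sqrt (real n)" using n1 by simp
    have "1 * 1 \<le> a * sqrt (real n)" using a s1 by (intro mult_mono) auto
    then obtain q where q: "a * sqrt (real n) \<le> 2 ^ q" "2 ^ q \<le> 2 * (a * sqrt (real n))"
      using exists_dyadic[of "a * sqrt (real n)"] by auto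
    \<comment> \<open>Here n \<ge> 4^m enters: the last level has to lie above m for a chain between
      them to exist.\<close>
    have mq: "m \<le> q"
    proof -
      have "2 ^ m \<le> a * sqrt (real n)" using mult_mono[OF a(1) sq] a by simp
      then have "(2::real) ^ m \<le> 2 ^ q" using q(1) by linarith
      then show ?thesis by simp
    qed
    have osc: "integrable M (\<lambda>\<omega>. osc \<rho> p i (Zn n \<omega>))" "(\<integral>\<omega>. osc \<rho> p i (Zn n \<omega>) \<partial>M) \<le> c * \<rho> ^ i"
      if i: "i \<le> q" for i
    proof -
      have "(4::real) ^ i \<le> 4 ^ q" using i by (intro power_increasing) auto
      also have "(4::real) ^ q = (2 ^ q)\<^sup>2" by (simp add: power2_eq_square flip: power_mult_distrib)
      also have "\<dots> \<le> (2 * (a * sqrt (real n)))\<^sup>2" by (intro power_mono q) auto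
      also have "\<dots> = D * real n" by (simp add: D_def power_mult_distrib)
      finally have "4 ^ i \<le> D * real n" .
      with K(2) n1 D show "integrable M (\<lambda>\<omega>. osc \<rho> p i (Zn n \<omega>))" "(\<integral>\<omega>. osc \<rho> p i (Zn n \<omega>) \<partial>M) \<le> c * \<rho> ^ i"
        unfolding c_def by blast+
    qed
    define E where "E \<omega> = 2 * (\<Sum>i=m..<Suc q. osc \<rho> p i (Zn n \<omega>)) + sqrt (real n) * (9 * d / 2 ^ q)" for \<omega>
    have Ei: "integrable M E"
      unfolding E_def using osc(1)
      by (intro Bochner_Integration.integrable_add integrable_mult_right Bochner_Integration.integrable_sum) auto
    have EE: "(\<integral>\<omega>. E \<omega> \<partial>M) \<le> 2 * (c * (\<rho> ^ m / (1 - \<rho>))) + 9 * d / a"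
    proof -
      have "(\<integral>\<omega>. (\<Sum>i=m..<Suc q. osc \<rho> p i (Zn n \<omega>)) \<partial>M) = (\<Sum>i=m..<Suc q. \<integral>\<omega>. osc \<rho> p i (Zn n \<omega>) \<partial>M)"
        using osc(1) by (intro Bochner_Integration.integral_sum) auto
      also have "\<dots> \<le> (\<Sum>i=m..<Suc q. c * \<rho> ^ i)" using osc(2) by (intro sum_mono) auto
      also have "\<dots> = c * (\<Sum>i=m..<m + (Suc q - m). \<rho> ^ i)"
      proof -
        have "m + (Suc q - m) = Suc q" using mq by simp
        then show ?thesis by (simp only: sum_distrib_left)
      qed
      also have "\<dots> \<le> c * (\<rho> ^ m / (1 - \<rho>))"
        using K(1) D unfolding c_def by (intro mult_left_mono sum_power_le rho) auto
      finally have 1: "(\<integral>\<omega>. (\<Sum>i=m..<Suc q. osc \<rho> p i (Zn n \<omega>)) \<partial>M) \<le> c * (\<rho> ^ m / (1 - \<rho>))" .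
      have "sqrt (real n) * (9 * d / 2 ^ q) \<le> 9 * d / a"
      proof -
        have "9 * d * (a * sqrt (real n)) \<le> 9 * d * 2 ^ q" using q(1) by (intro mult_left_mono) (auto simp: d_def)
        then show ?thesis using a(1) by (simp add: field_simps)
      qed
      moreover have "(\<integral>\<omega>. E \<omega> \<partial>M) = 2 * (\<integral>\<omega>. (\<Sum>i=m..<Suc q. osc \<rho> p i (Zn n \<omega>)) \<partial>M) + sqrt (real n) * (9 * d / 2 ^ q)"
      proof -
        have "integrable M (\<lambda>\<omega>. 2 * (\<Sum>i=m..<Suc q. osc \<rho> p i (Zn n \<omega>)))"
          using osc(1) by (intro integrable_mult_right Bochner_Integration.integrable_sum) auto
        then have "(\<integral>\<omega>. E \<omega> \<partial>M) = (\<integral>\<omega>. 2 * (\<Sum>i=m..<Suc q. osc \<rho> p i (Zn n \<omega>)) \<partial>M) + (\<integral>\<omega>. sqrt (real n) * (9 * d / 2 ^ q) \<partial>M)"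
          unfolding E_def by (intro Bochner_Integration.integral_add) auto
        then show ?thesis by (simp only: integral_mult_right_zero lebesgue_integral_const prob_space) simp
      qed
      ultimately show ?thesis using 1 by linarith
    qed
    have lV: "integrable M (\<lambda>\<omega>. ?l (V m (Zn n \<omega>)))"
    proof (rule integrable_const_bound[where B=B])
      show "(\<lambda>\<omega>. ?l (V m (Zn n \<omega>))) \<in> borel_measurable M"
        by (rule borel_measurable_continuous_family[OF lip_reg_V_continuous Zn_measurable]) simp
    qed (use b V_in_Dspace in auto)
    have gU: "integrable M (\<lambda>\<omega>. g (empirical_process M X n \<omega>))"
      by (rule integrable_const_bound[where B=B]) (use B empirical_in_Dspace empirical_measurable[OF g] in auto)
    \<comment> \<open>Pointwise, passing from the interpolation to the empirical process costs k E,
      and the regularisation lies below g. After integration only the mean of E remains, which is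
      what chaining controls.\<close>
    have "(\<integral>\<omega>. ?l (V m (Zn n \<omega>)) - real k * E \<omega> \<partial>M) \<le> (\<integral>\<omega>. g (empirical_process M X n \<omega>) \<partial>M)"
    proof (rule integral_mono)
      show "integrable M (\<lambda>\<omega>. ?l (V m (Zn n \<omega>)) - real k * E \<omega>)"
        using lV Ei by (intro Bochner_Integration.integrable_diff integrable_mult_right)
      show "integrable M (\<lambda>\<omega>. g (empirical_process M X n \<omega>))" by (rule gU)
      fix \<omega> assume w: "\<omega> \<in> space M"
      have "\<bar>V m (Zn n \<omega>) t - empirical_process M X n \<omega> t\<bar> \<le> E \<omega>" for t
        using empirical_V_bound[OF w mq, of n t] unfolding E_def d_def by (simp only: abs_minus_commute)
      then have "?l (V m (Zn n \<omega>)) - real k * E \<omega> \<le> ?l (empirical_process M X n \<omega>)"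
        by (intro lip_reg_lipschitz1[OF B _ V_in_Dspace empirical_in_Dspace]) simp_all
      also have "\<dots> \<le> g (empirical_process M X n \<omega>)"
        by (rule lip_reg_le[OF B _ empirical_in_Dspace]) simp_all
      finally show "?l (V m (Zn n \<omega>)) - real k * E \<omega> \<le> g (empirical_process M X n \<omega>)" .
    qed
    moreover have "(\<integral>\<omega>. ?l (V m (Zn n \<omega>)) - real k * E \<omega> \<partial>M) = (\<integral>\<omega>. ?l (V m (Zn n \<omega>)) \<partial>M) - real k * (\<integral>\<omega>. E \<omega> \<partial>M)"
      using lV Ei by simp
    moreover have "real k * (\<integral>\<omega>. E \<omega> \<partial>M) \<le> e / 8 + e / 8"
    proof -
      have "real k * (\<integral>\<omega>. E \<omega> \<partial>M) \<le> real k * (2 * (c * (\<rho> ^ m / (1 - \<rho>))) + 9 * d / a)"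
        by (intro mult_left_mono EE) simp
      also have "\<dots> = real k * (2 * (c * (\<rho> ^ m / (1 - \<rho>)))) + real k * (9 * d / a)" by (rule distrib_left)
      also have "\<dots> \<le> e / 8 + e / 8" using m(1) a(2) by (intro add_mono) auto
      finally show ?thesis .
    qed
    ultimately show ?case using k m(2) elim(1) unfolding dist_real_def abs_less_iff by linarith
  qed
qed

end

lemma empirical_convergence:
  assumes g: "skor_continuous g" and B: "\<And>x. x \<in> Dspace \<Longrightarrow> \<bar>g x\<bar> \<le> B"
  shows "(\<lambda>n. \<integral>\<omega>. g (empirical_process M X n \<omega>) \<partial>M) \<longlonglongrightarrow> (\<integral>\<omega>. g (W \<omega>) \<partial>P)"
proof (rule tendstoI)
  fix e :: real assume e: "0 < e"
  have lo: "\<forall>\<^sub>F n in sequentially. (\<integral>\<omega>. g (W \<omega>) \<partial>P) - e / 2 \<le> (\<integral>\<omega>. g (empirical_process M X n \<omega>) \<partial>M)"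
    by (rule empirical_lower_bound[OF g B]) (use e in auto)
  have hi: "\<forall>\<^sub>F n in sequentially. (\<integral>\<omega>. - g (W \<omega>) \<partial>P) - e / 2 \<le> (\<integral>\<omega>. - g (empirical_process M X n \<omega>) \<partial>M)"
    by (rule empirical_lower_bound[OF skor_continuous_uminus[OF g], of B]) (use e B in auto)
  from lo hi show "\<forall>\<^sub>F n in sequentially. dist (\<integral>\<omega>. g (empirical_process M X n \<omega>) \<partial>M) (\<integral>\<omega>. g (W \<omega>) \<partial>P) < e"
    by eventually_elim (use e in \<open>simp add: dist_real_def abs_less_iff\<close>)
qed

end

end

section \<open>The law of the limit on the Skorokhod space\<close>

context empirical_setup
begin

lemma empirical_process_clt:
  "\<exists>N :: (ereal^'d \<Rightarrow> real) measure.
           prob_space N \<and> space N = Dspace \<and>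
           centered_gaussian_process N (\<lambda>t \<omega>. \<omega> t) \<and>
           (AE \<omega> in N. continuous_on UNIV \<omega>) \<and>
           (\<forall>g. skor_continuous g \<and> (\<exists>B. \<forall>x\<in>Dspace. \<bar>g x\<bar> \<le> B) \<longrightarrow>
               g \<in> borel_measurable N \<and>
               (\<lambda>n. \<integral>\<omega>. g (empirical_process M X n \<omega>) \<partial>M) \<longlonglongrightarrow> (\<integral>x. g x \<partial>N))"
proof (rule gaussian_limit)
  fix P :: "(nat \<Rightarrow> real) measure" and Z
  assume PZ: "prob_space P" "\<And>s. Z s \<in> borel_measurable P"
    "\<And>S c. finite S \<Longrightarrow> \<exists>\<sigma>\<ge>0. distr P borel (\<lambda>\<omega>. \<Sum>s\<in>S. c s * Z s \<omega>) = normal_law \<sigma>"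
    "\<And>S c. finite S \<Longrightarrow> weak_conv_m (\<lambda>n. distr M borel (\<lambda>\<omega>. \<Sum>s\<in>S. c s * Zn n \<omega> s))
        (distr P borel (\<lambda>\<omega>. \<Sum>s\<in>S. c s * Z s \<omega>))"
  interpret L: empirical_limit M X \<alpha> \<beta> \<gamma> r p \<kappa> lam z0 \<Phi> C P Z
  proof (intro empirical_limit.intro empirical_limit_axioms.intro)
    show "empirical_setup M X \<alpha> \<beta> \<gamma> r p \<kappa> lam z0 \<Phi> C" by (rule empirical_setup_axioms)
  qed (fact PZ)+
  obtain K where K: "\<And>k. integrable P (\<lambda>\<omega>. osc \<rho> p k (\<lambda>s. Z s \<omega>))"
    "\<And>k. (\<integral>\<omega>. osc \<rho> p k (\<lambda>s. Z s \<omega>) \<partial>P) \<le> K * \<rho> ^ k"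
    using L.limit_osc by blast
  show ?thesis
  proof (rule limit_process[where P=P and Z=Z and K=K, OF PZ(1,2) K])
    fix A W
    assume AW: "A \<in> sets P" "AE \<omega> in P. \<omega> \<in> A"
      "\<And>\<omega>. \<omega> \<in> A \<Longrightarrow> \<exists>R. R \<longlonglongrightarrow> 0 \<and> (\<forall>m t. \<bar>V m (\<lambda>s. Z s \<omega>) t - W \<omega> t\<bar> \<le> R m)"
      "\<And>\<omega>. \<omega> \<notin> A \<Longrightarrow> W \<omega> = (\<lambda>_. 0)" "\<And>\<omega>. continuous_on UNIV (W \<omega>)"
    note W_D = L.W_in_Dspace[OF AW]
    \<comment> \<open>Transport to \<open>Dspace\<close> turns paths into sample points, so that the
      coordinate maps become the limit process.\<close>
    show ?thesis
    proof (rule pushforward_exists[of P W Dspace, OF PZ(1) W_D])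
      fix N
      assume N: "prob_space N" "space N = Dspace"
        "\<And>f :: _ \<Rightarrow> real. (\<lambda>\<omega>. f (W \<omega>)) \<in> borel_measurable P \<Longrightarrow>
           f \<in> borel_measurable N \<and> integral\<^sup>L N f = (\<integral>\<omega>. f (W \<omega>) \<partial>P) \<and> distr N borel f = distr P borel (\<lambda>\<omega>. f (W \<omega>))"
        "\<And>A. (\<And>\<omega>. \<omega> \<in> space P \<Longrightarrow> W \<omega> \<in> A) \<Longrightarrow> AE x in N. x \<in> A"
      note Wm = L.W_coordinate_measurable[OF AW]
      have "centered_gaussian_process N (\<lambda>t \<omega>. \<omega> t)"
        unfolding centered_gaussian_process_def centered_gaussian_rv_def
      proof (intro conjI allI impI)
        show "(\<lambda>\<omega>. \<omega> t) \<in> borel_measurable N" for t using N(3)[of "\<lambda>\<omega>. \<omega> t"] Wm by blast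
        fix T :: "(ereal^'d) set" and c assume T: "finite T"
        have "(\<lambda>\<omega>. \<Sum>t\<in>T. c t * W \<omega> t) \<in> borel_measurable P"
          using Wm by (intro borel_measurable_sum borel_measurable_times borel_measurable_const)
        from N(3)[OF this] L.W_gaussian[OF AW T, of c]
        show "(\<lambda>\<omega>. \<Sum>t\<in>T. c t * \<omega> t) \<in> borel_measurable N"
          "\<exists>\<sigma>\<ge>0. distr N borel (\<lambda>\<omega>. \<Sum>t\<in>T. c t * \<omega> t) = normal_law \<sigma>" by auto
      qed
      moreover have "AE \<omega> in N. continuous_on UNIV \<omega>"
        using N(4)[of "{x. continuous_on UNIV x}"] AW(5) by simp
      moreover have "g \<in> borel_measurable N \<and>
           (\<lambda>n. \<integral>\<omega>. g (empirical_process M X n \<omega>) \<partial>M) \<longlonglongrightarrow> (\<integral>x. g x \<partial>N)"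
        if g: "skor_continuous g \<and> (\<exists>B. \<forall>x\<in>Dspace. \<bar>g x\<bar> \<le> B)" for g :: "(ereal^'d \<Rightarrow> real) \<Rightarrow> real"
      proof -
        obtain B where B: "\<And>x. x \<in> Dspace \<Longrightarrow> \<bar>g x\<bar> \<le> B" using g by blast
        note gN = N(3)[OF L.g_W_measurable[OF AW conjunct1[OF g]]]
        have "(\<lambda>n. \<integral>\<omega>. g (empirical_process M X n \<omega>) \<partial>M) \<longlonglongrightarrow> (\<integral>\<omega>. g (W \<omega>) \<partial>P)"
          by (rule L.empirical_convergence[OF AW conjunct1[OF g] B])
        then show ?thesis using gN by simp
      qed
      ultimately show ?thesis using N(1,2) by blast
    qed
  qed
qed

end

theorem theorem3:
  fixes M :: "'a measure" and X :: "nat \<Rightarrow> 'a \<Rightarrow> real^'d" and \<alpha> :: real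
  assumes prob: "prob_space M"
    and meas: "\<forall>i. X i \<in> borel_measurable M"
    and stat: "stationary M X"
    and contF: "continuous_on UNIV (dfun M X)"
    and alpha: "0 < \<alpha>" "\<alpha> \<le> 1"
    and clt: "\<forall>f\<in>holder_space \<alpha>. (\<integral>\<omega>. f (X 0 \<omega>) \<partial>M) = 0 \<longrightarrow>
               (\<exists>\<sigma>\<ge>0. weak_conv_m
                    (\<lambda>n. distr M borel (\<lambda>\<omega>. (\<Sum>i=1..n. f (X i \<omega>)) / sqrt (real n)))
                    (normal_law \<sigma>))"
    and moment: "\<exists>\<beta> \<gamma> r (p::nat) \<kappa> lam z0 \<Phi> C.
       \<beta> > 0 \<and> \<gamma> > 1 \<and> r \<ge> 1 \<and> real p > r * real CARD('d) \<and>
       (\<forall>i\<in>{1..p}. \<kappa> i > 0 \<and>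
          \<kappa> i < \<gamma> * (real i / r + 2 * (real p - real i) - real CARD('d))) \<and>
       lam > 1 \<and> z0 > 0 \<and>
       bij_betw \<Phi> {0::real..} {0::real..} \<and> mono_on {0..} \<Phi> \<and>
       (\<forall>y>0. modulus (dfun M X) y \<le> \<beta> * (\<Phi> (y powr (- \<alpha>))) powr (- \<gamma>)) \<and>
       (\<forall>z\<ge>z0. \<Phi> (2 * z) \<le> lam * \<Phi> z) \<and>
       C > 0 \<and>
       (\<forall>f\<in>holder_space \<alpha>. sup_norm f \<le> 1 \<longrightarrow> (\<forall>n::nat. n \<ge> 1 \<longrightarrow>
          (let m = (\<integral>\<omega>. f (X 0 \<omega>) \<partial>M) in
            (\<integral>\<omega>. \<bar>\<Sum>i=1..n. f (X i \<omega>) - m\<bar> ^ (2 * p) \<partial>M)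
            \<le> C * (\<Sum>i=1..p. real n ^ i
                    * ((\<integral>\<omega>. \<bar>f (X 0 \<omega>) - m\<bar> powr r \<partial>M) powr (1 / r)) ^ i
                    * (\<Phi> (holder_norm \<alpha> (\<lambda>x. f x - m))) powr (\<kappa> i)))))"
  shows "\<exists>N :: (ereal^'d \<Rightarrow> real) measure.
           prob_space N \<and> space N = Dspace \<and>
           centered_gaussian_process N (\<lambda>t \<omega>. \<omega> t) \<and>
           (AE \<omega> in N. continuous_on UNIV \<omega>) \<and>
           (\<forall>g. skor_continuous g \<and> (\<exists>B. \<forall>x\<in>Dspace. \<bar>g x\<bar> \<le> B) \<longrightarrow>
               g \<in> borel_measurable N \<and>
               (\<lambda>n. \<integral>\<omega>. g (empirical_process M X n \<omega>) \<partial>M) \<longlonglongrightarrow> (\<integral>x. g x \<partial>N))"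
  using moment
proof (elim exE conjE)
  fix \<beta> \<gamma> r :: real and p :: nat and \<kappa> :: "nat \<Rightarrow> real" and lam z0 :: real and \<Phi> :: "real \<Rightarrow> real" and C :: real
  assume par: "\<beta> > 0" "\<gamma> > 1" "r \<ge> 1" "real p > r * real CARD('d)"
      "\<forall>i\<in>{1..p}. \<kappa> i > 0 \<and> \<kappa> i < \<gamma> * (real i / r + 2 * (real p - real i) - real CARD('d))"
      "lam > 1" "z0 > 0" "bij_betw \<Phi> {0::real..} {0::real..}" "mono_on {0..} \<Phi>"
      "\<forall>y>0. modulus (dfun M X) y \<le> \<beta> * (\<Phi> (y powr (- \<alpha>))) powr (- \<gamma>)"
      "\<forall>z\<ge>z0. \<Phi> (2 * z) \<le> lam * \<Phi> z" "C > 0"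
    and mom: "\<forall>f\<in>holder_space \<alpha>. sup_norm f \<le> 1 \<longrightarrow> (\<forall>n::nat. n \<ge> 1 \<longrightarrow>
          (let m = (\<integral>\<omega>. f (X 0 \<omega>) \<partial>M) in
            (\<integral>\<omega>. \<bar>\<Sum>i=1..n. f (X i \<omega>) - m\<bar> ^ (2 * p) \<partial>M)
            \<le> C * (\<Sum>i=1..p. real n ^ i
                    * ((\<integral>\<omega>. \<bar>f (X 0 \<omega>) - m\<bar> powr r \<partial>M) powr (1 / r)) ^ i
                    * (\<Phi> (holder_norm \<alpha> (\<lambda>x. f x - m))) powr (\<kappa> i))))"
  have "empirical_setup M X \<alpha> \<beta> \<gamma> r p \<kappa> lam z0 \<Phi> C"
    by (intro empirical_setup.intro empirical_setup_axioms.intro prob)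
      (use meas alpha clt par mom[unfolded Let_def] in blast)+
  then show ?thesis by (rule empirical_setup.empirical_process_clt)
qed

end
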